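(* The variable-round Dealer's choice pile shuffle sort problem is NP-hard. That is: the decision problem whose instances are pairs $(\sigma,(m_1,\dots,m_T))$, with $\sigma$ a permutation of $[n]$ for some $n\ge 0$, $T\ge 0$ and integers $m_1,\dots,m_T\ge 1$, and whose question is "does there exist a type schedule $X=(\psi_1,\dots,\psi_T)$ with $\psi_t\in\{\mathtt q,\mathtt s\}^{m_t}$ for each $t$ that sorts $\sigma$?", is NP-hard.
   Context: Pile shuffle model. A deck of $n$ distinct cards labelled $1,\dots,n$ is represented by a permutation $\sigma$ of $[n]=\{1,\dots,n\}$, where $\sigma(s)$ is the position (counted from the top) of the card labelled $s$; the deck is sorted when $\sigma$ is the identity. Pile types form the alphabet $\Sigma=\{\mathtt q,\mathtt s\}$ (queue, stack). One round of pile shuffle on $m$ piles is given by a type assignment $\psi=\psi(1)\cdots\psi(m)\in\Sigma^m$ and a pile assignment $p:[n]\to[m]$: cards are dealt from the top of the deck one at a time, card $s$ being placed on pile $p(s)$; afterwards piles are collected in the order $1,2,\dots,m$, each placed under the previously collected ones, forming the new deck. A queue keeps the relative order its cards had in the old deck; a stack reverses it. Formally the new deck $\tau$ satisfies, for labels $s\neq t$: $\tau(s)<\tau(t)$ iff either $p(s)<p(t)$, or $p(s)=p(t)$, $\psi(p(s))=\mathtt q$ and $\sigma(s)<\sigma(t)$, or $p(s)=p(t)$, $\psi(p(s))=\mathtt s$ and $\sigma(s)>\sigma(t)$. A multi-round shuffle with type schedule $X=(\psi_1,\dots,\psi_T)$, $\psi_t\in\Sigma^{m_t}$, applies rounds $(\psi_1,p_1),\dots,(\psi_T,p_T)$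 in succession, the output deck of each round being the input deck of the next. The schedule $X$ sorts $\sigma$ if there exist pile assignments $p_t:[n]\to[m_t]$ ($1\le t\le T$) such that the final deck is the identity permutation (for $T=0$ this means $\sigma$ is the identity). NP-hardness is with respect to polynomial-time many-one reductions. *)

theory Defs
  imports
    "HOL-Library.FuncSet"
    "HOL-Combinatorics.Permutations"
    "HOL-Computational_Algebra.Polynomial"
begin

section \<open>Multi-tape Turing machines, NP and polynomial-time many-one reductions\<close>

text \<open>
  Languages are sets of bit strings. States and tape symbols are natural numbers; symbol 0 is the
  blank, and symbols 1 and 2 stand for the input/output bits 0 and 1. Only finitely many states
  and symbols matter for a given machine, because its set of rules is required to be finite.
  A rule \<open>(q, rs, q', ws, ds)\<close> reads: in state \<open>q\<close>, with the heads scanning the symbols \<open>rs\<close>,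
  go to state \<open>q'\<close>, write the symbols \<open>ws\<close> and move the heads according to \<open>ds\<close> (one list entry
  per tape). Several rules may share \<open>(q, rs)\<close>, so machines are nondeterministic in general.
\<close>

datatype head_move = Move_Left | Stay | Move_Right

record tm =
  num_tapes :: nat
  start_state :: nat
  accept_state :: nat
  rules :: "(nat \<times> nat list \<times> nat \<times> nat list \<times> head_move list) set"

definition wf_tm :: "tm \<Rightarrow> bool" where
  "wf_tm M \<longleftrightarrow> num_tapes M \<ge> 1 \<and> finite (rules M) \<and>
     (\<forall>(q, rs, q', ws, ds) \<in> rules M.
        q \<noteq> accept_state M \<and>
        length rs = num_tapes M \<and> length ws = num_tapes M \<and> length ds = num_tapes M)"

definition deterministic :: "tm \<Rightarrow> bool" where
  "deterministic M \<longleftrightarrow>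
     (\<forall>q rs a b. (q, rs, a) \<in> rules M \<and> (q, rs, b) \<in> rules M \<longrightarrow> a = b)"

text \<open>
  Tapes are one-way infinite; a tape is given by its contents and its head position.
  Moving left on cell 0 leaves the head where it is (truncated subtraction).
\<close>

type_synonym tape = "(nat \<Rightarrow> nat) \<times> nat"
type_synonym config = "nat \<times> tape list"

fun move_head :: "head_move \<Rightarrow> nat \<Rightarrow> nat" where
  "move_head Move_Left h = h - 1"
| "move_head Stay h = h"
| "move_head Move_Right h = h + 1"

definition scanned :: "tape \<Rightarrow> nat" where
  "scanned = (\<lambda>(t, h). t h)"

definition act :: "tape \<Rightarrow> nat \<times> head_move \<Rightarrow> tape" where
  "act = (\<lambda>(t, h) (w, d). (t(h := w), move_head d h))"

inductive step :: "tm \<Rightarrow> config \<Rightarrow> config \<Rightarrow> bool" for M where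
  "(q, map scanned ts, q', ws, ds) \<in> rules M \<Longrightarrow>
     step M (q, ts) (q', map2 act ts (zip ws ds))"

definition bit_symbol :: "bool \<Rightarrow> nat" where
  "bit_symbol b = (if b then 2 else 1)"

definition initial_config :: "tm \<Rightarrow> bool list \<Rightarrow> config" where
  "initial_config M x =
     (start_state M,
      (\<lambda>i. if i < length x then bit_symbol (x ! i) else 0, 0)
        # replicate (num_tapes M - 1) (\<lambda>_. 0, 0))"

text \<open>
  The output is the bit string on the last tape, read from cell 0 up to the first blank.
\<close>

definition has_output :: "config \<Rightarrow> bool list \<Rightarrow> bool" where
  "has_output c y \<longleftrightarrow>
     (let t = fst (last (snd c))
      in (\<forall>i < length y. t i = bit_symbol (y ! i)) \<and> t (length y) = 0)"

definition halted :: "tm \<Rightarrow> config \<Rightarrow> bool" where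
  "halted M c \<longleftrightarrow> \<not> (\<exists>c'. step M c c')"

definition accepts :: "tm \<Rightarrow> bool list \<Rightarrow> bool" where
  "accepts M x \<longleftrightarrow> (\<exists>c. (step M)\<^sup>*\<^sup>* (initial_config M x) c \<and> fst c = accept_state M)"

definition NP :: "bool list set set" where
  "NP = {L. \<exists>M (p :: nat poly). wf_tm M \<and>
     (\<forall>x n c. (step M ^^ n) (initial_config M x) c \<longrightarrow> n \<le> poly p (length x)) \<and>
     (\<forall>x. x \<in> L \<longleftrightarrow> accepts M x)}"

definition polytime_computable :: "(bool list \<Rightarrow> bool list) \<Rightarrow> bool" where
  "polytime_computable f \<longleftrightarrow> (\<exists>M (p :: nat poly). wf_tm M \<and> deterministic M \<and>
     (\<forall>x. \<exists>n c. n \<le> poly p (length x) \<and> (step M ^^ n) (initial_config M x) c \<and>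
        halted M c \<and> has_output c (f x)))"

definition polytime_reducible :: "bool list set \<Rightarrow> bool list set \<Rightarrow> bool" (infix "\<le>\<^sub>p" 50) where
  "A \<le>\<^sub>p B \<longleftrightarrow> (\<exists>f. polytime_computable f \<and> (\<forall>x. x \<in> A \<longleftrightarrow> f x \<in> B))"

definition NP_hard :: "bool list set \<Rightarrow> bool" where
  "NP_hard B \<longleftrightarrow> (\<forall>A \<in> NP. A \<le>\<^sub>p B)"


section \<open>Pile shuffles\<close>

datatype pile_type = Queue | Stack

text \<open>
  A deck of \<open>n\<close> cards is a permutation \<open>\<sigma>\<close> of \<open>{1..n}\<close> mapping labels to positions. A type
  assignment for \<open>m\<close> piles is a list of length \<open>m\<close>; the type of pile \<open>j \<in> {1..m}\<close> is \<open>\<psi> ! (j - 1)\<close>.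
\<close>

definition pile_round ::
  "nat \<Rightarrow> pile_type list \<Rightarrow> (nat \<Rightarrow> nat) \<Rightarrow> (nat \<Rightarrow> nat) \<Rightarrow> (nat \<Rightarrow> nat) \<Rightarrow> bool" where
  "pile_round n \<psi> p \<sigma> \<tau> \<longleftrightarrow> \<tau> permutes {1..n} \<and>
     (\<forall>s \<in> {1..n}. \<forall>t \<in> {1..n}. s \<noteq> t \<longrightarrow>
        (\<tau> s < \<tau> t \<longleftrightarrow>
           p s < p t \<or>
           p s = p t \<and> \<psi> ! (p s - 1) = Queue \<and> \<sigma> s < \<sigma> t \<or>
           p s = p t \<and> \<psi> ! (p s - 1) = Stack \<and> \<sigma> s > \<sigma> t))"

lemma pile_round_ex1:
  assumes \<sigma>: "\<sigma> permutes {1..n}"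
  shows "\<exists>!\<tau>. pile_round n \<psi> p \<sigma> \<tau>"
proof -
  define r where "r s t \<longleftrightarrow> p s < p t \<or>
           p s = p t \<and> \<psi> ! (p s - 1) = Queue \<and> \<sigma> s < \<sigma> t \<or>
           p s = p t \<and> \<psi> ! (p s - 1) = Stack \<and> \<sigma> s > \<sigma> t" for s t
  define rank where "rank s = card {t \<in> {1..n}. r t s} + 1" for s
  define \<tau> where "\<tau> s = (if s \<in> {1..n} then rank s else s)" for s
  have inj: "\<sigma> s \<noteq> \<sigma> t" if "s \<noteq> t" for s t
    using permutes_inj[OF \<sigma>] that by (simp add: inj_eq)
  have irrefl: "\<not> r s s" for s by (auto simp: r_def)
  have trans: "r s u" if "r s t" "r t u" for s t u using that by (auto simp: r_def)
  have total: "r s t \<or> r t s" if "s \<noteq> t" for s t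
    using inj[OF that] pile_type.exhaust[of "\<psi> ! (p s - 1)"]
    unfolding r_def by (metis linorder_neqE_nat)
  have mono: "rank s < rank t" if "r s t" "s \<in> {1..n}" for s t
  proof -
    have "{u \<in> {1..n}. r u s} \<subset> {u \<in> {1..n}. r u t}"
      using that trans irrefl by blast
    then show ?thesis unfolding rank_def by (simp add: psubset_card_mono)
  qed
  have iff: "\<tau> s < \<tau> t \<longleftrightarrow> r s t" if "s \<in> {1..n}" "t \<in> {1..n}" "s \<noteq> t" for s t
    using mono[of s t] mono[of t s] total[of s t] that by (auto simp: \<tau>_def)
  have range: "rank s \<in> {1..n}" if "s \<in> {1..n}" for s
  proof -
    have "{t \<in> {1..n}. r t s} \<subset> {1..n}" using that irrefl by blast
    then have "card {t \<in> {1..n}. r t s} < card {1..n}" by (rule psubset_card_mono[rotated]) simp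
    then show ?thesis by (simp add: rank_def)
  qed
  have "inj_on rank {1..n}"
    by (rule inj_onI) (metis mono total less_irrefl)
  moreover from this have "rank ` {1..n} = {1..n}"
    using range by (intro endo_inj_surj) auto
  ultimately have "bij_betw rank {1..n} {1..n}" by (simp only: bij_betw_def)
  then have "bij_betw \<tau> {1..n} {1..n}"
    by (rule bij_betw_cong[THEN iffD2, rotated]) (simp add: \<tau>_def)
  then have "\<tau> permutes {1..n}"
    by (rule bij_imp_permutes) (auto simp: \<tau>_def)
  with iff have ex: "pile_round n \<psi> p \<sigma> \<tau>"
    unfolding pile_round_def r_def by blast
  have "\<tau>' = \<tau>" if "pile_round n \<psi> p \<sigma> \<tau>'" for \<tau>'
  proof
    fix s
    have perm: "\<tau>' permutes {1..n}" and iff':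
      "\<And>s t. s \<in> {1..n} \<Longrightarrow> t \<in> {1..n} \<Longrightarrow> s \<noteq> t \<Longrightarrow> \<tau>' s < \<tau>' t \<longleftrightarrow> r s t"
      using that unfolding pile_round_def r_def by blast+
    show "\<tau>' s = \<tau> s"
    proof (cases "s \<in> {1..n}")
      case True
      then have in_range: "\<tau>' s \<in> {1..n}" using perm by (simp only: permutes_in_image)
      have "{t \<in> {1..n}. r t s} = {t \<in> {1..n}. \<tau>' t < \<tau>' s}"
        using iff' True irrefl by (metis (lifting) less_irrefl)
      moreover have "\<tau>' ` {t \<in> {1..n}. \<tau>' t < \<tau>' s} = {1..<\<tau>' s}"
      proof -
        have "\<tau>' ` {t \<in> {1..n}. \<tau>' t < \<tau>' s} = {u \<in> \<tau>' ` {1..n}. u < \<tau>' s}" by blast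
        also have "\<dots> = {1..<\<tau>' s}" unfolding permutes_image[OF perm] using in_range by auto
        finally show ?thesis .
      qed
      then have "card {t \<in> {1..n}. \<tau>' t < \<tau>' s} = \<tau>' s - 1"
        by (metis card_atLeastLessThan card_image inj_on_subset permutes_inj[OF perm] subset_UNIV)
      ultimately show ?thesis using True in_range by (simp add: \<tau>_def rank_def)
    next
      case False
      then show ?thesis unfolding \<tau>_def using permutes_not_in[OF perm] by auto
    qed
  qed
  with ex show ?thesis by blast
qed

inductive pile_shuffle ::
  "nat \<Rightarrow> (pile_type list \<times> (nat \<Rightarrow> nat)) list \<Rightarrow> (nat \<Rightarrow> nat) \<Rightarrow> (nat \<Rightarrow> nat) \<Rightarrow> bool"
  for n where
  no_round: "pile_shuffle n [] \<sigma> \<sigma>"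
| more_rounds: "pile_round n \<psi> p \<sigma> \<rho> \<Longrightarrow> pile_shuffle n rest \<rho> \<tau> \<Longrightarrow>
     pile_shuffle n ((\<psi>, p) # rest) \<sigma> \<tau>"

definition sorts :: "nat \<Rightarrow> pile_type list list \<Rightarrow> (nat \<Rightarrow> nat) \<Rightarrow> bool" where
  "sorts n X \<sigma> \<longleftrightarrow> (\<exists>ps. length ps = length X \<and>
     (\<forall>t < length X. ps ! t \<in> {1..n} \<rightarrow> {1..length (X ! t)}) \<and>
     pile_shuffle n (zip X ps) \<sigma> id)"


section \<open>The decision problem as a language\<close>

text \<open>
  Numbers are written in binary, least significant digit first (0 is the empty numeral).
  To obtain a bit string, a digit \<open>b\<close> becomes \<open>1b\<close>, the end of a number \<open>00\<close>, the end of a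
  list \<open>01\<close>.
\<close>

fun binary :: "nat \<Rightarrow> bool list" where
  "binary n = (if n = 0 then [] else odd n # binary (n div 2))"

declare binary.simps [simp del]

definition encode_nat :: "nat \<Rightarrow> bool list" where
  "encode_nat n = concat (map (\<lambda>b. [True, b]) (binary n)) @ [False, False]"

definition encode_list :: "nat list \<Rightarrow> bool list" where
  "encode_list xs = concat (map encode_nat xs) @ [False, True]"

definition encode_instance :: "nat \<Rightarrow> (nat \<Rightarrow> nat) \<Rightarrow> nat list \<Rightarrow> bool list" where
  "encode_instance n \<sigma> ms = encode_list (map \<sigma> [1..<n + 1]) @ encode_list ms"

definition dealers_choice_sort :: "bool list set" where
  "dealers_choice_sort =
     {encode_instance n \<sigma> ms | n \<sigma> ms.
        \<sigma> permutes {1..n} \<and> (\<forall>m \<in> set ms. m \<ge> 1) \<and>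
        (\<exists>X. length X = length ms \<and> (\<forall>t < length ms. length (X ! t) = ms ! t) \<and> sorts n X \<sigma>)}"

text \<open>
  The encoding is injective on instances, so membership of a code in the language depends only
  on the instance it encodes.
\<close>

lemma binary_inj: "binary m = binary n \<Longrightarrow> m = n"
proof (induction m arbitrary: n rule: binary.induct)
  case (1 m)
  show ?case
  proof (cases "m = 0 \<or> n = 0")
    case True
    with "1.prems" show ?thesis
      by (subst (asm) (1 2) binary.simps) (auto split: if_splits)
  next
    case False
    with "1.prems" have *: "odd m = odd n" "binary (m div 2) = binary (n div 2)"
      by (metis binary.simps list.inject)+
    with "1.IH" False have "m div 2 = n div 2" by blast
    with *(1) show ?thesis by (metis bit_eq_rec)
  qed
qed

lemma encode_digits_prefix:
  "concat (map (\<lambda>b. [True, b]) bs) @ False # us = concat (map (\<lambda>b. [True, b]) cs) @ False # vs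
   \<Longrightarrow> bs = cs \<and> us = vs"
proof (induction bs arbitrary: cs)
  case Nil
  then show ?case by (cases cs) auto
next
  case (Cons b bs)
  then show ?case by (cases cs) auto
qed

lemma encode_nat_prefix: "encode_nat m @ us = encode_nat n @ vs \<Longrightarrow> m = n \<and> us = vs"
  using encode_digits_prefix[of "binary m" "False # us" "binary n" "False # vs"] binary_inj
  by (auto simp: encode_nat_def)

lemma encode_nat_not_end: "encode_nat n @ us \<noteq> False # True # vs"
  by (cases "binary n") (auto simp: encode_nat_def)

lemma encode_list_prefix: "encode_list xs @ us = encode_list ys @ vs \<Longrightarrow> xs = ys \<and> us = vs"
proof (induction xs arbitrary: ys)
  case Nil
  then show ?case
    by (cases ys) (auto simp: encode_list_def dest: encode_nat_not_end[THEN notE, OF sym])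
next
  case (Cons x xs)
  show ?case
  proof (cases ys)
    case Nil
    with Cons.prems show ?thesis
      by (auto simp: encode_list_def encode_nat_not_end)
  next
    case (Cons y zs)
    with Cons.prems have "encode_nat x @ (encode_list xs @ us) = encode_nat y @ (encode_list zs @ vs)"
      by (simp add: encode_list_def)
    from encode_nat_prefix[OF this] Cons.IH[of zs] Cons show ?thesis by auto
  qed
qed

lemma encode_instance_inj:
  assumes "\<sigma> permutes {1..n}" "\<sigma>' permutes {1..n'}"
    and "encode_instance n \<sigma> ms = encode_instance n' \<sigma>' ms'"
  shows "n = n' \<and> \<sigma> = \<sigma>' \<and> ms = ms'"
proof -
  from assms(3) have eq: "map \<sigma> [1..<n + 1] = map \<sigma>' [1..<n' + 1]"
    and rest: "encode_list ms = encode_list ms'"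
    unfolding encode_instance_def using encode_list_prefix by blast+
  from rest have ms: "ms = ms'" using encode_list_prefix[of ms "[]" ms' "[]"] by simp
  from arg_cong[OF eq, of length] have n: "n = n'" by (simp del: upt_Suc)
  have "\<sigma> s = \<sigma>' s" for s
  proof (cases "s \<in> {1..n}")
    case True
    then show ?thesis using eq n by (auto simp: map_eq_conv simp del: upt_Suc)
  next
    case False
    then show ?thesis using assms(1,2) n by (metis permutes_not_in)
  qed
  with n ms show ?thesis by auto
qed

end

theory Submission
  imports Defs "HOL-Library.Countable_Set" "HOL-Library.Sublist"
begin

text \<open>
  Rounds compose: two rounds amount to a single one whose type word is obtained from the second
  word by replacing every queue by the first word and every stack by its reversed complement.
  A single round sorts a deck if and only if its type word, read letter by letter, eats the word
  of ascents and descents of the deck, where a letter eats the initial run of letters equal to it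
  and the letter after that run.
  The instances have three rounds with 6, \<open>n + 3\<close> and \<open>m\<close> piles. Their ascent words consist of
  single letters and of runs too long to be skipped. They begin with so many copies of a frame
  that some copy must be eaten by few letters, which forces the first round to be one of two words
  of length 6 that are reversed complements of each other; they serve as the truth values, and the
  second round is then an assignment to \<open>n\<close> variables. Each clause is a further piece of the
  ascent word that one block of the third round eats if and only if the assignment satisfies it.

  The clauses say that an accepting computation of a given machine, seen as a tiling of a square,
  exists. The deck is written down by a bounded number of nested loops over the (padded) input, where
  a loop is an operation that replaces a word by the concatenation of its copies with one marked
  position each. Together with finite transducers and a conversion from unary to binary, this is
  all that has to be run on a Turing machine.
\<close>

section \<open>Structured programs for Turing machines\<close>

text \<open>Every type is the dealer's to choose, so no round offers a fixed piece to start from;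
  rigidity comes from counting letters. Each pile of the third round contributes a block of exactly
  \<open>6 * (n + 3)\<close> letters, which is also the least number that gets through one frame. If
  the first word is not an intended one, the key at the head of the frame never occurs in the
  composed word, every copy of the frame costs one extra letter, and there are at least as many
  copies as the blocks meant for the clauses have letters; nothing is left for the clauses. With an
  intended word the frames use up their blocks, each clause costs at least one block, and so each
  clause is read by exactly one block. The \<open>n + 3\<close> letters of the second word are
  \<open>True\<close>, \<open>False\<close>, the \<open>n\<close> values, \<open>True\<close>. The
  first two spell the key. The first and the last are tested by every clause; as a block and its
  reversed complement cannot both begin and end with \<open>True\<close>, all clauses see the same
  assignment.\<close>

datatype com =
    Act nat "nat option" head_move
  | Seq com com
  | Case nat "com list"
  | While nat "com list"

instance head_move :: countable by countable_datatype
instance com :: countable by countable_datatype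

type_synonym tapes = "nat \<Rightarrow> tape"

text \<open>Control is the list of commands still to be run; these lists become the states.
  \<open>Case\<close> and \<open>While\<close> look up a branch by the scanned symbol. A symbol
  outside the table falls through, and \<open>While\<close> also stops on the blank, so a loop over
  a stack ends when the stack is empty.\<close>

fun nxt :: "(nat \<Rightarrow> nat) \<Rightarrow> com \<Rightarrow> com list \<Rightarrow> com list" where
  "nxt r (Act i w d) K = K"
| "nxt r (Seq a b) K = a # b # K"
| "nxt r (Case i bs) K = (if r i < length bs then bs ! r i # K else K)"
| "nxt r (While i bs) K =
    (if r i \<noteq> 0 \<and> r i < length bs then bs ! r i # While i bs # K else K)"

fun perform :: "com \<Rightarrow> tapes \<Rightarrow> tapes" where
  "perform (Act i w d) s =
    s(i := act (s i) (case w of None \<Rightarrow> scanned (s i) | Some v \<Rightarrow> v, d))"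
| "perform c s = s"

fun cstep :: "com list \<times> tapes \<Rightarrow> com list \<times> tapes" where
  "cstep (c # K, s) = (nxt (\<lambda>i. scanned (s i)) c K, perform c s)"
| "cstep ([], s) = ([], s)"

text \<open>The run must not depend on the commands \<open>K\<close> waiting behind
  \<open>c\<close>; this is what allows timed runs to be chained.\<close>

definition does :: "com \<Rightarrow> tapes \<Rightarrow> nat \<Rightarrow> tapes \<Rightarrow> bool" where
  "does c s B t \<longleftrightarrow> (\<exists>n \<le> B. \<forall>K. (cstep ^^ n) (c # K, s) = (K, t))"

lemma does_mono: "does c s B t \<Longrightarrow> B \<le> B' \<Longrightarrow> does c s B' t"
  unfolding does_def by (meson order_trans)

lemma does_Act:
  "does (Act i w d) s 1 (s(i := act (s i) (case w of None \<Rightarrow> scanned (s i) | Some v \<Rightarrow> v, d)))"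
  unfolding does_def by (intro exI[of _ 1]) auto

lemma does_Seq:
  assumes "does a s B t" "does b t B' u"
  shows "does (Seq a b) s (B + B' + 1) u"
proof -
  obtain n m where n: "n \<le> B" "\<And>K. (cstep ^^ n) (a # K, s) = (K, t)"
    and m: "m \<le> B'" "\<And>K. (cstep ^^ m) (b # K, t) = (K, u)"
    using assms unfolding does_def by metis
  have "(cstep ^^ (m + n + 1)) (Seq a b # K, s) = (K, u)" for K
    by (simp only: funpow_add o_apply) (simp add: n m)
  moreover have "m + n + 1 \<le> B + B' + 1" using n m by simp
  ultimately show ?thesis unfolding does_def by blast
qed

lemma does_Case:
  assumes "scanned (s i) < length bs" "does (bs ! scanned (s i)) s B t"
  shows "does (Case i bs) s (B + 1) t"
proof -
  obtain n where n: "n \<le> B" "\<And>K. (cstep ^^ n) (bs ! scanned (s i) # K, s) = (K, t)"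
    using assms unfolding does_def by metis
  have "(cstep ^^ (n + 1)) (Case i bs # K, s) = (K, t)" for K
    by (simp only: funpow_add o_apply) (simp add: n assms)
  then show ?thesis unfolding does_def using n(1) by (meson add_le_mono1)
qed

lemma does_While_stop:
  assumes "scanned (s i) = 0"
  shows "does (While i bs) s 1 s"
  unfolding does_def by (intro exI[of _ 1]) (simp add: assms)

lemma does_While_iter:
  assumes "scanned (s i) \<noteq> 0" "scanned (s i) < length bs" "does (bs ! scanned (s i)) s B t"
    "does (While i bs) t B' u"
  shows "does (While i bs) s (B + B' + 1) u"
proof -
  obtain n m where n: "n \<le> B" "\<And>K. (cstep ^^ n) (bs ! scanned (s i) # K, s) = (K, t)"
    and m: "m \<le> B'" "\<And>K. (cstep ^^ m) (While i bs # K, t) = (K, u)"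
    using assms unfolding does_def by metis
  have "(cstep ^^ (m + n + 1)) (While i bs # K, s) = (K, u)" for K
    by (simp only: funpow_add o_apply) (simp add: n m assms)
  moreover have "m + n + 1 \<le> B + B' + 1" using n m by simp
  ultimately show ?thesis unfolding does_def by blast
qed

section \<open>Reachable continuations\<close>

fun wfc :: "nat \<Rightarrow> nat \<Rightarrow> com \<Rightarrow> bool" where
  "wfc k B (Act i w d) \<longleftrightarrow> i < k \<and> (\<forall>v. w = Some v \<longrightarrow> v < B)"
| "wfc k B (Seq a b) \<longleftrightarrow> wfc k B a \<and> wfc k B b"
| "wfc k B (Case i bs) \<longleftrightarrow> i < k \<and> (\<forall>b \<in> set bs. wfc k B b)"
| "wfc k B (While i bs) \<longleftrightarrow> i < k \<and> (\<forall>b \<in> set bs. wfc k B b)"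

lemma wfc_mono: "wfc k B c \<Longrightarrow> B \<le> B' \<Longrightarrow> wfc k B' c"
  by (induction c) auto

text \<open>The body of a loop continues with the loop itself, so the set closes up after one
  unfolding and is finite although runs are unbounded.\<close>

fun reach :: "com \<Rightarrow> com list \<Rightarrow> com list set" where
  "reach (Act i w d) K = {Act i w d # K}"
| "reach (Seq a b) K = insert (Seq a b # K) (reach a (b # K) \<union> reach b K)"
| "reach (Case i bs) K = insert (Case i bs # K) (\<Union>b \<in> set bs. reach b K)"
| "reach (While i bs) K = insert (While i bs # K) (\<Union>b \<in> set bs. reach b (While i bs # K))"

lemma reach_self: "c # K \<in> reach c K"
  by (cases c) auto

lemma finite_reach: "finite (reach c K)"
  by (induction c arbitrary: K) auto

lemma reach_closed: "c' # K' \<in> reach c K \<Longrightarrow> nxt r c' K' \<in> insert K (reach c K)"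
proof (induction c arbitrary: K)
  case (Seq a b)
  then show ?case using reach_self[of a "b # K"] reach_self[of b K] by fastforce
next
  case (Case i bs)
  from Case.prems consider "c' # K' = Case i bs # K"
    | b where "b \<in> set bs" "c' # K' \<in> reach b K" by auto
  then show ?case
  proof cases
    case 1
    then show ?thesis using reach_self[of _ K] nth_mem by auto
  next
    case 2
    then show ?thesis using Case.IH[OF 2] by auto
  qed
next
  case (While i bs)
  from While.prems consider "c' # K' = While i bs # K"
    | b where "b \<in> set bs" "c' # K' \<in> reach b (While i bs # K)" by auto
  then show ?case
  proof cases
    case 1
    then show ?thesis using reach_self[of _ "While i bs # K"] nth_mem by auto
  next
    case 2
    then show ?thesis using While.IH[OF 2] by auto
  qed
qed auto

lemma reach_wfc: "wfc k B c \<Longrightarrow> (\<forall>x \<in> set K. wfc k B x) \<Longrightarrow> L \<in> reach c K \<Longrightarrow> \<forall>x \<in> set L. wfc k B x"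
proof (induction c arbitrary: K)
  case (Seq a b)
  from Seq.prems consider "L = Seq a b # K" | "L \<in> reach a (b # K)" | "L \<in> reach b K" by auto
  then show ?case
  proof cases
    case 2
    show ?thesis by (rule Seq.IH(1)[OF _ _ 2]) (use Seq.prems in auto)
  next
    case 3
    show ?thesis by (rule Seq.IH(2)[OF _ _ 3]) (use Seq.prems in auto)
  qed (use Seq.prems in auto)
next
  case (Case i bs)
  from Case.prems consider "L = Case i bs # K"
    | b where "b \<in> set bs" "L \<in> reach b K" by auto
  then show ?case
  proof cases
    case 2
    show ?thesis by (rule Case.IH[OF 2(1) _ _ 2(2)]) (use Case.prems 2 in auto)
  qed (use Case.prems in auto)
next
  case (While i bs)
  from While.prems consider "L = While i bs # K"
    | b where "b \<in> set bs" "L \<in> reach b (While i bs # K)" by auto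
  then show ?case
  proof cases
    case 2
    show ?thesis by (rule While.IH[OF 2(1) _ _ 2(2)]) (use While.prems 2 in auto)
  qed (use While.prems in auto)
qed auto

section \<open>Compilation into a deterministic machine\<close>

fun acts :: "nat \<Rightarrow> com \<Rightarrow> nat list \<Rightarrow> nat list \<times> head_move list" where
  "acts k (Act i w d) rs =
    (case w of None \<Rightarrow> rs | Some v \<Rightarrow> rs[i := v], (replicate k Stay)[i := d])"
| "acts k c rs = (rs, replicate k Stay)"

text \<open>One rule for each reachable nonempty continuation and each vector of symbols below
  \<open>B\<close>. The empty continuation is the accepting state and has no rule, so finishing the
  program is halting.\<close>

definition machine :: "nat \<Rightarrow> nat \<Rightarrow> com \<Rightarrow> tm" where
  "machine k B c = \<lparr>num_tapes = k, start_state = to_nat [c], accept_state = to_nat ([] :: com list),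
     rules = (\<lambda>(L, rs). (to_nat L, rs, to_nat (nxt ((!) rs) (hd L) (tl L)), acts k (hd L) rs)) ` (
       (reach c [] - {[]}) \<times> {rs. set rs \<subseteq> {..<B} \<and> length rs = k})\<rparr>"

lemma length_acts: "length rs = k \<Longrightarrow> length (fst (acts k c rs)) = k \<and> length (snd (acts k c rs)) = k"
  by (cases c) (auto split: option.splits)


definition config_of :: "nat \<Rightarrow> com list \<times> tapes \<Rightarrow> config" where
  "config_of k = (\<lambda>(K, s). (to_nat K, map s [0..<k]))"

lemma wf_machine:
  assumes "k \<ge> 1"
  shows "wf_tm (machine k B c)"
proof -
  have fin: "finite {rs. set rs \<subseteq> {..<B} \<and> length rs = k}" by (rule finite_lists_length_eq) simp
  then have "finite (rules (machine k B c))"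
    unfolding machine_def tm.simps by (intro finite_imageI finite_cartesian_product finite_Diff finite_reach)
  moreover have "q \<noteq> accept_state (machine k B c) \<and> length rs = k \<and> length ws = k \<and> length ds = k"
    if rule: "(q, rs, q', ws, ds) \<in> rules (machine k B c)" for q rs q' ws ds
  proof -
    obtain L where "L \<noteq> []" "q = to_nat L" "length rs = k" "(ws, ds) = acts k (hd L) rs"
      using rule by (auto simp: machine_def)
    then show ?thesis using length_acts[of rs k "hd L"]
      by (simp add: machine_def) (metis fst_conv snd_conv)
  qed
  moreover have "num_tapes (machine k B c) = k" by (simp add: machine_def)
  ultimately show ?thesis using assms by (clarsimp simp: wf_tm_def)
qed

lemma deterministic_machine: "deterministic (machine k B c)"
  unfolding deterministic_def
proof (intro allI impI, elim conjE)
  fix q rs a b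
  assume "(q, rs, a) \<in> rules (machine k B c)" "(q, rs, b) \<in> rules (machine k B c)"
  then obtain L L' where "q = to_nat L" "a = (to_nat (nxt ((!) rs) (hd L) (tl L)), acts k (hd L) rs)"
    "q = to_nat L'" "b = (to_nat (nxt ((!) rs) (hd L') (tl L')), acts k (hd L') rs)"
    by (auto simp: machine_def)
  then show "a = b" by simp
qed

lemma halted_machine: "halted (machine k B c) (config_of k ([], s))"
  by (auto simp: halted_def machine_def config_of_def elim!: step.cases)

lemma machine_step:
  assumes "c' # K' \<in> reach c []" "wfc k B c'" "\<And>i j. fst (s i) j < B"
  shows "step (machine k B c) (config_of k (c' # K', s)) (config_of k (cstep (c' # K', s)))"
proof -
  define rs where "rs = map scanned (map s [0..<k])"
  have rs: "length rs = k" "set rs \<subseteq> {..<B}" "\<And>i. i < k \<Longrightarrow> rs ! i = scanned (s i)"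
    using assms(3) by (auto simp: rs_def scanned_def split_beta)
  have nxt: "nxt ((!) rs) c' K' = nxt (\<lambda>i. scanned (s i)) c' K'"
    using assms(2) rs by (cases c') auto
  have tapes: "map2 act (map s [0..<k]) (zip (fst (acts k c' rs)) (snd (acts k c' rs))) =
      map (perform c' s) [0..<k]"
  proof (rule nth_equalityI)
    fix i assume "i < length (map2 act (map s [0..<k]) (zip (fst (acts k c' rs)) (snd (acts k c' rs))))"
    then have "i < k" by simp
    moreover have "act t (scanned t, Stay) = t" for t
      by (cases t) (simp add: act_def scanned_def)
    ultimately show "map2 act (map s [0..<k]) (zip (fst (acts k c' rs)) (snd (acts k c' rs))) ! i =
        map (perform c' s) [0..<k] ! i"
      using rs length_acts[OF rs(1), of c'] assms(2)
      by (cases c') (auto simp: nth_list_update split: option.splits)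
  qed (use rs length_acts[OF rs(1), of c'] in simp)
  have "(to_nat (c' # K'), rs, to_nat (nxt ((!) rs) c' K'), acts k c' rs) \<in> rules (machine k B c)"
    using assms(1) rs by (force simp: machine_def image_iff)
  then have "step (machine k B c) (to_nat (c' # K'), map s [0..<k])
      (to_nat (nxt ((!) rs) c' K'), map2 act (map s [0..<k]) (zip (fst (acts k c' rs)) (snd (acts k c' rs))))"
    unfolding rs_def by (intro step.intros) (simp add: rs_def[symmetric])
  then show ?thesis by (simp only: config_of_def case_prod_conv cstep.simps nxt tapes)
qed

lemma cstep_bounded:
  assumes "wfc k B c'" "\<And>i j. fst (s i) j < B"
  shows "fst (snd (cstep (c' # K', s)) i) j < B"
  using assms
  by (cases c') (auto simp: act_def scanned_def split_beta split: option.splits)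

text \<open>\<open>cstep\<close> idles on the empty continuation whereas the machine has halted
  there, hence possibly fewer steps \<open>n'\<close>. Symbols stay below \<open>B\<close> by
  \<open>cstep_bounded\<close>, so the finite rule table always applies.\<close>

lemma machine_steps:
  assumes "wfc k B c" "K \<in> insert [] (reach c [])" "\<And>i j. fst (s i) j < B"
  shows "\<exists>n' \<le> n. (step (machine k B c) ^^ n') (config_of k (K, s)) (config_of k ((cstep ^^ n) (K, s)))"
  using assms(2,3)
proof (induction n arbitrary: K s)
  case 0
  then show ?case by auto
next
  case (Suc n)
  show ?case
  proof (cases K)
    case Nil
    have "(cstep ^^ m) ([], s) = ([], s)" for m by (induction m) auto
    then show ?thesis using Nil by (intro exI[of _ 0]) (simp del: funpow.simps)
  next
    case (Cons c' K')
    define t where "t = cstep (K, s)"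
    have mem: "c' # K' \<in> reach c []" using Suc.prems Cons by auto
    then have wf: "wfc k B c'" using reach_wfc[OF assms(1), of "[]" "c' # K'"] by simp
    have 1: "step (machine k B c) (config_of k (K, s)) (config_of k t)"
      unfolding t_def Cons by (rule machine_step[OF mem wf Suc.prems(2)])
    have "fst t \<in> insert [] (reach c [])"
      using reach_closed[OF mem] by (simp add: t_def Cons)
    moreover have "fst (snd t i) j < B" for i j
      unfolding t_def Cons by (rule cstep_bounded[OF wf Suc.prems(2)])
    ultimately obtain n' where "n' \<le> n"
      "(step (machine k B c) ^^ n') (config_of k t) (config_of k ((cstep ^^ n) t))"
      using Suc.IH[of "fst t" "snd t"] by auto
    then show ?thesis using 1
      by (intro exI[of _ "Suc n'"]) (simp add: t_def funpow_swap1 relpowp_Suc_I2 del: relpowp.simps)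
  qed
qed

definition init_tapes :: "bool list \<Rightarrow> tapes" where
  "init_tapes x = (\<lambda>_. (\<lambda>_. 0, 0))
     (0 := (\<lambda>i. if i < length x then bit_symbol (x ! i) else 0, 0))"

theorem polytime_computableI:
  fixes p :: "nat poly"
  assumes c: "wfc (Suc k) B c"
    and run: "\<And>x. \<exists>t. does c (init_tapes x) (poly p (length x)) t \<and>
      (\<forall>i < length (f x). fst (t k) i = bit_symbol (f x ! i)) \<and> fst (t k) (length (f x)) = 0"
  shows "polytime_computable f"
proof -
  \<comment> \<open>The blank and the two input bits are the symbols 0, 1, 2.\<close>
  define B' where "B' = max B 3"
  define M where "M = machine (Suc k) B' c"
  have c': "wfc (Suc k) B' c" using c wfc_mono by (auto simp: B'_def)
  have "\<exists>n d. n \<le> poly p (length x) \<and> (step M ^^ n) (initial_config M x) d \<and>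
      halted M d \<and> has_output d (f x)" for x
  proof -
    obtain t where t: "does c (init_tapes x) (poly p (length x)) t"
      "\<forall>i < length (f x). fst (t k) i = bit_symbol (f x ! i)" "fst (t k) (length (f x)) = 0"
      using run by blast
    then obtain n where n: "n \<le> poly p (length x)" "(cstep ^^ n) ([c], init_tapes x) = ([], t)"
      unfolding does_def by blast
    have "[c] \<in> insert [] (reach c [])" using reach_self[of c "[]"] by simp
    moreover have "fst (init_tapes x i) j < B'" for i j
      by (auto simp: init_tapes_def B'_def bit_symbol_def)
    ultimately obtain n' where n': "n' \<le> n"
      "(step M ^^ n') (config_of (Suc k) ([c], init_tapes x)) (config_of (Suc k) ([], t))"
      unfolding M_def using machine_steps[OF c'] n(2) by metis
    have "map (init_tapes x) [0..<Suc k] = init_tapes x 0 # replicate k (\<lambda>_. 0, 0)"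
      by (rule nth_equalityI) (auto simp: init_tapes_def nth_Cons' simp del: upt_Suc)
    then have "config_of (Suc k) ([c], init_tapes x) = initial_config M x"
      by (simp add: config_of_def initial_config_def M_def machine_def init_tapes_def del: upt_Suc)
    moreover have "has_output (config_of (Suc k) ([], t)) (f x)"
      using t by (simp add: has_output_def config_of_def)
    moreover have "halted M (config_of (Suc k) ([], t))"
      unfolding M_def by (rule halted_machine)
    ultimately show ?thesis using n n' by (metis order_trans)
  qed
  moreover have "wf_tm M" "deterministic M"
    unfolding M_def by (simp_all add: wf_machine deterministic_machine)
  ultimately show ?thesis unfolding polytime_computable_def by blast
qed

section \<open>Polynomial-time list functions\<close>

definition pb :: "(nat \<Rightarrow> nat) \<Rightarrow> bool" where
  "pb p \<longleftrightarrow> (\<exists>q :: nat poly. \<forall>n. p n \<le> poly q n)"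

lemma poly_mono_nat: "m \<le> n \<Longrightarrow> poly (q :: nat poly) m \<le> poly q n"
  by (induction q) (auto intro: add_mono mult_mono)

lemma pb_const [intro, simp]: "pb (\<lambda>_. k)"
  unfolding pb_def by (rule exI[of _ "[:k:]"]) simp

lemma pb_id [intro, simp]: "pb (\<lambda>n. n)"
  unfolding pb_def by (rule exI[of _ "[:0, 1:]"]) simp

lemma pb_add [intro, simp]: "pb p \<Longrightarrow> pb q \<Longrightarrow> pb (\<lambda>n. p n + q n)"
  unfolding pb_def by (metis add_mono poly_add)

lemma pb_mult [intro, simp]: "pb p \<Longrightarrow> pb q \<Longrightarrow> pb (\<lambda>n. p n * q n)"
  unfolding pb_def by (metis mult_le_mono poly_mult)

lemma pb_Suc [intro, simp]: "pb p \<Longrightarrow> pb (\<lambda>n. Suc (p n))"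
  using pb_add[of p "\<lambda>_. 1"] by simp

lemma pb_comp:
  assumes "pb p" "pb q"
  shows "pb (\<lambda>n. p (q n))"
proof -
  obtain P Q :: "nat poly" where "\<And>n. p n \<le> poly P n" "\<And>n. q n \<le> poly Q n"
    using assms unfolding pb_def by blast
  then have "p (q n) \<le> poly (pcompose P Q) n" for n
    by (metis order_trans poly_mono_nat poly_pcompose)
  then show ?thesis unfolding pb_def by blast
qed

text \<open>
  A stack occupies cells 1, 2, ... with its top under the head, so that the blank cell 0 is
  scanned exactly when the stack is empty.
\<close>

definition stk :: "nat list \<Rightarrow> tape" where
  "stk xs = ((\<lambda>j. if 1 \<le> j \<and> j \<le> length xs then rev xs ! (j - 1) else 0), length xs)"

lemma scanned_stk [simp]: "scanned (stk []) = 0" "scanned (stk (a # xs)) = a"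
  using nth_append_length[of "rev xs" a "[]"] by (simp_all add: scanned_def stk_def)

lemma act_pop: "act (stk (a # xs)) (0, Move_Left) = stk xs"
  by (cases xs) (auto simp: act_def stk_def nth_append fun_eq_iff)

lemma act_push: "act (act (stk xs) (scanned (stk xs), Move_Right)) (a, Stay) = stk (a # xs)"
  by (cases "xs = []") (auto simp: act_def stk_def scanned_def nth_append fun_eq_iff Suc_le_eq)

lemma act_set: "act (stk (a # xs)) (b, Stay) = stk (b # xs)"
  by (auto simp: act_def stk_def scanned_def nth_append fun_eq_iff)

section \<open>Stack operations with time bounds\<close>

definition st :: "tapes \<Rightarrow> nat list \<Rightarrow> nat list \<Rightarrow> nat list \<Rightarrow> nat list \<Rightarrow> tapes" where
  "st s a b c d = s(1 := stk a, 2 := stk b, 3 := stk c, 4 := stk d)"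

lemma st_nth [simp]:
  "st s a b c d 1 = stk a" "st s a b c d (Suc 0) = stk a" "st s a b c d 2 = stk b"
  "st s a b c d 3 = stk c" "st s a b c d 4 = stk d"
  by (simp_all add: st_def)

lemma st_upd:
  "(st s a b c d)(Suc 0 := stk x) = st s x b c d" "(st s a b c d)(2 := stk x) = st s a x c d"
  "(st s a b c d)(3 := stk x) = st s a b x d" "(st s a b c d)(4 := stk x) = st s a b c x"
  by (auto simp: st_def fun_eq_iff)

definition pop :: "nat \<Rightarrow> com" where "pop i = Act i (Some 0) Move_Left"
definition set_top :: "nat \<Rightarrow> nat \<Rightarrow> com" where "set_top i a = Act i (Some a) Stay"
definition push :: "nat \<Rightarrow> nat \<Rightarrow> com" where
  "push i a = Seq (Act i None Move_Right) (Act i (Some a) Stay)"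
definition skip :: com where "skip = Case 0 []"

lemma does_skip: "does skip s 1 s"
  unfolding does_def skip_def by (intro exI[of _ 1]) auto

lemma does_pop:
  "does (pop 1) (st s (x # a) b c d) 1 (st s a b c d)"
  "does (pop 2) (st s a (x # b) c d) 1 (st s a b c d)"
  "does (pop 3) (st s a b (x # c) d) 1 (st s a b c d)"
  "does (pop 4) (st s a b c (x # d)) 1 (st s a b c d)"
  using does_Act[of 1 "Some 0" Move_Left] does_Act[of 2 "Some 0" Move_Left]
    does_Act[of 3 "Some 0" Move_Left] does_Act[of 4 "Some 0" Move_Left]
  unfolding pop_def by (metis act_pop option.case(2) st_nth st_upd One_nat_def)+

lemma does_set_top:
  "does (set_top 1 y) (st s (x # a) b c d) 1 (st s (y # a) b c d)"
  "does (set_top 2 y) (st s a (x # b) c d) 1 (st s a (y # b) c d)"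
  "does (set_top 3 y) (st s a b (x # c) d) 1 (st s a b (y # c) d)"
  "does (set_top 4 y) (st s a b c (x # d)) 1 (st s a b c (y # d))"
  using does_Act[of 1 "Some y" Stay] does_Act[of 2 "Some y" Stay]
    does_Act[of 3 "Some y" Stay] does_Act[of 4 "Some y" Stay]
  unfolding set_top_def by (metis act_set option.case(2) st_nth st_upd One_nat_def)+

lemma does_push_gen:
  assumes "s i = stk xs"
  shows "does (push i a) s 3 (s(i := stk (a # xs)))"
proof -
  let ?u = "s(i := act (s i) (scanned (s i), Move_Right))"
  have "does (Act i None Move_Right) s 1 ?u" using does_Act[of i None Move_Right s] by simp
  moreover have "does (Act i (Some a) Stay) ?u 1 (s(i := stk (a # xs)))"
    using does_Act[of i "Some a" Stay ?u] act_push[of xs a] assms by simp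
  ultimately show ?thesis unfolding push_def using does_Seq[of _ s 1 ?u _ 1] by (simp add: numeral_3_eq_3)
qed

lemma does_push:
  "does (push 1 x) (st s a b c d) 3 (st s (x # a) b c d)"
  "does (push 2 x) (st s a b c d) 3 (st s a (x # b) c d)"
  "does (push 3 x) (st s a b c d) 3 (st s a b (x # c) d)"
  "does (push 4 x) (st s a b c d) 3 (st s a b c (x # d))"
  by (metis does_push_gen st_nth st_upd One_nat_def)+

fun pushes :: "nat list \<Rightarrow> com" where
  "pushes [] = skip"
| "pushes (x # xs) = Seq (push 2 x) (pushes xs)"

lemma does_pushes: "does (pushes xs) (st s a b c d) (4 * length xs + 1) (st s a (rev xs @ b) c d)"
proof (induction xs arbitrary: b)
  case Nil
  then show ?case using does_skip by simp
next
  case (Cons x xs)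
  show ?case using does_Seq[OF does_push(2) Cons.IH[of "x # b"]] does_mono by fastforce
qed

definition tab :: "nat \<Rightarrow> (nat \<Rightarrow> com) \<Rightarrow> com list" where
  "tab K f = map f [0..<K]"

lemma tab_simps [simp]: "length (tab K f) = K" "i < K \<Longrightarrow> tab K f ! i = f i"
  "set (tab K f) = f ` {..<K}"
  by (auto simp: tab_def)

text \<open>Well-formedness without a symbol bound. Tables are built from codes of unknown size; a
  common bound is extracted afterwards because a program contains finitely many symbols.\<close>

fun wfi :: "nat \<Rightarrow> com \<Rightarrow> bool" where
  "wfi k (Act i w d) \<longleftrightarrow> i < k"
| "wfi k (Seq a b) \<longleftrightarrow> wfi k a \<and> wfi k b"
| "wfi k (Case i bs) \<longleftrightarrow> i < k \<and> (\<forall>b \<in> set bs. wfi k b)"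
| "wfi k (While i bs) \<longleftrightarrow> i < k \<and> (\<forall>b \<in> set bs. wfi k b)"

lemma wfi_imp_wfc: "wfi k c \<Longrightarrow> \<exists>B. wfc k B c"
proof (induction c)
  case (Act i w d)
  then show ?case by (cases w) auto
next
  case (Seq a b)
  then obtain B B' where "wfc k B a" "wfc k B' b" by auto
  then have "wfc k (max B B') (Seq a b)" using wfc_mono by auto
  then show ?case by blast
next
  case (Case i bs)
  then have "\<forall>b \<in> set bs. \<exists>B. wfc k B b" by auto
  then obtain f where f: "\<forall>b \<in> set bs. wfc k (f b) b" by metis
  have "wfc k (Max (f ` set bs)) b" if "b \<in> set bs" for b
    by (rule wfc_mono[OF bspec[OF f that]]) (simp add: that)
  then show ?case using Case.prems by (intro exI[of _ "Max (f ` set bs)"]) simp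
next
  case (While i bs)
  then have "\<forall>b \<in> set bs. \<exists>B. wfc k B b" by auto
  then obtain f where f: "\<forall>b \<in> set bs. wfc k (f b) b" by metis
  have "wfc k (Max (f ` set bs)) b" if "b \<in> set bs" for b
    by (rule wfc_mono[OF bspec[OF f that]]) (simp add: that)
  then show ?case using While.prems by (intro exI[of _ "Max (f ` set bs)"]) simp
qed

lemma wfi_ops [simp]:
  "i < k \<Longrightarrow> wfi k (pop i)" "i < k \<Longrightarrow> wfi k (push i a)" "i < k \<Longrightarrow> wfi k (set_top i a)"
  "0 < k \<Longrightarrow> wfi k skip"
  by (simp_all add: pop_def push_def set_top_def skip_def)

lemma wfi_pushes [simp]: "2 < k \<Longrightarrow> wfi k (pushes xs)"
  by (induction xs) simp_all

definition move :: "nat \<Rightarrow> nat \<Rightarrow> nat \<Rightarrow> com" where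
  "move K i j = While i (tab K (\<lambda>a. Seq (pop i) (push j a)))"

lemma wfi_move [simp]: "i < k \<Longrightarrow> j < k \<Longrightarrow> wfi k (move K i j)"
  by (auto simp: move_def)

lemma does_move_2_1:
  assumes "\<And>x. x \<in> set xs \<Longrightarrow> 0 < x \<and> x < K"
  shows "does (move K 2 1) (st s a xs c d) (6 * length xs + 1) (st s (rev xs @ a) [] c d)"
  using assms
proof (induction xs arbitrary: a)
  case Nil
  show ?case unfolding move_def using does_While_stop[of "st s a [] c d" 2] by simp
next
  case (Cons x xs)
  have x: "0 < x" "x < K" using Cons.prems by auto
  have "does (tab K (\<lambda>a. Seq (pop 2) (push 1 a)) ! scanned ((st s a (x # xs) c d) 2))
      (st s a (x # xs) c d) (1 + 3 + 1) (st s (x # a) xs c d)"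
    using does_Seq[OF does_pop(2) does_push(1)] x by simp
  from does_While_iter[OF _ _ this Cons.IH[unfolded move_def]] Cons.prems x
  show ?case by (simp add: move_def)
qed

lemma does_move_3_4:
  assumes "\<And>x. x \<in> set xs \<Longrightarrow> 0 < x \<and> x < K"
  shows "does (move K 3 4) (st s e b xs a) (6 * length xs + 1) (st s e b [] (rev xs @ a))"
  using assms
proof (induction xs arbitrary: a)
  case Nil
  show ?case unfolding move_def using does_While_stop[of "st s e b [] a" 3] by simp
next
  case (Cons x xs)
  have x: "0 < x" "x < K" using Cons.prems by auto
  have "does (tab K (\<lambda>a. Seq (pop 3) (push 4 a)) ! scanned ((st s e b (x # xs) a) 3))
      (st s e b (x # xs) a) (1 + 3 + 1) (st s e b xs (x # a))"
    using does_Seq[OF does_pop(3) does_push(4)] x by simp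
  from does_While_iter[OF _ _ this Cons.IH[unfolded move_def]] Cons.prems x
  show ?case by (simp add: move_def)
qed

section \<open>Words on a stack and functions between them\<close>

text \<open>Shifted by one because 0 is the blank that signals an empty stack.\<close>

definition enc :: "'a :: countable \<Rightarrow> nat" where "enc a = Suc (to_nat a)"
definition dec :: "nat \<Rightarrow> 'a :: countable" where "dec k = from_nat (k - 1)"

lemma enc_simps [simp]: "enc a > 0" "enc a \<noteq> 0" "dec (enc a) = a"
  by (simp_all add: enc_def dec_def)

lemma enc_bound: "finite A \<Longrightarrow> \<exists>K. \<forall>a \<in> A. enc a < K"
  using finite_nat_set_iff_bounded[of "enc ` A"] by auto

text \<open>Six tapes: 0 for the input, 1 to 4 as stacks, 5 for the output. Stack 1 holds argument
  and result, the other stacks are empty before and after, and tapes 0 and 5 are left alone;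
  \<open>D\<close> is the set of words for which this is promised. The length bound is included
  because the time of a second function is measured in the length of the first result.\<close>

definition pf :: "'a :: countable list set \<Rightarrow> ('a list \<Rightarrow> 'b :: countable list) \<Rightarrow> bool" where
  "pf D F \<longleftrightarrow> (\<exists>c p. wfi 6 c \<and> pb p \<and> (\<forall>xs \<in> D. length (F xs) \<le> p (length xs) \<and>
     (\<forall>s. does c (st s (map enc xs) [] [] []) (p (length xs)) (st s (map enc (F xs)) [] [] []))))"

lemma pb_dominated:
  assumes "pb p"
  obtains q where "pb q" "\<And>n. p n \<le> q n" "\<And>m n. m \<le> n \<Longrightarrow> q m \<le> q n"
  using assms unfolding pb_def by (metis order_refl poly_mono_nat)

lemma pf_comp:
  assumes "pf D F" "pf D' G" "\<And>xs. xs \<in> D \<Longrightarrow> F xs \<in> D'"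
  shows "pf D (\<lambda>xs. G (F xs))"
proof -
  obtain c p where c: "wfi 6 c" "pb p" "\<And>xs. xs \<in> D \<Longrightarrow> length (F xs) \<le> p (length xs)"
    "\<And>xs s. xs \<in> D \<Longrightarrow> does c (st s (map enc xs) [] [] []) (p (length xs)) (st s (map enc (F xs)) [] [] [])"
    using assms(1) unfolding pf_def by blast
  obtain e q where e: "wfi 6 e" "pb q" "\<And>xs. xs \<in> D' \<Longrightarrow> length (G xs) \<le> q (length xs)"
    "\<And>xs s. xs \<in> D' \<Longrightarrow> does e (st s (map enc xs) [] [] []) (q (length xs)) (st s (map enc (G xs)) [] [] [])"
    using assms(2) unfolding pf_def by blast
  \<comment> \<open>A bound in \<open>pb\<close> need not be monotone; a polynomial with natural
    coefficients above it is.\<close>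
  obtain r where r: "pb r" "\<And>n. q n \<le> r n" "\<And>m n. m \<le> n \<Longrightarrow> r m \<le> r n"
    using pb_dominated[OF e(2)] by blast
  have le: "q (length (F xs)) \<le> r (p (length xs))" if "xs \<in> D" for xs
    using r c(3)[OF that] by (meson order_trans)
  show ?thesis unfolding pf_def
  proof (intro exI conjI ballI allI)
    show "wfi 6 (Seq c e)" using c e by simp
    show "pb (\<lambda>n. p n + r (p n) + 1)" using c r pb_comp by auto
    fix xs assume xs: "xs \<in> D"
    show "length (G (F xs)) \<le> p (length xs) + r (p (length xs)) + 1"
      using e(3)[OF assms(3)[OF xs]] le[OF xs] by linarith
    show "does (Seq c e) (st s (map enc xs) [] [] []) (p (length xs) + r (p (length xs)) + 1)
        (st s (map enc (G (F xs))) [] [] [])" for s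
      using does_Seq[OF c(4)[OF xs] e(4)[OF assms(3)[OF xs]]]
      by (rule does_mono) (use le[OF xs] in simp)
  qed
qed

lemma pf_mono: "pf D F \<Longrightarrow> D' \<subseteq> D \<Longrightarrow> pf D' F"
  unfolding pf_def by (meson subsetD)

lemma pf_cong: "pf D F \<Longrightarrow> (\<And>xs. xs \<in> D \<Longrightarrow> F xs = G xs) \<Longrightarrow> pf D G"
  unfolding pf_def by (metis (no_types, lifting))

section \<open>Finite transducers\<close>

fun fout :: "('q \<Rightarrow> 'a \<Rightarrow> 'q \<times> 'b list) \<Rightarrow> 'q \<Rightarrow> 'a list \<Rightarrow> 'b list" where
  "fout \<delta> q [] = []"
| "fout \<delta> q (a # xs) = snd (\<delta> q a) @ fout \<delta> (fst (\<delta> q a)) xs"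

fun fend :: "('q \<Rightarrow> 'a \<Rightarrow> 'q \<times> 'b list) \<Rightarrow> 'q \<Rightarrow> 'a list \<Rightarrow> 'q" where
  "fend \<delta> q [] = q"
| "fend \<delta> q (a # xs) = fend \<delta> (fst (\<delta> q a)) xs"

definition frun :: "('q \<Rightarrow> 'a \<Rightarrow> 'q \<times> 'b list) \<Rightarrow> ('q \<Rightarrow> 'b list) \<Rightarrow> 'q \<Rightarrow> 'a list \<Rightarrow> 'b list" where
  "frun \<delta> fin q xs = fout \<delta> q xs @ fin (fend \<delta> q xs)"

lemma does_at_most: "does c s B t \<Longrightarrow> B \<le> B' \<Longrightarrow> t = t' \<Longrightarrow> does c s B' t'"
  using does_mono by blast

theorem pf_frun:
  fixes \<delta> :: "'q \<Rightarrow> 'a :: countable \<Rightarrow> 'q \<times> 'b :: countable list"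
  assumes A: "finite A" "D \<subseteq> lists A" and Q: "finite Q" "q0 \<in> Q"
    and closed: "\<And>q a. q \<in> Q \<Longrightarrow> a \<in> A \<Longrightarrow> fst (\<delta> q a) \<in> Q"
  shows "pf D (frun \<delta> fin q0)"
proof -
  define code where "code = (\<lambda>q. Suc (to_nat_on Q q))"
  define state where "state = (\<lambda>k. from_nat_into Q (k - 1))"
  have state: "state (code q) = q" if "q \<in> Q" for q
    using that countable_finite[OF Q(1)] by (simp add: state_def code_def)
  obtain K where K: "\<And>a. a \<in> A \<Longrightarrow> enc a < K" using enc_bound[OF A(1)] by blast
  obtain KQ where KQ: "\<And>q. q \<in> Q \<Longrightarrow> code q < KQ"
    using finite_nat_set_iff_bounded[of "code ` Q"] Q(1) by auto
  obtain L where L: "\<And>q a. q \<in> Q \<Longrightarrow> a \<in> A \<Longrightarrow> length (snd (\<delta> q a)) \<le> L" "\<And>q. q \<in> Q \<Longrightarrow> length (fin q) \<le> L"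
  proof -
    have "finite ((\<lambda>(q, a). length (snd (\<delta> q a))) ` (Q \<times> A) \<union> (\<lambda>q. length (fin q)) ` Q)"
      using A Q by simp
    then obtain L where "\<forall>n \<in> (\<lambda>(q, a). length (snd (\<delta> q a))) ` (Q \<times> A) \<union> (\<lambda>q. length (fin q)) ` Q. n \<le> L"
      using finite_nat_set_iff_bounded_le by blast
    then show ?thesis by (intro that[of L]) auto
  qed
  define out where "out = (\<lambda>bs :: 'b list. pushes (map enc bs))"
  define body where "body = (\<lambda>a. Case 3 (tab KQ (\<lambda>k. let r = \<delta> (state k) (dec a) in
    Seq (pop 1) (Seq (set_top 3 (code (fst r))) (out (snd r))))))"
  define loop where "loop = While 1 (tab K body)"
  define final where "final = Case 3 (tab KQ (\<lambda>k. out (fin (state k))))"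
  have fend: "fend \<delta> q xs \<in> Q" if "q \<in> Q" "xs \<in> lists A" for q xs
    using that by (induction xs arbitrary: q) (auto simp: closed)
  have len: "length (fout \<delta> q xs) \<le> L * length xs" if "q \<in> Q" "xs \<in> lists A" for q xs
    using that
  proof (induction xs arbitrary: q)
    case (Cons a xs)
    then have "length (fout \<delta> (fst (\<delta> q a)) xs) \<le> L * length xs"
      "length (snd (\<delta> q a)) \<le> L" using closed L by auto
    then show ?case by simp
  qed simp
  have out: "does (out bs) (st s a b c d) (4 * length bs + 1) (st s a (rev (map enc bs) @ b) c d)"
    for bs s a b c d using does_pushes[of "map enc bs" s a b c d] by (simp add: out_def)
  have loop: "does loop (st s (map enc xs) ys [code q] []) ((4 * L + 10) * length xs + 1)
      (st s [] (rev (map enc (fout \<delta> q xs)) @ ys) [code (fend \<delta> q xs)] [])"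
    if "q \<in> Q" "xs \<in> lists A" for q xs ys s
    using that
  proof (induction xs arbitrary: q ys)
    case Nil
    then show ?case unfolding loop_def using does_While_stop[of "st s [] ys [code q] []" 1] by simp
  next
    case (Cons a xs)
    let ?s = "st s (map enc (a # xs)) ys [code q] []" and ?q = "fst (\<delta> q a)" and ?o = "snd (\<delta> q a)"
    let ?t = "st s (map enc xs) (rev (map enc ?o) @ ys) [code ?q] []"
    have a: "a \<in> A" "q \<in> Q" using Cons.prems by auto
    have "does (Seq (pop 1) (Seq (set_top 3 (code ?q)) (out ?o))) ?s
        (1 + (1 + (4 * length ?o + 1) + 1) + 1) ?t"
      using does_Seq[OF does_pop(1) does_Seq[OF does_set_top(3) out]] by simp
    then have "does (body (enc a)) ?s (1 + (1 + (4 * length ?o + 1) + 1) + 1 + 1) ?t"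
      unfolding body_def by (intro does_Case) (use a KQ state in \<open>auto simp: Let_def\<close>)
    then have "does (tab K body ! scanned (?s 1)) ?s (4 * L + 6) ?t"
      using K[OF a(1)] L(1)[OF a(2,1)] by (auto intro: does_mono)
    from does_While_iter[OF _ _ this Cons.IH[unfolded loop_def]] closed[OF a(2,1)] Cons.prems K[OF a(1)]
    have "does loop ?s (4 * L + 6 + ((4 * L + 10) * length xs + 1) + 1)
      (st s [] (rev (map enc (fout \<delta> ?q xs)) @ rev (map enc ?o) @ ys) [code (fend \<delta> ?q xs)] [])"
      by (simp add: loop_def)
    then show ?case by (simp add: does_mono)
  qed
  have final: "does final (st s a b [code q] d) (4 * L + 2) (st s a (rev (map enc (fin q)) @ b) [code q] d)"
    if "q \<in> Q" for q s a b d
  proof -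
    have "does (tab KQ (\<lambda>k. out (fin (state k))) ! scanned (st s a b [code q] d 3)) (st s a b [code q] d) (4 * length (fin q) + 1)
        (st s a (rev (map enc (fin q)) @ b) [code q] d)"
      using out[of "fin q"] KQ[OF that] state[OF that] by simp
    from does_Case[OF _ this] show ?thesis
      unfolding final_def using KQ[OF that] L(2)[OF that] by (auto elim!: does_mono)
  qed
  \<comment> \<open>The table of the pouring loop must cover all output symbols; they are finitely
    many because there are finitely many transitions.\<close>
  obtain K' where K': "\<And>xs x. xs \<in> D \<Longrightarrow> x \<in> set (frun \<delta> fin q0 xs) \<Longrightarrow> enc x < K'"
  proof -
    define X where "X = (\<Union>q \<in> Q. \<Union>a \<in> A. set (snd (\<delta> q a))) \<union> (\<Union>q \<in> Q. set (fin q))"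
    have "finite X" using A Q by (auto simp: X_def)
    from enc_bound[OF this] obtain K' where "\<And>x. x \<in> X \<Longrightarrow> enc x < K'" by auto
    moreover have X: "set (fout \<delta> q xs) \<subseteq> X" if "q \<in> Q" "xs \<in> lists A" for q xs
      using that by (induction xs arbitrary: q) (auto simp: closed X_def)
    have "set (frun \<delta> fin q0 xs) \<subseteq> X" if "xs \<in> D" for xs
    proof -
      have "xs \<in> lists A" using A that by blast
      from X[OF Q(2) this] fend[OF Q(2) this] show ?thesis
        unfolding frun_def set_append by (auto simp: X_def)
    qed
    ultimately show ?thesis using that by blast
  qed
  define p where "p = (\<lambda>n. (4 * L + 10) * n + 4 * L + 6 * (L * n + L) + 20)"
  define prog where "prog = Seq (push 3 (code q0)) (Seq loop (Seq final (Seq (pop 3) (move K' 2 1))))"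
  have wf: "wfi 6 prog"
    by (auto simp: prog_def loop_def body_def final_def out_def Let_def)
  have "length (frun \<delta> fin q0 xs) \<le> p (length xs)" "does prog (st s (map enc xs) [] [] [])
      (p (length xs)) (st s (map enc (frun \<delta> fin q0 xs)) [] [] [])" if xs: "xs \<in> D" for xs s
  proof -
    have xsA: "xs \<in> lists A" using A xs by blast
    have l: "length (frun \<delta> fin q0 xs) \<le> L * length xs + L"
      using len[OF Q(2) xsA] L(2)[OF fend[OF Q(2) xsA]] by (simp add: frun_def)
    then show "length (frun \<delta> fin q0 xs) \<le> p (length xs)" by (simp add: p_def algebra_simps)
    let ?o = "rev (map enc (frun \<delta> fin q0 xs))"
    have 1: "does loop (st s (map enc xs) [] [code q0] []) ((4 * L + 10) * length xs + 1)
      (st s [] (rev (map enc (fout \<delta> q0 xs))) [code (fend \<delta> q0 xs)] [])"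
      using loop[OF Q(2) xsA, of s "[]"] by simp
    have 2: "does final (st s [] (rev (map enc (fout \<delta> q0 xs))) [code (fend \<delta> q0 xs)] []) (4 * L + 2)
      (st s [] ?o [code (fend \<delta> q0 xs)] [])"
      using final[OF fend[OF Q(2) xsA], of s "[]" "rev (map enc (fout \<delta> q0 xs))" "[]"]
      by (simp add: frun_def)
    have 3: "does (move K' 2 1) (st s [] ?o [] []) (6 * length ?o + 1)
        (st s (map enc (frun \<delta> fin q0 xs)) [] [] [])"
      using does_move_2_1[of ?o K' s "[]" "[]" "[]"] K'[OF xs] by fastforce
    have "does prog (st s (map enc xs) [] [] [])
      (3 + ((4 * L + 10) * length xs + 1 + (4 * L + 2 + (1 + (6 * length ?o + 1) + 1) + 1) + 1) + 1)
      (st s (map enc (frun \<delta> fin q0 xs)) [] [] [])"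
      unfolding prog_def
      by (rule does_Seq[OF does_push(3) does_Seq[OF 1 does_Seq[OF 2 does_Seq[OF does_pop(3) 3]]]])
    then show "does prog (st s (map enc xs) [] [] [])
      (p (length xs)) (st s (map enc (frun \<delta> fin q0 xs)) [] [] [])"
      by (rule does_mono) (use l in \<open>simp add: p_def algebra_simps\<close>)
  qed
  moreover have "pb p" unfolding p_def by (intro pb_add pb_mult pb_const pb_id)
  ultimately show ?thesis unfolding pf_def using wf by blast
qed

section \<open>Marking every position of a word\<close>

text \<open>A list of blocks as one word; the terminator \<open>None\<close> makes the blocks
  recoverable, empty ones included.\<close>

definition flat :: "'a list list \<Rightarrow> 'a option list" where
  "flat bs = concat (map (\<lambda>b. map Some b @ [None]) bs)"

lemma flat_simps [simp]: "flat [] = []" "flat (b # bs) = map Some b @ None # flat bs"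
  "flat (bs @ cs) = flat bs @ flat cs"
  by (simp_all add: flat_def)

lemma map_Some_eq: "map Some b @ None # xs = map Some c @ None # ys \<longleftrightarrow> b = c \<and> xs = ys"
proof (induction b arbitrary: c)
  case Nil
  then show ?case by (cases c) auto
next
  case (Cons a b)
  then show ?case by (cases c) auto
qed

lemma inj_flat: "inj flat"
proof (rule injI)
  show "bs = cs" if "flat bs = flat cs" for bs cs :: "'a list list" using that
  proof (induction bs arbitrary: cs)
    case Nil
    then show ?case by (cases cs) auto
  next
    case (Cons b bs)
    then show ?case by (cases cs) (auto simp: map_Some_eq)
  qed
qed

lemma length_flat_mono: "b \<in> set bs \<Longrightarrow> length b \<le> length (flat bs)"
  by (induction bs) auto

abbreviation off :: "'a \<Rightarrow> 'a \<times> bool" where "off x \<equiv> (x, False)"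

fun marks_from :: "'a list \<Rightarrow> 'a list \<Rightarrow> ('a \<times> bool) list list" where
  "marks_from xs [] = []"
| "marks_from xs (y # ys) = (map off xs @ (y, True) # map off ys) # marks_from (xs @ [y]) ys"

definition marks :: "'a list \<Rightarrow> ('a \<times> bool) list list" where
  "marks b = marks_from [] b"

lemma marks_from_conv:
  "marks_from xs ys = map (\<lambda>j. map (\<lambda>i. ((xs @ ys) ! i, i = j)) [0..<length (xs @ ys)])
     [length xs..<length (xs @ ys)]"
proof (induction ys arbitrary: xs)
  case (Cons y ys)
  have "map off xs @ (y, True) # map off ys =
      map (\<lambda>i. ((xs @ y # ys) ! i, i = length xs)) [0..<length (xs @ y # ys)]"
    by (rule nth_equalityI) (auto simp: nth_append nth_Cons' simp del: upt_Suc)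
  moreover have "[length xs..<length (xs @ y # ys)] = length xs # [length (xs @ [y])..<length ((xs @ [y]) @ ys)]"
    by (simp add: upt_conv_Cons del: upt_Suc)
  ultimately show ?case using Cons.IH[of "xs @ [y]"] by (simp del: upt_Suc)
qed simp

lemma marks_conv: "marks b = map (\<lambda>j. map (\<lambda>i. (b ! i, i = j)) [0..<length b]) [0..<length b]"
  unfolding marks_def using marks_from_conv[of "[]" b] by simp

definition mark :: "'a option list \<Rightarrow> ('a \<times> bool) option list" where
  "mark xs = flat (concat (map marks (inv flat xs)))"

lemma mark_flat [simp]: "mark (flat bs) = flat (concat (map marks bs))"
  by (simp add: mark_def inv_f_f[OF inj_flat])

abbreviation un :: "'a :: countable \<Rightarrow> nat" where "un x \<equiv> enc (Some (x, False))"
abbreviation mk :: "'a :: countable \<Rightarrow> nat" where "mk x \<equiv> enc (Some (x, True))"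

section \<open>Sweeping a mark through a block\<close>

definition clear3 :: "nat \<Rightarrow> com" where "clear3 K = While 3 (tab K (\<lambda>_. pop 3))"

lemma does_clear3:
  assumes "\<And>x. x \<in> set xs \<Longrightarrow> 0 < x \<and> x < K"
  shows "does (clear3 K) (st s a b xs d) (2 * length xs + 1) (st s a b [] d)"
  using assms
proof (induction xs)
  case Nil
  show ?case unfolding clear3_def using does_While_stop[of "st s a b [] d" 3] by simp
next
  case (Cons x xs)
  have x: "0 < x" "x < K" using Cons.prems by auto
  have "does (tab K (\<lambda>_. pop 3) ! scanned ((st s a b (x # xs) d) 3))
      (st s a b (x # xs) d) 1 (st s a b xs d)"
    using does_pop(3) x by simp
  from does_While_iter[OF _ _ this Cons.IH[unfolded clear3_def]] Cons.prems x
  show ?case by (simp add: clear3_def)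
qed

definition copy_out :: "nat \<Rightarrow> com" where
  "copy_out K = While 4 (tab K (\<lambda>a. Seq (pop 4) (Seq (push 3 a) (push 2 a))))"

lemma does_copy_out:
  assumes "\<And>x. x \<in> set xs \<Longrightarrow> 0 < x \<and> x < K"
  shows "does (copy_out K) (st s a b c xs) (10 * length xs + 1) (st s a (rev xs @ b) (rev xs @ c) [])"
  using assms
proof (induction xs arbitrary: b c)
  case Nil
  show ?case unfolding copy_out_def using does_While_stop[of "st s a b c []" 4] by simp
next
  case (Cons x xs)
  have x: "0 < x" "x < K" using Cons.prems by auto
  have "does (tab K (\<lambda>a. Seq (pop 4) (Seq (push 3 a) (push 2 a))) ! scanned ((st s a b c (x # xs)) 4))
      (st s a b c (x # xs)) (1 + (3 + 3 + 1) + 1) (st s a (x # b) (x # c) xs)"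
    using does_Seq[OF does_pop(4) does_Seq[OF does_push(3) does_push(2)]] x by simp
  from does_While_iter[OF _ _ this Cons.IH[unfolded copy_out_def]] Cons.prems x
  show ?case by (simp add: copy_out_def)
qed

text \<open>One sweep copies the block from stack 4 to the output and, reversed, to stack 3, and
  pours it back. Pouring back meets the marked letter just after its right neighbour has landed on
  stack 4, so the mark steps right by rewriting the top of stack 4. If stack 4 is empty, the mark
  was on the last letter; discarding stack 3 leaves stack 4 empty and thereby ends the loop of
  sweeps.\<close>

definition advance :: "nat \<Rightarrow> 'a :: countable \<Rightarrow> nat \<Rightarrow> com" where
  "advance K x k = (if k = 0 then clear3 K
     else case dec k :: ('a \<times> bool) option of
       Some (y, _) \<Rightarrow> Seq (set_top 4 (mk y)) (push 4 (un x)) | None \<Rightarrow> skip)"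

definition back_body :: "nat \<Rightarrow> 'a :: countable itself \<Rightarrow> nat \<Rightarrow> com" where
  "back_body K ty a = (case dec a :: ('a \<times> bool) option of
     Some (x, True) \<Rightarrow> Seq (pop 3) (Case 4 (tab K (advance K x)))
   | _ \<Rightarrow> Seq (pop 3) (push 4 a))"

definition rewind :: "nat \<Rightarrow> 'a :: countable itself \<Rightarrow> com" where
  "rewind K ty = While 3 (tab K (back_body K ty))"

definition first_mark :: "'a :: countable itself \<Rightarrow> nat \<Rightarrow> com" where
  "first_mark ty k = (if k = 0 then skip else case dec k :: ('a \<times> bool) option of
     Some (x, _) \<Rightarrow> set_top 4 (mk x) | None \<Rightarrow> skip)"

definition sweeps :: "nat \<Rightarrow> 'a :: countable itself \<Rightarrow> com" where
  "sweeps K ty = While 4 (tab K (\<lambda>_. Seq (copy_out K)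
     (Seq (push 2 (enc (None :: ('a \<times> bool) option))) (rewind K ty))))"

definition main_body :: "nat \<Rightarrow> 'a :: countable itself \<Rightarrow> nat \<Rightarrow> com" where
  "main_body K ty a = Seq (pop 1) (case dec a :: 'a option of
     Some x \<Rightarrow> push 3 (un x)
   | None \<Rightarrow> Seq (move K 3 4) (Seq (Case 4 (tab K (first_mark ty))) (sweeps K ty)))"

definition mark_prog :: "nat \<Rightarrow> 'a :: countable itself \<Rightarrow> com" where
  "mark_prog K ty = Seq (While 1 (tab K (main_body K ty))) (move K 2 1)"

lemma wfi_mark_prog: "wfi 6 (mark_prog K ty)"
  by (auto simp: mark_prog_def main_body_def sweeps_def first_mark_def rewind_def back_body_def
      advance_def clear3_def copy_out_def split: option.splits bool.splits)

context
  fixes A :: "'a :: countable set" and K :: nat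
  assumes K: "\<And>x m. x \<in> A \<Longrightarrow> enc (Some (x, m :: bool)) < K" "\<And>x. x \<in> A \<Longrightarrow> enc (Some x) < K"
    "enc (None :: 'a option) < K" "enc (None :: ('a \<times> bool) option) < K" 
begin

lemma K_pos: "0 < K"
  using K(3) by auto

lemma back_off:
  assumes "does (rewind K TYPE('a)) (st s a b c (rev (map un zs) @ d)) B t" "set zs \<subseteq> A"
  shows "does (rewind K TYPE('a)) (st s a b (map un zs @ c) d) (6 * length zs + B) t"
  using assms
proof (induction zs arbitrary: d)
  case (Cons z zs)
  have z: "un z < K" using K Cons.prems by auto
  have "does (tab K (back_body K TYPE('a)) ! scanned (st s a b (map un (z # zs) @ c) d 3))
      (st s a b (map un (z # zs) @ c) d) (1 + 3 + 1) (st s a b (map un zs @ c) (un z # d))"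
    using does_Seq[OF does_pop(3) does_push(4)] z by (simp add: back_body_def)
  from does_While_iter[OF _ _ this Cons.IH[unfolded rewind_def]] Cons.prems z
  show ?case by (simp add: rewind_def ac_simps)
qed simp

lemma back_last:
  assumes "set xs \<subseteq> A" "x \<in> A"
  shows "does (rewind K TYPE('a)) (st s a b (mk x # rev (map un xs)) []) (2 * length xs + 6) (st s a b [] [])"
proof -
  let ?s = "st s a b (mk x # rev (map un xs)) []" and ?s1 = "st s a b (rev (map un xs)) []"
  have "does (clear3 K) ?s1 (2 * length xs + 1) (st s a b [] [])"
    using does_clear3[of "rev (map un xs)" K s a b "[]"] K assms by fastforce
  then have 1: "does (Case 4 (tab K (advance K x))) ?s1 (2 * length xs + 1 + 1) (st s a b [] [])"
    by (intro does_Case) (use K_pos in \<open>auto simp: advance_def\<close>)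
  have 2: "does (tab K (back_body K TYPE('a)) ! scanned (?s 3)) ?s (1 + (2 * length xs + 1 + 1) + 1) (st s a b [] [])"
    using does_Seq[OF does_pop(3) 1] K assms by (simp add: back_body_def)
  have "does (While 3 (tab K (back_body K TYPE('a)))) (st s a b [] []) 1 (st s a b [] [])"
    using does_While_stop[of "st s a b [] []" 3] by simp
  from does_While_iter[OF _ _ 2 this] K assms show ?thesis
    by (auto simp: rewind_def elim: does_mono)
qed

lemma back_move:
  assumes "set xs \<subseteq> A" "x \<in> A" "y \<in> A" "set ys \<subseteq> A"
  shows "does (rewind K TYPE('a)) (st s a b (rev (map un xs @ mk x # un y # map un ys)) [])
     (6 * (length xs + length ys) + 20) (st s a b [] (map un xs @ un x # mk y # map un ys))"
proof -
  let ?e = "st s a b [] (map un xs @ un x # mk y # map un ys)"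
  have "does (While 3 (tab K (back_body K TYPE('a)))) ?e 1 ?e"
    using does_While_stop[of ?e 3] by simp
  then have 1: "does (rewind K TYPE('a)) (st s a b (map un (rev xs)) (un x # mk y # map un ys)) (6 * length xs + 1) ?e"
    using back_off[of s a b "[]" "rev xs" "un x # mk y # map un ys" 1 ?e] assms
    by (simp add: rev_map rewind_def)
  let ?s = "st s a b (mk x # map un (rev xs)) (un y # map un ys)"
  have "does (advance K x (un y)) (st s a b (map un (rev xs)) (un y # map un ys)) (1 + 3 + 1)
      (st s a b (map un (rev xs)) (un x # mk y # map un ys))"
    using does_Seq[OF does_set_top(4) does_push(4)] by (simp add: advance_def)
  then have "does (Case 4 (tab K (advance K x))) (st s a b (map un (rev xs)) (un y # map un ys)) (1 + 3 + 1 + 1)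
      (st s a b (map un (rev xs)) (un x # mk y # map un ys))"
    by (intro does_Case) (use K assms in auto)
  from does_Seq[OF does_pop(3) this, of "mk x"]
  have "does (tab K (back_body K TYPE('a)) ! scanned (?s 3)) ?s (1 + (1 + 3 + 1 + 1) + 1)
      (st s a b (map un (rev xs)) (un x # mk y # map un ys))"
    using K assms by (simp add: back_body_def)
  from does_While_iter[OF _ _ this 1[unfolded rewind_def]] K assms
  have 2: "does (rewind K TYPE('a)) ?s (6 * length xs + 10) ?e"
    by (simp add: rewind_def add.commute)
  show ?thesis
    using back_off[of s a b "mk x # map un (rev xs)" "rev (ys) @ [y]" "[]" "6 * length xs + 10" ?e] 2 assms
    by (auto simp: rev_map intro: does_mono)
qed

lemma top_bounds:
  assumes "set xs \<subseteq> A" "y \<in> A"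
  shows "0 < scanned (st s a b c (map un xs @ mk y # r) 4)"
    "scanned (st s a b c (map un xs @ mk y # r) 4) < K"
  using assms K by (cases xs; simp)+

text \<open>Induction on the letters to the right of the mark: a sweep emits one marked copy and
  moves one letter to the left part. The total length \<open>n\<close> is fixed, so all sweeps share
  one bound.\<close>

lemma sweeps_run:
  assumes "set (xs @ y # ys) \<subseteq> A" "n = length (xs @ y # ys)"
  shows "does (sweeps K TYPE('a)) (st s a b [] (map un xs @ mk y # map un ys)) ((length ys + 1) * (20 * n + 30) + 1)
    (st s a (rev (map enc (flat (marks_from xs (y # ys)))) @ b) [] [])"
  using assms
proof (induction ys arbitrary: xs y b)
  case Nil
  let ?w = "map un xs @ mk y # map un ([] :: 'a list)" and ?N = "enc (None :: ('a \<times> bool) option)"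
  let ?s = "st s a b [] ?w" and ?o = "?N # rev ?w @ b"
  have "does (copy_out K) ?s (10 * length ?w + 1) (st s a (rev ?w @ b) (rev ?w @ []) [])"
    by (rule does_copy_out) (use K Nil in auto)
  moreover have "does (rewind K TYPE('a)) (st s a ?o (rev ?w @ []) []) (2 * length xs + 6) (st s a ?o [] [])"
    using back_last[of xs y s a ?o] Nil by simp
  ultimately have "does (Seq (copy_out K) (Seq (push 2 ?N) (rewind K TYPE('a)))) ?s
      (10 * length ?w + 1 + (3 + (2 * length xs + 6) + 1) + 1) (st s a ?o [] [])"
    using does_Seq does_push(2) by blast
  then have "does (tab K (\<lambda>_. Seq (copy_out K) (Seq (push 2 ?N) (rewind K TYPE('a)))) ! scanned (?s 4)) ?s
      (10 * length ?w + 1 + (3 + (2 * length xs + 6) + 1) + 1) (st s a ?o [] [])"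
    using top_bounds[of xs y s a b "[]" "[]"] Nil by simp
  moreover have "does (While 4 (tab K (\<lambda>_. Seq (copy_out K) (Seq (push 2 ?N) (rewind K TYPE('a))))))
      (st s a ?o [] []) 1 (st s a ?o [] [])"
    using does_While_stop[of "st s a ?o [] []" 4] by simp
  ultimately have "does (sweeps K TYPE('a)) ?s (10 * length ?w + 1 + (3 + (2 * length xs + 6) + 1) + 1 + 1 + 1) (st s a ?o [] [])"
    unfolding sweeps_def using top_bounds[of xs y s a b "[]" "[]"] Nil
    by (intro does_While_iter) simp_all
  then show ?case by (rule does_at_most) (use Nil in \<open>simp_all add: comp_def\<close>)
next
  case (Cons z ys)
  let ?w = "map un xs @ mk y # map un (z # ys)" and ?N = "enc (None :: ('a \<times> bool) option)"
  let ?s = "st s a b [] ?w" and ?o = "?N # rev ?w @ b"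
  let ?t = "st s a ?o [] (map un (xs @ [y]) @ mk z # map un ys)"
  let ?B = "10 * length ?w + 1 + (3 + (6 * (length xs + length ys) + 20) + 1) + 1"
  have "does (copy_out K) ?s (10 * length ?w + 1) (st s a (rev ?w @ b) (rev ?w @ []) [])"
    by (rule does_copy_out) (use K Cons.prems in auto)
  moreover have "does (rewind K TYPE('a)) (st s a ?o (rev ?w @ []) []) (6 * (length xs + length ys) + 20) ?t"
    using back_move[of xs y z ys s a ?o] Cons.prems by simp
  ultimately have "does (Seq (copy_out K) (Seq (push 2 ?N) (rewind K TYPE('a)))) ?s ?B ?t"
    using does_Seq does_push(2) by blast
  then have "does (tab K (\<lambda>_. Seq (copy_out K) (Seq (push 2 ?N) (rewind K TYPE('a)))) ! scanned (?s 4)) ?s ?B ?t"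
    using top_bounds[of xs y s a b "[]" "un z # map un ys"] Cons.prems by simp
  moreover have "does (While 4 (tab K (\<lambda>_. Seq (copy_out K) (Seq (push 2 ?N) (rewind K TYPE('a)))))) ?t
      ((length ys + 1) * (20 * n + 30) + 1)
      (st s a (rev (map enc (flat (marks_from (xs @ [y]) (z # ys)))) @ ?o) [] [])"
    using Cons.IH[of "xs @ [y]" z ?o] Cons.prems by (simp add: sweeps_def)
  ultimately have "does (sweeps K TYPE('a)) ?s (?B + ((length ys + 1) * (20 * n + 30) + 1) + 1)
     (st s a (rev (map enc (flat (marks_from (xs @ [y]) (z # ys)))) @ ?o) [] [])"
    unfolding sweeps_def using top_bounds[of xs y s a b "[]" "un z # map un ys"] Cons.prems
    by (intro does_While_iter) simp_all
  then show ?case by (rule does_at_most) (use Cons.prems in \<open>simp_all add: comp_def\<close>)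
qed

lemma main_block:
  assumes "set b \<subseteq> A" "length b \<le> n"
    and rest: "does (While 1 (tab K (main_body K TYPE('a)))) (st s r (rev (map enc (flat (marks b))) @ o1) [] []) B t"
  shows "does (While 1 (tab K (main_body K TYPE('a)))) (st s (enc (None :: 'a option) # r) o1 (rev (map un b)) [])
     ((n + 1) * (20 * n + 50) + B) t"
proof -
  let ?P = "Seq (move K 3 4) (Seq (Case 4 (tab K (first_mark TYPE('a)))) (sweeps K TYPE('a)))"
  let ?f = "st s r (rev (map enc (flat (marks b))) @ o1) [] []"
  have 1: "does (move K 3 4) (st s r o1 (rev (map un b)) []) (6 * length b + 1) (st s r o1 [] (map un b))"
    using does_move_3_4[of "rev (map un b)" K s r o1 "[]"] K assms by fastforce
  \<comment> \<open>Five steps are held back for removing the terminator and for the surrounding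
    loop.\<close>
  have 2: "does ?P (st s r o1 (rev (map un b)) []) ((n + 1) * (20 * n + 50) - 5) ?f"
  proof (cases b)
    case Nil
    let ?u = "st s r o1 [] []"
    have "does (Case 4 (tab K (first_mark TYPE('a)))) ?u (1 + 1) ?u"
      by (rule does_Case) (use K_pos does_skip in \<open>auto simp: first_mark_def\<close>)
    moreover have "does (sweeps K TYPE('a)) ?u 1 ?u"
      unfolding sweeps_def by (rule does_While_stop) simp
    ultimately have 3: "does (Seq (Case 4 (tab K (first_mark TYPE('a)))) (sweeps K TYPE('a))) ?u (1 + 1 + 1 + 1) ?u"
      by (rule does_Seq)
    have "does (move K 3 4) (st s r o1 (rev (map un b)) []) (6 * length b + 1) ?u"
      using 1 by (simp add: Nil)
    from does_Seq[OF this 3] show ?thesis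
      by (rule does_at_most) (simp_all add: Nil marks_def)
  next
    case (Cons x xs)
    let ?u = "st s r o1 [] (un x # map un xs)" and ?v = "st s r o1 [] (mk x # map un xs)"
    have "does (Case 4 (tab K (first_mark TYPE('a)))) ?u (1 + 1) ?v"
      by (rule does_Case) (use K assms(1) Cons does_set_top(4) in \<open>auto simp: first_mark_def\<close>)
    moreover have "does (sweeps K TYPE('a)) ?v ((length xs + 1) * (20 * length b + 30) + 1) ?f"
      using sweeps_run[of "[]" x xs "length b" s r o1] assms Cons by (simp add: marks_def)
    ultimately have 3: "does (Seq (Case 4 (tab K (first_mark TYPE('a)))) (sweeps K TYPE('a))) ?u
        (1 + 1 + ((length xs + 1) * (20 * length b + 30) + 1) + 1) ?f"
      by (rule does_Seq)
    have "does (move K 3 4) (st s r o1 (rev (map un b)) []) (6 * length b + 1) ?u"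
      using 1 by (simp add: Cons)
    from does_Seq[OF this 3] have "does ?P (st s r o1 (rev (map un b)) [])
        (6 * length b + 1 + (1 + 1 + ((length xs + 1) * (20 * length b + 30) + 1) + 1) + 1) ?f" .
    moreover have "(length xs + 1) * (20 * length b + 30) \<le> n * (20 * n + 30)"
      using assms(2) Cons by (intro mult_mono) auto
    moreover have "(n + 1) * (20 * n + 50) = n * (20 * n + 30) + 40 * n + 50"
      by (simp add: algebra_simps)
    ultimately show ?thesis using assms(2) by (elim does_mono) linarith
  qed
  let ?s = "st s (enc (None :: 'a option) # r) o1 (rev (map un b)) []"
  have "does (tab K (main_body K TYPE('a)) ! scanned (?s 1)) ?s (1 + ((n + 1) * (20 * n + 50) - 5) + 1) ?f"
    using does_Seq[OF does_pop(1) 2] K by (simp add: main_body_def)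
  from does_While_iter[OF _ _ this rest] K
  have "does (While 1 (tab K (main_body K TYPE('a)))) ?s
      (1 + ((n + 1) * (20 * n + 50) - 5) + 1 + B + 1) t" by simp
  then show ?thesis by (rule does_mono) (simp add: algebra_simps)
qed

lemma main_load:
  assumes "set b \<subseteq> A"
    and "does (While 1 (tab K (main_body K TYPE('a)))) (st s r o1 (rev (map un b) @ c) []) B t"
  shows "does (While 1 (tab K (main_body K TYPE('a)))) (st s (map enc (map Some b) @ r) o1 c []) (6 * length b + B) t"
  using assms
proof (induction b arbitrary: c)
  case (Cons x b)
  let ?s = "st s (map enc (map Some (x # b)) @ r) o1 c []"
  have x: "enc (Some x) < K" using K Cons.prems by auto
  have "does (tab K (main_body K TYPE('a)) ! scanned (?s 1)) ?s (1 + 3 + 1) (st s (map enc (map Some b) @ r) o1 (un x # c) [])"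
    using does_Seq[OF does_pop(1) does_push(3)] x by (simp add: main_body_def)
  from does_While_iter[OF _ _ this Cons.IH] Cons.prems x show ?case by (simp add: ac_simps)
qed simp

lemma main_run:
  assumes "\<And>b. b \<in> set bs \<Longrightarrow> set b \<subseteq> A \<and> length b \<le> n"
  shows "does (While 1 (tab K (main_body K TYPE('a)))) (st s (map enc (flat bs)) o1 [] [])
     (length bs * (6 * n + (n + 1) * (20 * n + 50)) + 1) (st s [] (rev (map enc (flat (concat (map marks bs)))) @ o1) [] [])"
  using assms
proof (induction bs arbitrary: o1)
  case Nil
  show ?case using does_While_stop[of "st s [] o1 [] []" 1] by simp
next
  case (Cons b bs)
  have b: "set b \<subseteq> A" "length b \<le> n" using Cons.prems by auto
  have "does (While 1 (tab K (main_body K TYPE('a)))) (st s (map enc (flat bs)) (rev (map enc (flat (marks b))) @ o1) [] [])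
     (length bs * (6 * n + (n + 1) * (20 * n + 50)) + 1)
     (st s [] (rev (map enc (flat (concat (map marks bs)))) @ rev (map enc (flat (marks b))) @ o1) [] [])"
    (is "does _ _ ?B ?t") using Cons by simp
  from main_block[OF b this]
  have "does (While 1 (tab K (main_body K TYPE('a)))) (st s (enc (None :: 'a option) # map enc (flat bs)) o1 (rev (map un b)) [])
     ((n + 1) * (20 * n + 50) + ?B) ?t" .
  then have "does (While 1 (tab K (main_body K TYPE('a)))) (st s (map enc (flat (b # bs))) o1 [] [])
    (6 * length b + ((n + 1) * (20 * n + 50) + ?B)) ?t"
    using main_load[OF b(1), of s "enc (None :: 'a option) # map enc (flat bs)" o1 "[]"] by simp
  then show ?case by (rule does_at_most) (use b(2) in simp_all)
qed

end

lemma length_marks: "length (marks b) = length b" "x \<in> set (marks b) \<Longrightarrow> length x = length b"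
  by (auto simp: marks_conv)

lemma length_flat: "length (flat bs) = sum_list (map (\<lambda>b. length b + 1) bs)"
  by (induction bs) auto

lemma length_flat_marks: "length (flat (marks b)) = length b * (length b + 1)"
proof -
  have "map (\<lambda>x. length x + 1) (marks b) = map (\<lambda>_. length b + 1) (marks b)"
    using length_marks(2) by (intro map_cong) auto
  then show ?thesis by (simp only: length_flat map_replicate_const sum_list_replicate length_marks of_nat_id)
qed

theorem pf_mark:
  fixes A :: "'a :: countable set"
  assumes A: "finite A"
  shows "pf (flat ` lists (lists A)) mark"
proof -
  let ?X = "(\<lambda>(x, m). enc (Some (x, m :: bool))) ` (A \<times> UNIV) \<union> (\<lambda>x. enc (Some x)) ` A \<union>
    {enc (None :: 'a option), enc (None :: ('a \<times> bool) option)}"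
  have "finite ?X" using A by simp
  then obtain K where "\<forall>k \<in> ?X. k < K" using finite_nat_set_iff_bounded by blast
  then have K: "\<And>x m. x \<in> A \<Longrightarrow> enc (Some (x, m :: bool)) < K" "\<And>x. x \<in> A \<Longrightarrow> enc (Some x) < K"
    "enc (None :: 'a option) < K" "enc (None :: ('a \<times> bool) option) < K" by auto
  \<comment> \<open>The term \<open>n * (n * (n + 1))\<close> bounds the output: at most
    \<open>n\<close> blocks of length at most \<open>n\<close>, each turning into at most
    \<open>n\<close> blocks of at most \<open>n + 1\<close> symbols.\<close>
  define p where "p = (\<lambda>n :: nat. n * (6 * n + (n + 1) * (20 * n + 50)) + 6 * (n * (n * (n + 1))) + 3)"
  have "pb p" unfolding p_def by (intro pb_add pb_mult pb_const pb_id)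
  moreover have "length (mark xs) \<le> p (length xs) \<and> does (mark_prog K TYPE('a)) (st s (map enc xs) [] [] [])
      (p (length xs)) (st s (map enc (mark xs)) [] [] [])"
    if "xs \<in> flat ` lists (lists A)" for xs s
  proof -
    obtain bs where bs: "xs = flat bs" "bs \<in> lists (lists A)" using \<open>xs \<in> _\<close> by blast
    let ?n = "length xs" and ?o = "rev (map enc (mark xs))"
    have n: "length bs \<le> ?n" by (simp add: bs(1) length_flat sum_list_Suc)
    have "length (flat (concat (map marks cs))) \<le> length cs * (?n * (?n + 1))"
      if "set cs \<subseteq> set bs" for cs using that
    proof (induction cs)
      case (Cons c cs)
      then have "length c \<le> ?n" using length_flat_mono[of c bs] bs by auto
      then have "length (flat (marks c)) \<le> ?n * (?n + 1)"
        unfolding length_flat_marks by (intro mult_mono) auto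
      then show ?case using Cons by simp
    qed simp
    then have "length (mark xs) \<le> length bs * (?n * (?n + 1))" by (simp add: bs)
    also have "\<dots> \<le> ?n * (?n * (?n + 1))" using n by simp
    finally have len: "length (mark xs) \<le> ?n * (?n * (?n + 1))" .
    have 1: "does (While 1 (tab K (main_body K TYPE('a)))) (st s (map enc xs) [] [] [])
       (length bs * (6 * ?n + (?n + 1) * (20 * ?n + 50)) + 1) (st s [] ?o [] [])"
      using main_run[OF K, where bs = bs and n = ?n and s = s and ?o1.0 = "[]"] bs length_flat_mono by (fastforce simp: bs(1))
    have out: "set (mark xs) \<subseteq> insert None ((\<lambda>(x, m). Some (x, m)) ` (A \<times> UNIV))"
    proof -
      have marked: "set b \<subseteq> A \<times> UNIV" if "b \<in> set (marks c)" "c \<in> lists A" for b c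
        using that by (auto simp: marks_conv in_lists_conv_set)
      have flat: "set (flat cs) \<subseteq> insert None (Some ` X)" if "\<forall>c \<in> set cs. set c \<subseteq> X"
        for cs :: "'c list list" and X
        using that by (induction cs) auto
      have "set (flat (concat (map marks bs))) \<subseteq> insert None (Some ` (A \<times> UNIV))"
      proof (rule flat, rule ballI)
        fix c assume "c \<in> set (concat (map marks bs))"
        then obtain b where "b \<in> set bs" "c \<in> set (marks b)" by auto
        then show "set c \<subseteq> A \<times> UNIV" using marked bs(2) by (meson in_listsD)
      qed
      then show ?thesis by (auto simp: bs(1))
    qed
    have 2: "does (move K 2 1) (st s [] ?o [] []) (6 * length ?o + 1) (st s (map enc (mark xs)) [] [] [])"
      using does_move_2_1[of ?o K s "[]" "[]" "[]"] out K by fastforce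
    have "does (mark_prog K TYPE('a)) (st s (map enc xs) [] [] [])
       (length bs * (6 * ?n + (?n + 1) * (20 * ?n + 50)) + 1 + (6 * length ?o + 1) + 1)
       (st s (map enc (mark xs)) [] [] [])"
      unfolding mark_prog_def by (rule does_Seq[OF 1 2])
    moreover have "length bs * (6 * ?n + (?n + 1) * (20 * ?n + 50)) \<le> ?n * (6 * ?n + (?n + 1) * (20 * ?n + 50))"
      using n by (intro mult_right_mono) auto
    ultimately have "does (mark_prog K TYPE('a)) (st s (map enc xs) [] [] []) (p ?n)
        (st s (map enc (mark xs)) [] [] [])"
      by (elim does_mono) (use len in \<open>simp only: p_def length_rev length_map; linarith\<close>)
    then show ?thesis using len by (simp add: p_def)
  qed
  ultimately show ?thesis unfolding pf_def using wfi_mark_prog by blast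
qed

section \<open>From unary to binary numbers\<close>

datatype tok = Tick | Sep | Endl

instance tok :: countable by countable_datatype

text \<open>Ticks form a unary number, \<open>Sep\<close> ends the number and resets the count,
  \<open>Endl\<close> ends a list: the shape of the instance encoding with unary in place of binary
  numerals.\<close>

fun to_binary :: "nat \<Rightarrow> tok list \<Rightarrow> bool list" where
  "to_binary k [] = []"
| "to_binary k (Tick # xs) = to_binary (Suc k) xs"
| "to_binary k (Sep # xs) = encode_nat k @ to_binary 0 xs"
| "to_binary k (Endl # xs) = [False, True] @ to_binary k xs"

fun incr :: "bool list \<Rightarrow> bool list" where
  "incr [] = [True]"
| "incr (False # bs) = True # bs"
| "incr (True # bs) = False # incr bs"

lemma binary_0 [simp]: "binary 0 = []"
  by (simp add: binary.simps)

lemma binary_Suc: "binary (Suc k) = incr (binary k)"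
proof (induction k rule: less_induct)
  case (less k)
  show ?case
  proof (cases "k = 0")
    case True
    then show ?thesis by (simp add: binary.simps)
  next
    case False
    have k: "binary k = odd k # binary (k div 2)" using False by (simp add: binary.simps[of k])
    have S: "binary (Suc k) = even k # binary (Suc k div 2)" by (simp add: binary.simps[of "Suc k"])
    show ?thesis
    proof (cases "even k")
      case True
      then show ?thesis using S k by simp
    next
      case odd: False
      then have "Suc k div 2 = Suc (k div 2)" by (elim oddE) simp
      moreover have "binary (Suc (k div 2)) = incr (binary (k div 2))"
        using less.IH[of "k div 2"] False by simp
      ultimately show ?thesis using S k odd by simp
    qed
  qed
qed

lemma length_binary: "length (binary k) \<le> k"
proof (induction k)
  case (Suc k)
  have "length (incr bs) \<le> Suc (length bs)" for bs by (induction bs rule: incr.induct) auto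
  from this[of "binary k"] Suc show ?case by (simp add: binary_Suc)
qed simp

definition digit :: "bool \<Rightarrow> nat" where "digit b = (if b then 2 else 1)"

text \<open>The counter on stack 3 has its least significant digit on top and the sentinel 3 at the bottom.\<close>

definition counter :: "bool list \<Rightarrow> nat list" where "counter bs = map digit bs @ [3]"

lemma does_While_top:
  assumes "does e s B t" "does (While i bs) t B' u"
    and "scanned (s i) = a" "0 < a" "a < length bs" "bs ! a = e"
  shows "does (While i bs) s (B + B' + 1) u"
  using does_While_iter[of s i bs B t B' u] assms by simp

text \<open>The nonblank branches are for digit zero, digit one and the sentinel. A one becomes a
  zero and the carry goes on; a zero absorbs the carry and the remaining digits move unchanged; at
  the sentinel a new leading one is inserted. The result appears reversed on stack 4.\<close>

definition carry :: com where
  "carry = While 3 [skip,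
     Seq (pop 3) (Seq (push 4 2) (move 4 3 4)),
     Seq (pop 3) (push 4 1),
     Seq (pop 3) (Seq (push 4 2) (push 4 3))]"

lemma does_move_4_3:
  assumes "\<And>x. x \<in> set xs \<Longrightarrow> 0 < x \<and> x < K"
  shows "does (move K 4 3) (st s e b a xs) (6 * length xs + 1) (st s e b (rev xs @ a) [])"
  using assms
proof (induction xs arbitrary: a)
  case Nil
  show ?case unfolding move_def using does_While_stop[of "st s e b a []" 4] by simp
next
  case (Cons x xs)
  have x: "0 < x" "x < K" using Cons.prems by auto
  have "does (tab K (\<lambda>a. Seq (pop 4) (push 3 a)) ! scanned ((st s e b a (x # xs)) 4))
      (st s e b a (x # xs)) (1 + 3 + 1) (st s e b (x # a) xs)"
    using does_Seq[OF does_pop(4) does_push(3)] x by simp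
  from does_While_iter[OF _ _ this Cons.IH[unfolded move_def]] Cons.prems x
  show ?case by (simp add: move_def)
qed

lemma carry_run:
  "does carry (st s a b (counter bs) d) (6 * length bs + 20) (st s a b [] (rev (counter (incr bs)) @ d))"
proof (induction bs arbitrary: d rule: incr.induct)
  case 1
  let ?t = "st s a b [] (3 # 2 # d)"
  have 2: "does carry ?t 1 ?t" unfolding carry_def by (rule does_While_stop) simp
  have "does (Seq (pop 3) (Seq (push 4 2) (push 4 3))) (st s a b [3] d) (1 + (3 + 3 + 1) + 1) ?t"
    by (rule does_Seq[OF does_pop(3) does_Seq[OF does_push(4) does_push(4)]])
  from does_While_top[OF this 2[unfolded carry_def], of "3"]
  have "does carry (st s a b [3] d) (1 + (3 + 3 + 1) + 1 + 1 + 1) ?t"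
    unfolding carry_def by (simp_all add: counter_def digit_def)
  then show ?case by (simp add: counter_def digit_def does_mono)
next
  case (2 bs)
  let ?s = "st s a b (counter (False # bs)) d" and ?c = "counter bs"
  let ?t = "st s a b [] (rev (counter (True # bs)) @ d)"
  have 1: "does carry ?t 1 ?t" unfolding carry_def by (rule does_While_stop) simp
  have "does (move 4 3 4) (st s a b ?c (2 # d)) (6 * length ?c + 1) (st s a b [] (rev ?c @ 2 # d))"
    by (rule does_move_3_4) (auto simp: counter_def digit_def)
  from does_Seq[OF does_pop(3) does_Seq[OF does_push(4) this]]
  have "does (Seq (pop 3) (Seq (push 4 2) (move 4 3 4))) ?s (1 + (3 + (6 * length ?c + 1) + 1) + 1) ?t"
    by (simp add: counter_def digit_def)
  from does_While_top[OF this 1[unfolded carry_def], of "1"]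
  have "does carry ?s (1 + (3 + (6 * length ?c + 1) + 1) + 1 + 1 + 1) ?t"
    unfolding carry_def by (simp_all add: counter_def digit_def)
  then show ?case by (rule does_at_most) (simp_all add: counter_def)
next
  case (3 bs)
  let ?s = "st s a b (counter (True # bs)) d" and ?u = "st s a b (counter bs) (1 # d)"
  let ?t = "st s a b [] (rev (counter (incr bs)) @ 1 # d)"
  have "does (Seq (pop 3) (push 4 1)) ?s (1 + 3 + 1) ?u"
    using does_Seq[OF does_pop(3) does_push(4)] by (simp add: counter_def digit_def)
  from does_While_top[OF this 3[unfolded carry_def], of "2"]
  have "does carry ?s (1 + 3 + 1 + (6 * length bs + 20) + 1) ?t"
    unfolding carry_def by (simp_all add: counter_def digit_def)
  then show ?case by (rule does_at_most) (simp_all add: counter_def digit_def)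
qed

definition increment :: com where "increment = Seq carry (move 4 4 3)"

lemma does_increment:
  "does increment (st s a b (counter bs) []) (12 * length bs + 40) (st s a b (counter (incr bs)) [])"
proof -
  have len: "length (incr bs) \<le> length bs + 1" by (induction bs rule: incr.induct) auto
  have "does (move 4 4 3) (st s a b [] (rev (counter (incr bs)) @ []))
     (6 * length (rev (counter (incr bs)) @ []) + 1) (st s a b (rev (rev (counter (incr bs)) @ []) @ []) [])"
    by (rule does_move_4_3) (auto simp: counter_def digit_def)
  from does_Seq[OF carry_run this] show ?thesis
    unfolding increment_def by (rule does_at_most) (use len in \<open>simp_all add: counter_def\<close>)
qed

definition bits_out :: "bool list \<Rightarrow> com" where "bits_out bs = pushes (map enc bs)"

lemma does_bits_out:
  "does (bits_out bs) (st s a b c d) (4 * length bs + 1) (st s a (rev (map enc bs) @ b) c d)"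
  using does_pushes[of "map enc bs"] by (simp add: bits_out_def)

definition emit :: com where
  "emit = While 3 [skip,
     Seq (pop 3) (bits_out [True, False]),
     Seq (pop 3) (bits_out [True, True]),
     Seq (pop 3) (bits_out [False, False])]"

lemma does_emit:
  "does emit (st s a b (counter bs) d) (12 * length bs + 13)
     (st s a (rev (map enc (concat (map (\<lambda>b. [True, b]) bs) @ [False, False])) @ b) [] d)"
proof (induction bs arbitrary: b)
  case Nil
  let ?t = "st s a (rev (map enc [False, False]) @ b) [] d"
  have 2: "does emit ?t 1 ?t" unfolding emit_def by (rule does_While_stop) simp
  have "does (Seq (pop 3) (bits_out [False, False])) (st s a b [3] d) (1 + (4 * length [False, False] + 1) + 1) ?t"
    by (rule does_Seq[OF does_pop(3) does_bits_out])
  from does_While_top[OF this 2[unfolded emit_def], of "3"]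
  have "does emit (st s a b [3] d) (1 + (4 * length [False, False] + 1) + 1 + 1 + 1) ?t"
    unfolding emit_def by (simp_all add: counter_def digit_def)
  then show ?case by (auto simp: counter_def elim: does_mono)
next
  case (Cons x bs)
  let ?s = "st s a b (counter (x # bs)) d"
  have "does (Seq (pop 3) (bits_out [True, x])) ?s (1 + (4 * length [True, x] + 1) + 1)
     (st s a (rev (map enc [True, x]) @ b) (counter bs) d)"
    using does_Seq[OF does_pop(3) does_bits_out[of "[True, x]"]] by (simp add: counter_def)
  from does_While_top[OF this Cons.IH[unfolded emit_def], of "digit x"]
  have "does emit ?s (1 + (4 * length [True, x] + 1) + 1 + (12 * length bs + 13) + 1)
     (st s a (rev (map enc (concat (map (\<lambda>b. [True, b]) bs) @ [False, False])) @ rev (map enc [True, x]) @ b) [] d)"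
    unfolding emit_def by (cases x; simp add: counter_def digit_def)+
  then show ?case by (rule does_at_most) simp_all
qed

definition tok_body :: "nat \<Rightarrow> com" where
  "tok_body a = Seq (pop 1) (case dec a of
     Tick \<Rightarrow> increment
   | Sep \<Rightarrow> Seq emit (push 3 3)
   | Endl \<Rightarrow> bits_out [False, True])"

definition tok_loop :: "nat \<Rightarrow> com" where "tok_loop K = While 1 (tab K tok_body)"

text \<open>Counter plus remaining tokens never exceeds \<open>n\<close>, so a token costs linear
  time even when the length of a numeral is bounded by its value. The final \<open>k'\<close> counts
  ticks not followed by a separator and has to be cleared afterwards.\<close>

lemma tok_loop_run:
  assumes K: "\<And>x :: tok. enc x < K" and n: "k + length xs \<le> n"
  shows "\<exists>k'. does (tok_loop K) (st s (map enc xs) b (counter (binary k)) []) (length xs * (12 * n + 60) + 1)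
    (st s [] (rev (map enc (to_binary k xs)) @ b) (counter (binary k')) []) \<and> k' \<le> n"
  using n
proof (induction k xs arbitrary: b rule: to_binary.induct)
  case (1 k)
  then show ?case using does_While_stop[of "st s [] b (counter (binary k)) []" 1 "tab K tok_body"]
    by (auto simp: tok_loop_def intro!: exI[of _ k])
next
  case (2 k xs)
  let ?s = "st s (map enc (Tick # xs)) b (counter (binary k)) []"
  have "does (tab K tok_body ! scanned (?s 1)) ?s (1 + (12 * length (binary k) + 40) + 1)
     (st s (map enc xs) b (counter (binary (Suc k))) [])"
    using does_Seq[OF does_pop(1) does_increment] K[of Tick] by (simp add: tok_body_def binary_Suc)
  moreover obtain k' where "does (tok_loop K) (st s (map enc xs) b (counter (binary (Suc k))) []) (length xs * (12 * n + 60) + 1)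
    (st s [] (rev (map enc (to_binary (Suc k) xs)) @ b) (counter (binary k')) [])" "k' \<le> n"
    using 2 by fastforce
  ultimately have "does (tok_loop K) ?s (1 + (12 * length (binary k) + 40) + 1 + (length xs * (12 * n + 60) + 1) + 1)
    (st s [] (rev (map enc (to_binary (Suc k) xs)) @ b) (counter (binary k')) [])"
    unfolding tok_loop_def by (intro does_While_iter) (use K in auto)
  then show ?case using \<open>k' \<le> n\<close> length_binary[of k] 2(2)
    by (intro exI[of _ k'] conjI) (erule does_at_most, auto)
next
  case (3 k xs)
  let ?s = "st s (map enc (Sep # xs)) b (counter (binary k)) []"
  let ?b = "rev (map enc (encode_nat k)) @ b"
  have "does (Seq emit (push 3 3)) (st s (map enc xs) b (counter (binary k)) []) (12 * length (binary k) + 13 + 3 + 1)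
     (st s (map enc xs) ?b (counter (binary 0)) [])"
    using does_Seq[OF does_emit does_push(3)] by (simp add: counter_def encode_nat_def)
  from does_Seq[OF does_pop(1) this]
  have "does (tab K tok_body ! scanned (?s 1)) ?s (1 + (12 * length (binary k) + 13 + 3 + 1) + 1)
     (st s (map enc xs) ?b (counter (binary 0)) [])"
    using K[of Sep] by (simp add: tok_body_def)
  moreover obtain k' where "does (tok_loop K) (st s (map enc xs) ?b (counter (binary 0)) []) (length xs * (12 * n + 60) + 1)
    (st s [] (rev (map enc (to_binary 0 xs)) @ ?b) (counter (binary k')) [])" "k' \<le> n"
    using 3 by fastforce
  ultimately have "does (tok_loop K) ?s (1 + (12 * length (binary k) + 13 + 3 + 1) + 1 + (length xs * (12 * n + 60) + 1) + 1)
    (st s [] (rev (map enc (to_binary 0 xs)) @ ?b) (counter (binary k')) [])"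
    unfolding tok_loop_def by (intro does_While_iter) (use K in auto)
  then show ?case using \<open>k' \<le> n\<close> length_binary[of k] 3(2)
    by (intro exI[of _ k'] conjI) (erule does_at_most, auto)
next
  case (4 k xs)
  let ?s = "st s (map enc (Endl # xs)) b (counter (binary k)) []"
  let ?b = "rev (map enc [False, True]) @ b"
  have "does (tab K tok_body ! scanned (?s 1)) ?s (1 + (4 * length [False, True] + 1) + 1)
     (st s (map enc xs) ?b (counter (binary k)) [])"
    using does_Seq[OF does_pop(1) does_bits_out[of "[False, True]"]] K[of Endl] by (simp add: tok_body_def)
  moreover obtain k' where "does (tok_loop K) (st s (map enc xs) ?b (counter (binary k)) []) (length xs * (12 * n + 60) + 1)
    (st s [] (rev (map enc (to_binary k xs)) @ ?b) (counter (binary k')) [])" "k' \<le> n"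
    using 4 by fastforce
  ultimately have "does (tok_loop K) ?s (1 + (4 * length [False, True] + 1) + 1 + (length xs * (12 * n + 60) + 1) + 1)
    (st s [] (rev (map enc (to_binary k xs)) @ ?b) (counter (binary k')) [])"
    unfolding tok_loop_def by (intro does_While_iter) (use K in auto)
  then show ?case using \<open>k' \<le> n\<close>
    by (intro exI[of _ k'] conjI) (erule does_at_most, auto)
qed

lemma length_to_binary: "k + length xs \<le> n \<Longrightarrow> length (to_binary k xs) \<le> length xs * (2 * n + 2)"
proof (induction k xs rule: to_binary.induct)
  case (3 k xs)
  have "length (concat (map (\<lambda>b. [True, b]) bs)) = 2 * length bs" for bs by (induction bs) auto
  then show ?case using 3 length_binary[of k] by (simp add: encode_nat_def)
qed auto

theorem pf_to_binary: "pf UNIV (to_binary 0)"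
proof -
  have "(UNIV :: tok set) = {Tick, Sep, Endl}" using tok.exhaust by auto
  then have "finite (UNIV :: tok set)" by (metis finite.emptyI finite_insert)
  from enc_bound[OF this] obtain K where K: "\<And>x :: tok. enc x < K" by auto
  have "finite (UNIV :: bool set)" by simp
  from enc_bound[OF this] obtain K' where K': "\<And>x :: bool. enc x < K'" by auto
  define prog where "prog = Seq (push 3 3) (Seq (tok_loop K) (Seq (clear3 4) (move K' 2 1)))"
  define p where "p = (\<lambda>n :: nat. n * (12 * n + 60) + 2 * n + 6 * (n * (2 * n + 2)) + 20)"
  have "pb p" unfolding p_def by (intro pb_add pb_mult pb_const pb_id)
  moreover have "wfi 6 prog"
    by (auto simp: prog_def tok_loop_def tok_body_def increment_def carry_def emit_def clear3_def
        bits_out_def split: tok.splits)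
  moreover have "length (to_binary 0 xs) \<le> p (length xs) \<and> does prog (st s (map enc xs) [] [] [])
     (p (length xs)) (st s (map enc (to_binary 0 xs)) [] [] [])" for xs s
  proof -
    let ?n = "length xs" and ?o = "rev (map enc (to_binary 0 xs))"
    have len: "length (to_binary 0 xs) \<le> ?n * (2 * ?n + 2)" by (rule length_to_binary) simp
    obtain k' where k': "does (tok_loop K) (st s (map enc xs) [] [3] []) (?n * (12 * ?n + 60) + 1)
      (st s [] ?o (counter (binary k')) [])" "k' \<le> ?n"
      using tok_loop_run[OF K, of 0 xs ?n s "[]"] by (auto simp: counter_def)
    have 1: "does (clear3 4) (st s [] ?o (counter (binary k')) []) (2 * length (counter (binary k')) + 1) (st s [] ?o [] [])"
      by (rule does_clear3) (auto simp: counter_def digit_def)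
    have 2: "does (move K' 2 1) (st s [] ?o [] []) (6 * length ?o + 1) (st s (map enc (to_binary 0 xs)) [] [] [])"
      using does_move_2_1[of ?o K' s "[]" "[]" "[]"] K' by fastforce
    have "does prog (st s (map enc xs) [] [] [])
      (3 + (?n * (12 * ?n + 60) + 1 + (2 * length (counter (binary k')) + 1 + (6 * length ?o + 1) + 1) + 1) + 1)
      (st s (map enc (to_binary 0 xs)) [] [] [])"
      unfolding prog_def by (rule does_Seq[OF does_push(3) does_Seq[OF k'(1) does_Seq[OF 1 2]]])
    then have "does prog (st s (map enc xs) [] [] []) (p ?n) (st s (map enc (to_binary 0 xs)) [] [] [])"
    proof (rule does_mono)
      have "length (counter (binary k')) \<le> ?n + 1"
        using length_binary[of k'] k'(2) by (simp add: counter_def)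
      then show "3 + (?n * (12 * ?n + 60) + 1 + (2 * length (counter (binary k')) + 1 + (6 * length ?o + 1) + 1) + 1) + 1 \<le> p ?n"
        unfolding p_def using len by (simp only: length_rev length_map)
    qed
    then show ?thesis using len by (simp add: p_def)
  qed
  ultimately show ?thesis unfolding pf_def by blast
qed

section \<open>Input and output tapes\<close>

text \<open>The input tape is not in stack format: its head starts at cell 0 and runs right up to
  the first blank. Testing \<open>a = 2\<close> turns the symbol back into a bit.\<close>

definition read_input :: "nat \<Rightarrow> com" where
  "read_input K = Seq (While 0 (tab 3 (\<lambda>a. Seq (Act 0 None Move_Right) (push 2 (enc (a = 2)))))) (move K 2 1)"

definition input_at :: "bool list \<Rightarrow> nat \<Rightarrow> tape" where
  "input_at x h = ((\<lambda>i. if i < length x then bit_symbol (x ! i) else 0), h)"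

lemma does_read_input:
  assumes K: "\<And>b :: bool. enc b < K" and s: "s 0 = input_at x 0"
  shows "does (read_input K) (st s [] [] [] []) (13 * length x + 3)
    (st (s(0 := input_at x (length x))) (map enc x) [] [] [])"
proof -
  let ?S = "\<lambda>h. s(0 := input_at x h)"
  let ?L = "While 0 (tab 3 (\<lambda>a. Seq (Act 0 None Move_Right) (push 2 (enc (a = 2)))))"
  have 0: "st (?S h) a b c d 0 = input_at x h" for h a b c d by (simp add: st_def)
  have upd: "(st (?S h) a b c d)(0 := input_at x h') = st (?S h') a b c d" for h h' a b c d
    by (auto simp: st_def fun_eq_iff)
  have loop: "does ?L (st (?S h) [] (rev (map enc (take h x))) [] []) (6 * (length x - h) + 1)
     (st (?S (length x)) [] (rev (map enc x)) [] [])" if "h \<le> length x" for h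
    using that
  proof (induction h rule: inc_induct)
    case base
    have "scanned (st (?S (length x)) [] (rev (map enc (take (length x) x))) [] [] 0) = 0"
      unfolding 0 by (simp add: input_at_def scanned_def)
    then show ?case by (intro does_at_most[OF does_While_stop]) (simp_all add: fun_upd_def)
  next
    case (step h)
    let ?s = "st (?S h) [] (rev (map enc (take h x))) [] []"
    have h: "h < length x" using step by simp
    have sc: "scanned (?s 0) = bit_symbol (x ! h)" unfolding 0 using h by (simp add: input_at_def scanned_def)
    have "does (Act 0 None Move_Right) ?s 1 (st (?S (Suc h)) [] (rev (map enc (take h x))) [] [])"
    proof -
      have "act (?s 0) (scanned (?s 0), Move_Right) = input_at x (Suc h)"
        unfolding 0 using h by (auto simp: input_at_def scanned_def act_def fun_eq_iff)
      then show ?thesis using does_Act[of 0 None Move_Right ?s] upd by simp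
    qed
    from does_Seq[OF this does_push(2), of "enc (x ! h)"]
    have "does (tab 3 (\<lambda>a. Seq (Act 0 None Move_Right) (push 2 (enc (a = 2)))) ! scanned (?s 0)) ?s (1 + 3 + 1)
      (st (?S (Suc h)) [] (rev (map enc (take (Suc h) x))) [] [])"
      unfolding sc using h by (cases "x ! h") (simp_all add: bit_symbol_def take_Suc_conv_app_nth)
    from does_While_iter[OF _ _ this step.IH]
    have "does ?L ?s (1 + 3 + 1 + (6 * (length x - Suc h) + 1) + 1) (st (?S (length x)) [] (rev (map enc x)) [] [])"
      unfolding sc by (cases "x ! h") (simp_all add: bit_symbol_def fun_upd_def)
    then show ?case by (rule does_mono) (use h in simp)
  qed
  have "?S 0 = s" using s by (simp add: fun_eq_iff)
  then have 1: "does ?L (st s [] [] [] []) (6 * length x + 1) (st (?S (length x)) [] (rev (map enc x)) [] [])"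
    using loop[of 0] by simp
  have 2: "does (move K 2 1) (st (?S (length x)) [] (rev (map enc x)) [] []) (6 * length (rev (map enc x)) + 1)
     (st (?S (length x)) (map enc x) [] [] [])"
    using does_move_2_1[of "rev (map enc x)" K "?S (length x)" "[]" "[]" "[]"] K by fastforce
  from does_Seq[OF 1 2] show ?thesis
    unfolding read_input_def by (rule does_mono) simp
qed

definition write_output :: "nat \<Rightarrow> com" where
  "write_output K = While 1 (tab K (\<lambda>a. Seq (pop 1) (Act 5 (Some (bit_symbol (dec a))) Move_Right)))"

lemma does_write_output:
  assumes K: "\<And>b :: bool. enc b < K" and s: "s 5 = (\<lambda>_. 0, 0)"
  shows "does (write_output K) (st s (map enc y) [] [] []) (4 * length y + 1)
    (st (s(5 := input_at y (length y))) [] [] [] [])"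
proof -
  let ?S = "\<lambda>h. s(5 := input_at (take h y) h)"
  have 5: "st (?S h) a b c d 5 = input_at (take h y) h" for h a b c d by (simp add: st_def)
  have upd: "(st (?S h) a b c d)(5 := input_at (take h' y) h') = st (?S h') a b c d" for h h' a b c d
    by (auto simp: st_def fun_eq_iff)
  have loop: "does (write_output K) (st (?S h) (map enc (drop h y)) [] [] []) (4 * (length y - h) + 1)
     (st (?S (length y)) [] [] [] [])" if "h \<le> length y" for h
    using that
  proof (induction h rule: inc_induct)
    case base
    show ?case unfolding write_output_def
      by (rule does_at_most[OF does_While_stop]) simp_all
  next
    case (step h)
    have h: "h < length y" using step by simp
    then have d: "drop h y = y ! h # drop (Suc h) y" by (simp add: Cons_nth_drop_Suc)
    let ?s = "st (?S h) (map enc (drop h y)) [] [] []" and ?u = "st (?S h) (map enc (drop (Suc h) y)) [] [] []"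
    have "does (Act 5 (Some (bit_symbol (y ! h))) Move_Right) ?u 1 (st (?S (Suc h)) (map enc (drop (Suc h) y)) [] [] [])"
    proof -
      have "act (?u 5) (bit_symbol (y ! h), Move_Right) = input_at (take (Suc h) y) (Suc h)"
        unfolding 5 using h by (auto simp: input_at_def act_def fun_eq_iff less_Suc_eq)
      then show ?thesis using does_Act[of 5 "Some (bit_symbol (y ! h))" Move_Right ?u] upd by simp
    qed
    from does_Seq[OF does_pop(1) this]
    have "does (tab K (\<lambda>a. Seq (pop 1) (Act 5 (Some (bit_symbol (dec a))) Move_Right)) ! scanned (?s 1)) ?s (1 + 1 + 1)
      (st (?S (Suc h)) (map enc (drop (Suc h) y)) [] [] [])"
      using K by (simp add: d)
    from does_While_iter[OF _ _ this step.IH[unfolded write_output_def]]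
    have "does (write_output K) ?s (1 + 1 + 1 + (4 * (length y - Suc h) + 1) + 1) (st (?S (length y)) [] [] [] [])"
      unfolding write_output_def using K by (simp add: d fun_upd_def)
    then show ?case by (rule does_mono) (use h in simp)
  qed
  have "?S 0 = s" using s by (auto simp: fun_eq_iff input_at_def)
  then show ?thesis using loop[of 0] by simp
qed

theorem pf_imp_polytime_computable:
  assumes "pf UNIV F"
  shows "polytime_computable F"
proof -
  obtain c p where c: "wfi 6 c" "pb p" "\<And>x. length (F x) \<le> p (length x)"
    "\<And>x s. does c (st s (map enc x) [] [] []) (p (length x)) (st s (map enc (F x)) [] [] [])"
    using assms unfolding pf_def by blast
  have "finite (UNIV :: bool set)" by simp
  from enc_bound[OF this] obtain K where K: "\<And>x :: bool. enc x < K" by auto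
  define prog where "prog = Seq (read_input K) (Seq c (write_output K))"
  have "wfi (Suc 5) prog" using c(1) by (auto simp: prog_def read_input_def write_output_def eval_nat_numeral)
  then obtain B where B: "wfc (Suc 5) B prog" using wfi_imp_wfc by blast
  have "pb (\<lambda>n. 13 * n + 3 + p n + 4 * p n + 4)"
    using c(2) by (intro pb_add pb_mult pb_const pb_id)
  then obtain q :: "nat poly" where q: "\<And>n. 13 * n + 3 + p n + 4 * p n + 4 \<le> poly q n"
    unfolding pb_def by blast
  show ?thesis
  proof (rule polytime_computableI[OF B, of q])
    fix x
    let ?s = "init_tapes x"
    let ?s1 = "?s(0 := input_at x (length x))"
    let ?t = "st (?s1(5 := input_at (F x) (length (F x)))) [] [] [] []"
    \<comment> \<open>A blank tape with its head on cell 0 is the empty stack.\<close>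
    have s: "?s = st ?s [] [] [] []"
      by (auto simp: st_def init_tapes_def stk_def fun_eq_iff)
    have 1: "does (read_input K) ?s (13 * length x + 3) (st ?s1 (map enc x) [] [] [])"
      by (subst s) (rule does_read_input[OF K], simp add: init_tapes_def input_at_def)
    have 2: "does (write_output K) (st ?s1 (map enc (F x)) [] [] []) (4 * length (F x) + 1) ?t"
      by (rule does_write_output[OF K]) (simp add: init_tapes_def)
    have "does prog ?s (13 * length x + 3 + (p (length x) + (4 * length (F x) + 1) + 1) + 1) ?t"
      unfolding prog_def by (rule does_Seq[OF 1 does_Seq[OF c(4) 2]])
    then have "does prog ?s (poly q (length x)) ?t"
      by (rule does_mono) (use c(3)[of x] q[of "length x"] in linarith)
    moreover have "?t 5 = input_at (F x) (length (F x))" by (simp add: st_def)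
    ultimately show "\<exists>t. does prog ?s (poly q (length x)) t \<and>
      (\<forall>i < length (F x). fst (t 5) i = bit_symbol (F x ! i)) \<and> fst (t 5) (length (F x)) = 0"
      by (intro exI[of _ ?t]) (auto simp: input_at_def)
  qed
qed

section \<open>Shuffles of a deck with prescribed ascents\<close>

fun flip :: "pile_type \<Rightarrow> pile_type" where
  "flip Queue = Stack" | "flip Stack = Queue"

definition rounds_word :: "pile_type list \<Rightarrow> pile_type list \<Rightarrow> pile_type list" where
  "rounds_word \<psi> \<phi> = concat (map (\<lambda>v. if v = Queue then \<psi> else rev (map flip \<psi>)) \<phi>)"

lemma length_concat_uniform: "\<forall>x \<in> set xs. length x = m \<Longrightarrow> length (concat xs) = length xs * m"
  by (induction xs) auto

lemma nth_concat_uniform: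
  "\<forall>x \<in> set xs. length x = m \<Longrightarrow> j < length xs \<Longrightarrow> i < m \<Longrightarrow> concat xs ! (j * m + i) = xs ! j ! i"
proof (induction xs arbitrary: j)
  case (Cons x xs)
  show ?case
  proof (cases j)
    case (Suc j')
    then have "concat (x # xs) ! (j * m + i) = concat xs ! (j' * m + i)"
      using Cons.prems by (simp add: nth_append)
    then show ?thesis using Cons Suc by simp
  qed (use Cons.prems in \<open>simp add: nth_append\<close>)
qed simp

lemma length_rounds_word [simp]: "length (rounds_word \<psi> \<phi>) = length \<phi> * length \<psi>"
  unfolding rounds_word_def by (subst length_concat_uniform[of _ "length \<psi>"]) auto

lemma nth_rounds_word:
  assumes "j < length \<phi>" "i < length \<psi>"
  shows "rounds_word \<psi> \<phi> ! (j * length \<psi> + i) =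
    (if \<phi> ! j = Queue then \<psi> ! i else flip (\<psi> ! (length \<psi> - 1 - i)))"
  unfolding rounds_word_def using assms
  by (subst nth_concat_uniform) (auto simp: rev_nth)

definition before :: "pile_type list \<Rightarrow> (nat \<Rightarrow> nat) \<Rightarrow> (nat \<Rightarrow> nat) \<Rightarrow> nat \<Rightarrow> nat \<Rightarrow> bool" where
  "before \<psi> p \<sigma> s t \<longleftrightarrow> p s < p t \<or>
     p s = p t \<and> \<psi> ! (p s - 1) = Queue \<and> \<sigma> s < \<sigma> t \<or>
     p s = p t \<and> \<psi> ! (p s - 1) = Stack \<and> \<sigma> s > \<sigma> t"

lemma pile_round_before: "pile_round n \<psi> p \<sigma> \<tau> \<longleftrightarrow> \<tau> permutes {1..n} \<and>
    (\<forall>s \<in> {1..n}. \<forall>t \<in> {1..n}. s \<noteq> t \<longrightarrow> (\<tau> s < \<tau> t \<longleftrightarrow> before \<psi> p \<sigma> s t))"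
  unfolding pile_round_def before_def ..

text \<open>Piles of two successive rounds combine into one pile; a stack in the second round reverses
  the order of the first-round piles inside it.\<close>

definition joint :: "nat \<Rightarrow> pile_type list \<Rightarrow> (nat \<Rightarrow> nat) \<Rightarrow> (nat \<Rightarrow> nat) \<Rightarrow> nat \<Rightarrow> nat" where
  "joint m \<phi> p q s = (q s - 1) * m + (if \<phi> ! (q s - 1) = Queue then p s else m + 1 - p s)"

text \<open>Joint pile numbers are ordered by the second-round pile and, within it, by the
  first-round pile. A second-round stack reverses all it receives: the order of the first-round
  piles and also the order inside each of them, hence the flipped letter.\<close>

lemma before_joint:
  assumes p: "p s \<in> {1..length \<psi>}" "p t \<in> {1..length \<psi>}"
    and q: "q s \<in> {1..length \<phi>}" "q t \<in> {1..length \<phi>}"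
    and \<rho>: "\<rho> s < \<rho> t \<longleftrightarrow> before \<psi> p \<sigma> s t" "\<rho> t < \<rho> s \<longleftrightarrow> before \<psi> p \<sigma> t s"
  shows "before (rounds_word \<psi> \<phi>) (joint (length \<psi>) \<phi> p q) \<sigma> s t \<longleftrightarrow> before \<phi> q \<rho> s t"
proof -
  define m where "m = length \<psi>"
  define r where "r = (\<lambda>s. if \<phi> ! (q s - 1) = Queue then p s else m + 1 - p s)"
  have joint: "joint m \<phi> p q s = (q s - 1) * m + r s" for s by (simp add: joint_def r_def)
  have r: "r s \<in> {1..m}" "r t \<in> {1..m}" using p by (auto simp: r_def m_def)
  have less: "joint m \<phi> p q s < joint m \<phi> p q t"
    if "q s < q t" "r s \<in> {1..m}" "r t \<in> {1..m}" "1 \<le> q s" for s t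
  proof -
    have "(q s - 1) * m + r s \<le> Suc (q s - 1) * m" using that by (subst mult_Suc) auto
    also have "\<dots> \<le> (q t - 1) * m" using that by (intro mult_right_mono) auto
    finally show ?thesis using that by (simp add: joint)
  qed
  have letter: "rounds_word \<psi> \<phi> ! (joint m \<phi> p q s - 1) =
      (if \<phi> ! (q s - 1) = Queue then \<psi> ! (p s - 1) else flip (\<psi> ! (p s - 1)))"
  proof -
    have "joint m \<phi> p q s - 1 = (q s - 1) * m + (r s - 1)" using r by (simp add: joint)
    moreover have "q s - 1 < length \<phi>" "r s - 1 < length \<psi>" using r q by (auto simp: m_def)
    ultimately show ?thesis using nth_rounds_word[of "q s - 1" \<phi> "r s - 1" \<psi>] p
      by (auto simp: r_def m_def)
  qed
  consider "q s < q t" | "q t < q s" | "q s = q t" by linarith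
  then show ?thesis
  proof cases
    case 1
    then show ?thesis using less[of s t] r q by (auto simp: before_def m_def)
  next
    case 2
    then have "joint m \<phi> p q t < joint m \<phi> p q s" using less[of t s] r q by auto
    then show ?thesis using 2 by (simp add: before_def m_def)
  next
    case 3
    show ?thesis
    proof (cases "\<phi> ! (q s - 1) = Queue")
      case True
      then have "joint m \<phi> p q s < joint m \<phi> p q t \<longleftrightarrow> p s < p t" "joint m \<phi> p q s = joint m \<phi> p q t \<longleftrightarrow> p s = p t"
        using 3 by (simp_all add: joint r_def)
      then show ?thesis using 3 True letter \<rho> by (auto simp: before_def m_def)
    next
      case False
      have pm: "p s \<in> {1..m}" "p t \<in> {1..m}" using p by (simp_all add: m_def)
      have stack: "\<phi> ! (q s - 1) = Stack" using False pile_type.exhaust by blast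
      have "joint m \<phi> p q s < joint m \<phi> p q t \<longleftrightarrow> p t < p s" "joint m \<phi> p q s = joint m \<phi> p q t \<longleftrightarrow> p s = p t"
        using 3 False pm by (auto simp: joint r_def)
      moreover have "rounds_word \<psi> \<phi> ! (joint m \<phi> p q s - 1) = flip (\<psi> ! (p s - 1))"
        using letter False by simp
      moreover have "\<rho> t < \<rho> s \<longleftrightarrow> p t < p s \<or> p s = p t \<and> (\<psi> ! (p s - 1) = Queue \<and> \<sigma> t < \<sigma> s \<or>
          \<psi> ! (p s - 1) = Stack \<and> \<sigma> s < \<sigma> t)"
        unfolding \<rho>(2) before_def by metis
      ultimately show ?thesis unfolding m_def[symmetric] before_def
        using 3 stack by (cases "\<psi> ! (p s - 1)") simp_all
    qed
  qed
qed

lemma two_rounds: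
  assumes \<sigma>: "\<sigma> permutes {1..n}" and m: "length \<psi> \<ge> 1"
  shows "(\<exists>p \<in> {1..n} \<rightarrow> {1..length \<psi>}. \<exists>q \<in> {1..n} \<rightarrow> {1..length \<phi>}. \<exists>\<rho>.
       pile_round n \<psi> p \<sigma> \<rho> \<and> pile_round n \<phi> q \<rho> \<tau>) \<longleftrightarrow>
    (\<exists>g \<in> {1..n} \<rightarrow> {1..length (rounds_word \<psi> \<phi>)}. pile_round n (rounds_word \<psi> \<phi>) g \<sigma> \<tau>)" (is "?L \<longleftrightarrow> ?R")
proof
  assume ?L
  then obtain p q \<rho> where *: "p \<in> {1..n} \<rightarrow> {1..length \<psi>}" "q \<in> {1..n} \<rightarrow> {1..length \<phi>}"
    "pile_round n \<psi> p \<sigma> \<rho>" "pile_round n \<phi> q \<rho> \<tau>" by blast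
  let ?g = "joint (length \<psi>) \<phi> p q"
  have "before (rounds_word \<psi> \<phi>) ?g \<sigma> s t \<longleftrightarrow> before \<phi> q \<rho> s t"
    if "s \<in> {1..n}" "t \<in> {1..n}" "s \<noteq> t" for s t
    using * that by (intro before_joint) (auto simp: pile_round_before)
  moreover have "?g s \<in> {1..length (rounds_word \<psi> \<phi>)}" if "s \<in> {1..n}" for s
  proof -
    define x where "x = (if \<phi> ! (q s - 1) = Queue then p s else length \<psi> + 1 - p s)"
    have x: "1 \<le> x" "x \<le> length \<psi>" and qs: "q s \<in> {1..length \<phi>}"
      using funcset_mem[OF *(1) that] funcset_mem[OF *(2) that] by (auto simp: x_def)
    have "(q s - 1) * length \<psi> + x \<le> Suc (q s - 1) * length \<psi>" using x by simp
    also have "\<dots> \<le> length \<phi> * length \<psi>" using qs by (intro mult_right_mono) auto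
    finally have "(q s - 1) * length \<psi> + x \<le> length \<phi> * length \<psi>" .
    moreover have "?g s = (q s - 1) * length \<psi> + x" by (simp add: joint_def x_def)
    ultimately show ?thesis using x(1) by simp
  qed
  ultimately show ?R using *(4) by (intro bexI[of _ ?g]) (auto simp: pile_round_before)
next
  assume ?R
  then obtain g where g: "g \<in> {1..n} \<rightarrow> {1..length \<phi> * length \<psi>}"
    "pile_round n (rounds_word \<psi> \<phi>) g \<sigma> \<tau>" by auto
  define m where "m = length \<psi>"
  \<comment> \<open>Quotient and remainder of the zero-based joint number by \<open>m\<close>
    recover both assignments; in a stack the remainder is counted from the other end.\<close>
  define q where "q = (\<lambda>s. (g s - 1) div m + 1)"
  define p where "p = (\<lambda>s. if \<phi> ! (q s - 1) = Queue then (g s - 1) mod m + 1 else m - (g s - 1) mod m)"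
  have mod: "(g s - 1) mod m < m" for s
    by (rule mod_less_divisor) (use m in \<open>simp add: m_def Suc_le_eq\<close>)
  have p: "p s \<in> {1..m}" for s using mod[of s] m by (auto simp: p_def m_def Suc_le_eq)
  have q: "q s \<in> {1..length \<phi>}" if "s \<in> {1..n}" for s
  proof -
    have "g s \<in> {1..length \<phi> * m}" using g(1) that by (auto simp: m_def Pi_iff)
    then have "(g s - 1) div m < length \<phi>" by (subst less_mult_imp_div_less) auto
    then show ?thesis by (simp add: q_def)
  qed
  have joint: "joint m \<phi> p q s = g s" if "s \<in> {1..n}" for s
  proof -
    have "g s \<ge> 1" using g(1) that by auto
    moreover have "(if \<phi> ! (q s - 1) = Queue then p s else m + 1 - p s) = (g s - 1) mod m + 1"
      using mod[of s] by (simp add: p_def)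
    moreover have "(q s - 1) * m + (g s - 1) mod m = g s - 1" by (simp add: q_def)
    ultimately show ?thesis unfolding joint_def by linarith
  qed
  obtain \<rho> where \<rho>: "pile_round n \<psi> p \<sigma> \<rho>" using pile_round_ex1[OF \<sigma>] by blast
  have "before (rounds_word \<psi> \<phi>) g \<sigma> s t \<longleftrightarrow> before \<phi> q \<rho> s t"
    if "s \<in> {1..n}" "t \<in> {1..n}" "s \<noteq> t" for s t
  proof -
    have "before (rounds_word \<psi> \<phi>) (joint m \<phi> p q) \<sigma> s t \<longleftrightarrow> before \<phi> q \<rho> s t"
      unfolding m_def using \<rho> p q that by (intro before_joint) (auto simp: pile_round_before m_def)
    then show ?thesis using joint that by (simp add: before_def)
  qed
  then have "pile_round n \<phi> q \<rho> \<tau>" using g(2) by (auto simp: pile_round_before)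
  then show ?L using \<rho> p q
    by (intro bexI[of _ p] bexI[of _ q] exI[of _ \<rho>]) (auto simp: m_def)
qed

lemma sorts_three_rounds:
  assumes \<sigma>: "\<sigma> permutes {1..n}" and m: "length \<psi> \<ge> 1" "length \<phi> \<ge> 1"
  shows "sorts n [\<psi>, \<phi>, \<chi>] \<sigma> \<longleftrightarrow>
    (\<exists>g \<in> {1..n} \<rightarrow> {1..length (rounds_word (rounds_word \<psi> \<phi>) \<chi>)}. pile_round n (rounds_word (rounds_word \<psi> \<phi>) \<chi>) g \<sigma> id)"
proof -
  have shuffle: "pile_shuffle n [(\<psi>, p), (\<phi>, q), (\<chi>, r)] \<sigma> id \<longleftrightarrow>
      (\<exists>\<rho> \<rho>'. pile_round n \<psi> p \<sigma> \<rho> \<and> pile_round n \<phi> q \<rho> \<rho>' \<and> pile_round n \<chi> r \<rho>' id)" for p q r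
    by (simp add: pile_shuffle.simps[of n "_ # _"] pile_shuffle.simps[of n "[]"])
  have "sorts n [\<psi>, \<phi>, \<chi>] \<sigma> \<longleftrightarrow> (\<exists>p \<in> {1..n} \<rightarrow> {1..length \<psi>}. \<exists>q \<in> {1..n} \<rightarrow> {1..length \<phi>}.
      \<exists>r \<in> {1..n} \<rightarrow> {1..length \<chi>}. pile_shuffle n [(\<psi>, p), (\<phi>, q), (\<chi>, r)] \<sigma> id)" (is "_ \<longleftrightarrow> ?P")
  proof
    assume "sorts n [\<psi>, \<phi>, \<chi>] \<sigma>"
    then obtain ps where ps: "length ps = 3" "\<forall>t < 3. ps ! t \<in> {1..n} \<rightarrow> {1..length ([\<psi>, \<phi>, \<chi>] ! t)}"
      "pile_shuffle n (zip [\<psi>, \<phi>, \<chi>] ps) \<sigma> id" by (auto simp: sorts_def numeral_3_eq_3)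
    then obtain p q r where "ps = [p, q, r]" by (auto simp: numeral_3_eq_3 length_Suc_conv)
    then show ?P
      using ps(2)[rule_format, of 0] ps(2)[rule_format, of 1] ps(2)[rule_format, of 2] ps(3) by auto
  next
    assume ?P
    then obtain p q r where "p \<in> {1..n} \<rightarrow> {1..length \<psi>}" "q \<in> {1..n} \<rightarrow> {1..length \<phi>}"
      "r \<in> {1..n} \<rightarrow> {1..length \<chi>}" "pile_shuffle n [(\<psi>, p), (\<phi>, q), (\<chi>, r)] \<sigma> id" by blast
    then show "sorts n [\<psi>, \<phi>, \<chi>] \<sigma>"
      unfolding sorts_def by (intro exI[of _ "[p, q, r]"]) (auto simp: less_Suc_eq)
  qed
  also have "\<dots> \<longleftrightarrow> (\<exists>g \<in> {1..n} \<rightarrow> {1..length (rounds_word \<psi> \<phi>)}. \<exists>r \<in> {1..n} \<rightarrow> {1..length \<chi>}. \<exists>\<rho>'.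
      pile_round n (rounds_word \<psi> \<phi>) g \<sigma> \<rho>' \<and> pile_round n \<chi> r \<rho>' id)"
    unfolding shuffle using two_rounds[OF \<sigma> m(1), of \<phi>] by blast
  also have "\<dots> \<longleftrightarrow> (\<exists>g \<in> {1..n} \<rightarrow> {1..length (rounds_word (rounds_word \<psi> \<phi>) \<chi>)}.
      pile_round n (rounds_word (rounds_word \<psi> \<phi>) \<chi>) g \<sigma> id)"
    by (rule two_rounds[OF \<sigma>]) (use m in \<open>simp add: Suc_le_eq\<close>)
  finally show ?thesis .
qed

section \<open>One round as greedy segmentation\<close>

text \<open>\<open>before\<close> is transitive and asymmetric, so sortedness only has to be tested
  on consecutive labels.\<close>

lemma pile_round_id:
  "pile_round n W g \<sigma> id \<longleftrightarrow> (\<forall>s. 1 \<le> s \<and> s < n \<longrightarrow> before W g \<sigma> s (Suc s))"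
proof
  assume "pile_round n W g \<sigma> id"
  then have r: "s < t \<longleftrightarrow> before W g \<sigma> s t" if "s \<in> {1..n}" "t \<in> {1..n}" "s \<noteq> t" for s t
    using that unfolding pile_round_before id_def by blast
  show "\<forall>s. 1 \<le> s \<and> s < n \<longrightarrow> before W g \<sigma> s (Suc s)"
  proof (intro allI impI)
    show "before W g \<sigma> s (Suc s)" if "1 \<le> s \<and> s < n" for s
      using r[of s "Suc s"] that by simp
  qed
next
  assume step: "\<forall>s. 1 \<le> s \<and> s < n \<longrightarrow> before W g \<sigma> s (Suc s)"
  have trans: "before W g \<sigma> s u" if "before W g \<sigma> s t" "before W g \<sigma> t u" for s t u
    using that by (auto simp: before_def)
  have asym: "\<not> before W g \<sigma> t s" if "before W g \<sigma> s t" for s t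
    using that by (auto simp: before_def)
  have less: "before W g \<sigma> s t" if "s < t" "1 \<le> s" "t \<le> n" for s t
    using that
  proof (induction t)
    case (Suc t)
    then show ?case using step trans by (cases "s = t") auto
  qed simp
  show "pile_round n W g \<sigma> id"
    unfolding pile_round_before
  proof (intro conjI ballI impI)
    fix s t assume st: "s \<in> {1..n}" "t \<in> {1..n}" "s \<noteq> t"
    then consider "s < t" | "t < s" by linarith
    then show "id s < id t \<longleftrightarrow> before W g \<sigma> s t"
      using less[of s t] less[of t s] asym[of t s] st by cases auto
  qed (rule permutes_id)
qed

text \<open>Inside one pile every pair of consecutive cards must be of the kind of the pile's
  letter, whereas the pair that straddles two piles is unconstrained. The straddling pair is the
  additional entry swallowed after the run.\<close>

fun eat :: "bool \<Rightarrow> bool list \<Rightarrow> bool list" where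
  "eat a [] = []"
| "eat a (c # r) = (if c = a then eat a r else r)"

lemma suffix_eat: "suffix (eat a xs) xs"
  by (induction xs) (auto intro: suffix_ConsI)

lemma eat_mono: "suffix xs ys \<Longrightarrow> suffix (eat a xs) (eat a ys)"
proof (elim suffixE)
  fix zs assume "ys = zs @ xs"
  moreover have "suffix (eat a xs) (eat a (zs @ xs))"
    by (induction zs) (auto intro: suffix_appendI suffix_eat)
  ultimately show ?thesis by simp
qed

text \<open>Being further ahead is never a disadvantage, which justifies making every pile as large
  as possible.\<close>

lemma fold_eat_mono: "suffix xs ys \<Longrightarrow> suffix (fold eat W xs) (fold eat W ys)"
  by (induction W arbitrary: xs ys) (auto intro: eat_mono)

lemma eat_drop: "\<exists>k \<le> length D. eat a D = drop k D \<and> (\<forall>i. Suc i < k \<longrightarrow> D ! i = a)"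
proof (induction D)
  case (Cons c D)
  show ?case
  proof (cases "c = a")
    case True
    from Cons obtain k where "k \<le> length D" "eat a D = drop k D" "\<forall>i. Suc i < k \<longrightarrow> D ! i = a" by blast
    then show ?thesis using True by (intro exI[of _ "Suc k"]) (auto simp: nth_Cons')
  next
    case False
    then show ?thesis by (intro exI[of _ 1]) auto
  qed
qed auto

lemma eat_drop_suffix:
  "(\<And>i. Suc i < k \<Longrightarrow> i < length D \<and> D ! i = a) \<Longrightarrow> suffix (eat a D) (drop k D)"
proof (induction D arbitrary: k)
  case (Cons c D)
  consider "k = 0" | "k = 1" | k' where "k = Suc (Suc k')" by (cases k; cases "k - 1") auto
  then show ?case
  proof cases
    case 3
    have "suffix (eat a D) (drop (Suc k') D)"
      by (rule Cons.IH) (use Cons.prems[of "Suc _"] 3 in auto)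
    then show ?thesis using 3 Cons.prems[of 0] by simp
  qed (use suffix_eat in \<open>auto intro: suffix_ConsI\<close>)
qed simp

text \<open>Exchange argument: in any valid assignment the cards of the first pile form a prefix
  that is no longer than what greedy eating removes, so by monotonicity the remaining letters finish
  the greedy remainder as well. Conversely the greedy prefixes define the piles.\<close>

lemma segmentation_iff:
  "(\<exists>g. (\<forall>i < length D. g i < length W) \<and>
      (\<forall>i. Suc i < length D \<longrightarrow> g i < g (Suc i) \<or> g i = g (Suc i) \<and> W ! g i = D ! i)) \<longleftrightarrow>
    fold eat W D = []"
proof (induction W arbitrary: D)
  case Nil
  then show ?case by auto
next
  case (Cons a W)
  show ?case (is "(\<exists>g. ?P g) \<longleftrightarrow> _")
  proof
    assume "\<exists>g. ?P g"
    then obtain g where g: "\<And>i. i < length D \<Longrightarrow> g i < Suc (length W)"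
      "\<And>i. Suc i < length D \<Longrightarrow> g i < g (Suc i) \<or> g i = g (Suc i) \<and> (a # W) ! g i = D ! i" by auto
    have mono: "g i \<le> g j" if "i \<le> j" "j < length D" for i j
      using that
    proof (induction j)
      case (Suc j)
      then show ?case using g(2)[of j] by (cases "i = Suc j") auto
    qed simp
    \<comment> \<open>\<open>g\<close> is monotone, so the cards on pile 0 are exactly the first
      \<open>k\<close>.\<close>
    define k where "k = card {i. i < length D \<and> g i = 0}"
    have set: "{i. i < length D \<and> g i = 0} = {..<k}"
    proof -
      have fin: "finite {i. i < length D \<and> g i = 0}" by simp
      have "\<exists>l. {i. i < length D \<and> g i = 0} = {..<l}"
      proof (cases "\<exists>i < length D. g i \<noteq> 0")
        case True
        define l where "l = (LEAST i. i < length D \<and> g i \<noteq> 0)"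
        have l: "l < length D" "g l \<noteq> 0" using LeastI_ex[OF True[simplified]] by (auto simp: l_def)
        have zero: "g i = 0" if "i < l" for i using not_less_Least[of i "\<lambda>i. i < length D \<and> g i \<noteq> 0"] that l(1)
          by (auto simp: l_def)
        have nonzero: "g i \<noteq> 0" if "l \<le> i" "i < length D" for i using mono[OF that] l by auto
        have "i < length D \<and> g i = 0 \<longleftrightarrow> i < l" for i
          using zero[of i] nonzero[of i] l(1) by (cases "i < l") auto
        then show ?thesis by (intro exI[of _ l] set_eqI) simp
      next
        case False
        then show ?thesis by (intro exI[of _ "length D"]) auto
      qed
      then obtain l where l: "{i. i < length D \<and> g i = 0} = {..<l}" by blast
      then show ?thesis by (simp add: k_def)
    qed
    have mem: "i < length D \<and> g i = 0 \<longleftrightarrow> i < k" for i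
      using set unfolding set_eq_iff by simp
    have k: "g i = 0" "i < length D" if "i < k" for i using that mem by blast+
    have k': "g i \<noteq> 0" if "k \<le> i" "i < length D" for i using that mem[of i] by auto
    have "suffix (eat a D) (drop k D)"
    proof (rule eat_drop_suffix)
      show "i < length D \<and> D ! i = a" if "Suc i < k" for i
        using k[of i] k[of "Suc i"] g(2)[of i] that by simp
    qed
    moreover have "fold eat W (drop k D) = []"
    proof (rule Cons.IH[THEN iffD1], intro exI[of _ "\<lambda>i. g (k + i) - 1"] conjI allI impI)
      show "g (k + i) - 1 < length W" if "i < length (drop k D)" for i
      proof -
        have "k + i < length D" using that by simp
        then show ?thesis using g(1)[of "k + i"] k'[of "k + i"] by simp
      qed
      show "g (k + i) - 1 < g (k + Suc i) - 1 \<or> g (k + i) - 1 = g (k + Suc i) - 1 \<and> W ! (g (k + i) - 1) = drop k D ! i"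
        if "Suc i < length (drop k D)" for i
      proof -
        have "Suc (k + i) < length D" "k + i < length D" using that by simp_all
        then show ?thesis using g(2)[of "k + i"] k'[of "k + i"] k'[of "k + Suc i"] by (auto simp: nth_Cons')
      qed
    qed
    ultimately have "suffix (fold eat W (eat a D)) []" using fold_eat_mono by metis
    then show "fold eat (a # W) D = []" by simp
  next
    assume *: "fold eat (a # W) D = []"
    obtain k where k: "k \<le> length D" "eat a D = drop k D" "\<And>i. Suc i < k \<Longrightarrow> D ! i = a"
      using eat_drop by blast
    from * k(2) Cons.IH[of "drop k D"] obtain g where g: "\<And>i. i < length D - k \<Longrightarrow> g i < length W"
      "\<And>i. Suc i < length D - k \<Longrightarrow> g i < g (Suc i) \<or> g i = g (Suc i) \<and> W ! g i = drop k D ! i" by auto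
    show "\<exists>g. ?P g"
    proof (intro exI[of _ "\<lambda>i. if i < k then 0 else Suc (g (i - k))"] conjI allI impI)
      fix i
      show "(if i < k then 0 else Suc (g (i - k))) < length (a # W)" if "i < length D"
        using g(1)[of "i - k"] that by auto
      assume i: "Suc i < length D"
      show "(if i < k then 0 else Suc (g (i - k))) < (if Suc i < k then 0 else Suc (g (Suc i - k))) \<or>
        (if i < k then 0 else Suc (g (i - k))) = (if Suc i < k then 0 else Suc (g (Suc i - k))) \<and>
        (a # W) ! (if i < k then 0 else Suc (g (i - k))) = D ! i"
      proof (cases "k \<le> i")
        case True
        then have "Suc (i - k) < length D - k" "k + (i - k) = i" using i by simp_all
        then show ?thesis using g(2)[of "i - k"] True k(1) by (auto simp: Suc_diff_le)
      next
        case False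
        then show ?thesis using k(3)[of i] by auto
      qed
    qed
  qed
qed

definition up :: "pile_type \<Rightarrow> bool" where "up t \<longleftrightarrow> t = Queue"

text \<open>The last entry of \<open>D\<close> is a sentinel: only the first \<open>n - 1\<close> entries describe ascents.\<close>

lemma one_round_sorts:
  assumes \<sigma>: "\<sigma> permutes {1..length D}"
    and D: "\<And>i. Suc i < length D \<Longrightarrow> D ! i \<longleftrightarrow> \<sigma> (Suc i) < \<sigma> (Suc (Suc i))"
  shows "(\<exists>g \<in> {1..length D} \<rightarrow> {1..length W}. pile_round (length D) W g \<sigma> id) \<longleftrightarrow>
    fold eat (map up W) D = []"
proof -
  have neq: "\<sigma> s \<noteq> \<sigma> (Suc s)" for s using permutes_inj[OF \<sigma>] by (simp add: inj_eq)
  have bef: "before W g \<sigma> (Suc i) (Suc (Suc i)) \<longleftrightarrow>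
      g (Suc i) < g (Suc (Suc i)) \<or> g (Suc i) = g (Suc (Suc i)) \<and> up (W ! (g (Suc i) - 1)) = D ! i"
    if "Suc i < length D" for g i
    using D[OF that] neq[of "Suc i"]
    by (cases "W ! (g (Suc i) - 1)") (auto simp: before_def up_def)
  have "(\<exists>g \<in> {1..length D} \<rightarrow> {1..length W}. pile_round (length D) W g \<sigma> id) \<longleftrightarrow>
    (\<exists>g. (\<forall>i < length D. g i < length (map up W)) \<and>
      (\<forall>i. Suc i < length D \<longrightarrow> g i < g (Suc i) \<or> g i = g (Suc i) \<and> map up W ! g i = D ! i))"
    (is "?L \<longleftrightarrow> ?R")
  proof
    assume ?L
    then obtain g where g: "g \<in> {1..length D} \<rightarrow> {1..length W}" "pile_round (length D) W g \<sigma> id" by blast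
    have r: "1 \<le> g (Suc i) \<and> g (Suc i) \<le> length W" if "i < length D" for i
      using g(1) that by (auto simp: Pi_iff)
    show ?R
    proof (intro exI[of _ "\<lambda>i. g (Suc i) - 1"] conjI allI impI)
      show "g (Suc i) - 1 < length (map up W)" if "i < length D" for i using r[OF that] by auto
      show "g (Suc i) - 1 < g (Suc (Suc i)) - 1 \<or>
        g (Suc i) - 1 = g (Suc (Suc i)) - 1 \<and> map up W ! (g (Suc i) - 1) = D ! i"
        if "Suc i < length D" for i
        using g(2) bef[OF that, of g] r[of i] r[of "Suc i"] that unfolding pile_round_id
        by (auto simp: less_diff_conv2)
    qed
  next
    assume ?R
    then obtain g where g: "\<And>i. i < length D \<Longrightarrow> g i < length W"
      "\<And>i. Suc i < length D \<Longrightarrow> g i < g (Suc i) \<or> g i = g (Suc i) \<and> map up W ! g i = D ! i"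
      unfolding length_map by blast
    define h where "h = (\<lambda>s. Suc (g (s - 1)))"
    have "h \<in> {1..length D} \<rightarrow> {1..length W}" using g(1) by (auto simp: h_def Suc_le_eq)
    moreover have "before W h \<sigma> s (Suc s)" if "1 \<le> s" "s < length D" for s
    proof -
      obtain i where i: "s = Suc i" using \<open>1 \<le> s\<close> by (cases s) auto
      then show ?thesis using bef[of i h] g(2)[of i] g(1)[of i] that by (auto simp: h_def)
    qed
    ultimately show ?L unfolding pile_round_id by blast
  qed
  then show ?thesis using segmentation_iff[of D "map up W"] by simp
qed

definition ups :: "bool list \<Rightarrow> nat" where "ups D = length (filter id D)"

text \<open>An ascent is realised by the smallest unused value, a descent by the largest one.\<close>

definition position :: "bool list \<Rightarrow> nat \<Rightarrow> nat" where
  "position D i = Suc (ups (take i D)) + (if D ! i then 0 else length D - Suc i)"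

definition perm_of :: "bool list \<Rightarrow> nat \<Rightarrow> nat" where
  "perm_of D s = (if s \<in> {1..length D} then position D (s - 1) else s)"

lemma ups_take_Suc: "i < length D \<Longrightarrow> ups (take (Suc i) D) = ups (take i D) + (if D ! i then 1 else 0)"
  by (simp add: ups_def take_Suc_conv_app_nth)

lemma ups_take_bounds:
  assumes "i \<le> j" "j \<le> length D"
  shows "ups (take i D) \<le> ups (take j D)" "ups (take j D) \<le> ups (take i D) + (j - i)"
  using assms
proof (induction j)
  case (Suc j)
  { case 1 then show ?case using Suc by (cases "i = Suc j") (auto simp: ups_take_Suc) }
  { case 2 then show ?case using Suc by (cases "i = Suc j") (auto simp: ups_take_Suc) }
qed auto

text \<open>Ascents have used up low values and descents high ones, so every later value lies
  strictly between: an ascent is below and a descent above all that follow.\<close>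

lemma position_less:
  assumes "i < j" "j < length D"
  shows "position D i < position D j \<longleftrightarrow> D ! i" "position D i \<noteq> position D j"
  using ups_take_bounds[of "Suc i" j D] ups_take_Suc[of i D] assms
  by (auto simp: position_def)

lemma perm_of_permutes: "perm_of D permutes {1..length D}"
proof -
  let ?n = "length D"
  have "position D i \<le> ?n" if "i < ?n" for i
    using ups_take_bounds(2)[of 0 i D] that by (auto simp: position_def ups_def)
  then have sub: "perm_of D ` {1..?n} \<subseteq> {1..?n}"
  proof (intro image_subsetI)
    fix s assume s: "s \<in> {1..?n}"
    then have "position D (s - 1) \<le> ?n" using \<open>\<And>i. i < ?n \<Longrightarrow> position D i \<le> ?n\<close>[of "s - 1"] by auto
    then show "perm_of D s \<in> {1..?n}" using s by (simp add: perm_of_def position_def)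
  qed
  have "inj_on (perm_of D) {1..?n}"
  proof (rule inj_onI)
    fix s t assume st: "s \<in> {1..?n}" "t \<in> {1..?n}" "perm_of D s = perm_of D t"
    obtain i j where ij: "s = Suc i" "t = Suc j" "i < ?n" "j < ?n"
      using st by (cases s; cases t) auto
    then have "position D i = position D j" using st(3) by (simp add: perm_of_def)
    then show "s = t"
      using position_less(2)[of i j D] position_less(2)[of j i D] ij by (cases i j rule: linorder_cases) auto
  qed
  with sub have "bij_betw (perm_of D) {1..?n} {1..?n}"
    unfolding bij_betw_def by (simp add: endo_inj_surj)
  then show ?thesis by (rule bij_imp_permutes) (auto simp: perm_of_def)
qed

lemma perm_of_ascent: "Suc i < length D \<Longrightarrow> D ! i \<longleftrightarrow> perm_of D (Suc i) < perm_of D (Suc (Suc i))"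
  using position_less(1)[of i "Suc i" D] by (simp add: perm_of_def)

theorem sorts_perm_of:
  assumes "length \<psi> \<ge> 1" "length \<phi> \<ge> 1"
  shows "sorts (length D) [\<psi>, \<phi>, \<chi>] (perm_of D) \<longleftrightarrow>
    fold eat (map up (rounds_word (rounds_word \<psi> \<phi>) \<chi>)) D = []"
  unfolding sorts_three_rounds[OF perm_of_permutes assms]
  by (rule one_round_sorts[OF perm_of_permutes perm_of_ascent])

section \<open>Gadgets\<close>

type_synonym item = "bool \<times> bool"

abbreviation pp :: item where "pp \<equiv> (False, True)"
abbreviation mm :: item where "mm \<equiv> (False, False)"
abbreviation PP :: item where "PP \<equiv> (True, True)"
abbreviation MM :: item where "MM \<equiv> (True, False)"

text \<open>An item \<open>(l, c)\<close> stands for one letter \<open>c\<close>, or, if \<open>l\<close> holds, for a run of \<open>c\<close> that is longer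
  than the number of piles, so that it cannot be passed by reading the other letter.\<close>

fun ieat :: "bool \<Rightarrow> item list \<Rightarrow> item list" where
  "ieat a [] = []"
| "ieat a ((l, c) # r) = (if c = a then ieat a r else if l then (l, c) # r else r)"

section \<open>Items and their expansions\<close>

text \<open>A threshold \<open>K\<close> instead of exact lengths: runs differ in length, and it
  only matters that each exceeds the number of letters still to be read.\<close>

fun expands :: "nat \<Rightarrow> item list \<Rightarrow> bool list \<Rightarrow> bool" where
  "expands K [] D \<longleftrightarrow> D = []"
| "expands K ((l, c) # r) D \<longleftrightarrow>
    (\<exists>n D'. D = replicate n c @ D' \<and> (if l then K \<le> n else n = 1) \<and> expands K r D')"

lemma expands_mono: "expands K xs D \<Longrightarrow> K' \<le> K \<Longrightarrow> expands K' xs D"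
  by (induction K xs D rule: expands.induct) (fastforce split: if_splits)+

lemma eat_replicate: "eat a (replicate n a @ D) = eat a D"
  by (induction n) auto

text \<open>A letter of the other kind takes a single entry off a long run, so the threshold drops
  by one per letter and is still positive afterwards.\<close>

lemma expands_eat: "expands (Suc (Suc K)) xs D \<Longrightarrow> expands (Suc K) (ieat a xs) (eat a D)"
proof (induction xs arbitrary: D)
  case (Cons x r)
  obtain l c where x: "x = (l, c)" by fastforce
  with Cons.prems obtain n D' where n: "D = replicate n c @ D'"
    "if l then Suc (Suc K) \<le> n else n = 1" "expands (Suc (Suc K)) r D'" by auto
  show ?case
  proof (cases "c = a")
    case True
    then show ?thesis using Cons.IH[OF n(3)] x n(1) by (simp add: eat_replicate)
  next
    case False
    obtain n' where n': "n = Suc n'" using n(2) by (cases n) (auto split: if_splits)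
    have r: "expands (Suc K) r D'" using expands_mono[OF n(3), of "Suc K"] by simp
    have eat: "eat a D = replicate n' c @ D'" using False n(1) n' by simp
    show ?thesis
    proof (cases l)
      case True
      then have "Suc K \<le> n'" using n(2) n' by simp
      moreover have "ieat a (x # r) = (True, c) # r" using x False True by simp
      ultimately show ?thesis
        unfolding eat using r by (simp only: expands.simps if_True) blast
    next
      case l: False
      then have "n' = 0" using n(2) n' by simp
      then show ?thesis using r eat False l x by simp
    qed
  qed
qed simp

lemma expands_Nil_iff: "0 < K \<Longrightarrow> expands K xs D \<Longrightarrow> xs = [] \<longleftrightarrow> D = []"
proof (cases xs)
  case (Cons x r)
  assume "0 < K" "expands K xs D"
  moreover obtain l c where "x = (l, c)" by fastforce
  ultimately obtain n D' where "D = replicate n c @ D'" "if l then K \<le> n else n = 1"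
    using Cons by auto
  then show ?thesis using Cons \<open>0 < K\<close> by (cases n) (simp_all split: if_splits)
qed simp

abbreviation red :: "bool list \<Rightarrow> item list \<Rightarrow> item list" where "red W xs \<equiv> fold ieat W xs"

lemma expands_red:
  assumes "expands K xs D" "length W < K"
  shows "fold eat W D = [] \<longleftrightarrow> red W xs = []"
  using assms
proof (induction W arbitrary: K xs D)
  case Nil
  then show ?case using expands_Nil_iff by fastforce
next
  case (Cons a W)
  then obtain K' where K: "K = Suc (Suc K')" by (metis Suc_le_D Suc_lessE length_Cons less_eq_Suc_le)
  show ?case using Cons.IH[of "Suc K'" "ieat a xs" "eat a D"] expands_eat Cons.prems K by simp
qed

text \<open>The last entry of an ascent word is a sentinel that describes no pair of cards; a final
  long run of its kind absorbs it.\<close>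

lemma expands_last: "expands K (xs @ [(True, c)]) D \<Longrightarrow> expands K (xs @ [(True, c)]) (D @ [c])"
proof (induction xs arbitrary: D)
  case Nil
  then obtain n where "D = replicate n c" "K \<le> n" by auto
  then show ?case by (auto intro!: exI[of _ "Suc n"] simp: replicate_append_same)
next
  case (Cons x xs)
  obtain l a where "x = (l, a)" by fastforce
  with Cons show ?case by fastforce
qed

lemma suffix_ieat: "suffix (ieat a xs) xs"
  by (induction a xs rule: ieat.induct) (auto intro: suffix_ConsI)

lemma ieat_mono: "suffix xs ys \<Longrightarrow> suffix (ieat a xs) (ieat a ys)"
proof (elim suffixE)
  fix zs assume "ys = zs @ xs"
  moreover have "suffix (ieat a xs) (ieat a (zs @ xs))"
  proof (induction zs)
    case (Cons z zs)
    then show ?case by (cases z) (auto intro: suffix_appendI suffix_ieat suffix_ConsI)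
  qed simp
  ultimately show ?thesis by simp
qed

lemma red_mono: "suffix xs ys \<Longrightarrow> suffix (red W xs) (red W ys)"
  by (induction W arbitrary: xs ys) (auto intro: ieat_mono)

section \<open>Lower bounds in letters\<close>

text \<open>A lower bound: \<open>k\<close> letters cannot consume anything of \<open>ys\<close>.
  Because all shorter words are covered too, such bounds add up along consecutive pieces.\<close>

definition tight :: "nat \<Rightarrow> item list \<Rightarrow> item list \<Rightarrow> bool" where
  "tight k xs ys \<longleftrightarrow> (\<forall>W. length W \<le> k \<longrightarrow> suffix ys (red W xs))"

lemma tight_trans: "tight k xs ys \<Longrightarrow> tight l ys zs \<Longrightarrow> tight (k + l) xs zs"
  unfolding tight_def
proof (intro allI impI)
  fix W :: "bool list"
  assume *: "\<forall>W. length W \<le> k \<longrightarrow> suffix ys (red W xs)" "\<forall>W. length W \<le> l \<longrightarrow> suffix zs (red W ys)"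
    and W: "length W \<le> k + l"
  have "suffix zs (red (drop k W) ys)" using * W by simp
  also have "suffix \<dots> (red (drop k W) (red (take k W) xs))" using * by (intro red_mono) simp
  also have "\<dots> = red W xs" by (simp flip: fold_append comp_apply[of "fold ieat (drop k W)"])
  finally show "suffix zs (red W xs)" .
qed

lemma tight_one: "(\<And>a. suffix ys (ieat a xs)) \<Longrightarrow> tight 1 xs ys"
  unfolding tight_def
proof (intro allI impI)
  fix W :: "bool list"
  assume *: "\<And>a. suffix ys (ieat a xs)" and "length W \<le> 1"
  then consider "W = []" | a where "W = [a]" by (cases W) auto
  then show "suffix ys (red W xs)"
    using * suffix_ieat[of _ xs] by cases (auto intro: suffix_order.trans)
qed

text \<open>Long runs cannot be skipped, so the letters of \<open>w\<close> have to be read in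
  order. Between equal letters a single opposite item keeps the runs apart; it is swallowed as the
  entry after the run and costs nothing.\<close>

fun forced :: "bool list \<Rightarrow> item list" where
  "forced [] = []"
| "forced [a] = [(True, a)]"
| "forced (a # b # w) = (if a = b then [(True, a), (False, \<not> a)] else [(True, a)]) @ forced (b # w)"

lemma hd_forced: "\<exists>r. forced (b # w) = (True, b) # r"
  by (cases w) auto

lemma forced_suffix: "w \<noteq> [] \<Longrightarrow> suffix ((True, last w) # rest) (forced w @ rest)"
  by (induction w rule: forced.induct) (auto simp: suffix_Cons)

lemma forced_step:
  assumes "rest = [] \<or> hd rest = (True, \<not> last (a # w))"
  shows "ieat x (forced (a # w) @ rest) = (if x = a then forced w @ rest else forced (a # w) @ rest)"
proof (cases w)
  case Nil
  then show ?thesis using assms by (cases rest) auto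
next
  case (Cons b w')
  then show ?thesis using hd_forced[of b w'] by auto
qed

text \<open>A letter that differs from the current run is wasted, so within \<open>length w\<close>
  letters only \<open>w\<close> itself gets through, and any other word is stopped no later than at
  the last run. The opposite long run at the head of \<open>rest\<close> keeps the last letter of
  \<open>w\<close> from taking anything of \<open>rest\<close>.\<close>

lemma forced_run:
  assumes "rest = [] \<or> hd rest = (True, \<not> last w)" "w \<noteq> []" "length u \<le> length w"
  shows "red u (forced w @ rest) = rest \<and> u = w \<or> suffix ((True, last w) # rest) (red u (forced w @ rest))"
  using assms
proof (induction u arbitrary: w)
  case Nil
  then show ?case using forced_suffix by simp
next
  case (Cons x u)
  then obtain a w' where w: "w = a # w'" by (cases w) auto
  note step = forced_step[of rest a w' x]
  show ?case
  proof (cases "x = a")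
    case False
    then show ?thesis using Cons.IH[of w] Cons.prems step by (auto simp: w)
  next
    case True
    show ?thesis
    proof (cases "w' = []")
      case True
      then show ?thesis using step Cons.prems \<open>x = a\<close> by (simp add: w)
    next
      case False
      then show ?thesis using Cons.IH[of w'] step Cons.prems \<open>x = a\<close> by (simp add: w)
    qed
  qed
qed

lemma forced_pass: "rest = [] \<or> hd rest = (True, \<not> last w) \<Longrightarrow> red w (forced w @ rest) = rest"
proof (induction w)
  case (Cons a w)
  then show ?case using forced_step[of rest a w a] by (cases "w = []") auto
qed simp

lemma tight_forced:
  assumes "rest = [] \<or> hd rest = (True, \<not> last w)" "w \<noteq> []"
  shows "tight (length w) (forced w @ rest) rest"
  unfolding tight_def using forced_run[OF assms]
  by (metis suffix_ConsD suffix_order.refl)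

section \<open>Chunks and frames\<close>

text \<open>The two words are reversed complements of each other, so a stack acts on a chunk as
  negation of its truth value.\<close>

definition chunk :: "bool \<Rightarrow> bool list" where
  "chunk b = (if b then [True, True, True, True, False, False] else [True, True, False, False, False, False])"

text \<open>Passed by either chunk with all six letters in use. The chunks differ in their third and
  fourth letters, and these consume \<open>pp, mm, pp\<close> as two plus one or as one plus
  two.\<close>

definition wild :: "item list" where
  "wild = [PP, mm, PP, mm, pp, mm, pp, MM, pp, MM]"

lemma length_chunk [simp]: "length (chunk b) = 6"
  by (simp add: chunk_def)

abbreviation sep :: "item list \<Rightarrow> bool" where "sep rest \<equiv> rest = [] \<or> hd rest = PP"

lemma wild_pass: "sep rest \<Longrightarrow> red (chunk b) (wild @ rest) = rest"
  by (cases rest) (auto simp: chunk_def wild_def)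

text \<open>The last letter of either chunk is \<open>False\<close>. Behind the final long run it
  takes \<open>mm, pp\<close> together, but takes only \<open>pp\<close> if that comes at once. In
  this way an optional \<open>pp\<close> decides where the literals are entered.\<close>

lemma wild_enter:
  "red (chunk b) (wild @ pp # mm # r) = mm # r"
  "red (chunk b) (wild @ mm # pp # mm # r) = mm # r"
  by (auto simp: chunk_def wild_def)

text \<open>The piece is divided into six stages, none of which a single letter can overshoot;
  stopping one stage early leaves the final long run.\<close>

lemma tight_wild:
  assumes "sep rest"
  shows "tight 6 (wild @ rest) rest" "tight 5 (wild @ rest) (MM # rest)"
proof -
  have suf: "suffix (MM # rest) (MM # rest)" "suffix (MM # rest) (pp # MM # rest)" by (auto intro: suffix_ConsI)
  have 1: "tight 1 ([PP, mm, PP, mm, pp, mm, pp, MM, pp, MM] @ rest) ([PP, mm, pp, mm, pp, MM, pp, MM] @ rest)"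
    by (rule tight_one) (auto simp: suffix_def)
  have 2: "tight 1 ([PP, mm, pp, mm, pp, MM, pp, MM] @ rest) ([pp, mm, pp, MM, pp, MM] @ rest)"
    by (rule tight_one) (auto simp: suffix_def)
  have 3: "tight 1 ([pp, mm, pp, MM, pp, MM] @ rest) ([pp, MM, pp, MM] @ rest)"
    by (rule tight_one) (auto simp: suffix_def)
  have 4: "tight 1 ([pp, MM, pp, MM] @ rest) ([MM, pp, MM] @ rest)"
    by (rule tight_one) (auto simp: suffix_def)
  have 5: "tight 1 ([MM, pp, MM] @ rest) ([MM] @ rest)"
    by (rule tight_one) (auto simp: suffix_def)
  have 6: "tight 1 ([MM] @ rest) rest"
    using assms by (intro tight_one) (cases rest; auto simp: suffix_def)
  have "tight (1 + 1 + 1 + 1 + 1) (wild @ rest) ([MM] @ rest)"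
    unfolding wild_def by (rule tight_trans[OF tight_trans[OF tight_trans[OF tight_trans[OF 1 2] 3] 4] 5])
  from this tight_trans[OF this 6] show "tight 6 (wild @ rest) rest" "tight 5 (wild @ rest) (MM # rest)"
    by (simp_all add: eval_nat_numeral)
qed

definition wilds :: "nat \<Rightarrow> item list" where "wilds k = concat (replicate k wild)"

lemma wilds_Suc: "wilds (Suc k) = wild @ wilds k"
  by (simp add: wilds_def)

lemma sep_wilds: "sep rest \<Longrightarrow> sep (wilds k @ rest)"
  by (cases k) (simp_all add: wilds_Suc wilds_def wild_def)

lemma tight_wilds: "sep rest \<Longrightarrow> tight (6 * k) (wilds k @ rest) rest"
proof (induction k)
  case 0
  then show ?case by (simp add: tight_def wilds_def)
next
  case (Suc k)
  from tight_trans[OF tight_wild(1)[OF sep_wilds[OF Suc.prems]] Suc.IH[OF Suc.prems]]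
  show ?case by (simp add: wilds_Suc)
qed

lemma tight_wilds_last: "sep rest \<Longrightarrow> 0 < k \<Longrightarrow> tight (6 * k - 1) (wilds k @ rest) (MM # rest)"
proof (induction k)
  case (Suc k)
  show ?case
  proof (cases "k = 0")
    case True
    then show ?thesis using tight_wild(2)[OF Suc.prems(1)] by (simp add: wilds_def)
  next
    case False
    from tight_trans[OF tight_wild(1)[OF sep_wilds[OF Suc.prems(1), of k]] Suc.IH] Suc.prems False
    show ?thesis by (simp add: wilds_Suc)
  qed
qed simp

lemma wilds_pass: "sep rest \<Longrightarrow> length bs = k \<Longrightarrow> red (concat (map chunk bs)) (wilds k @ rest) = rest"
proof (induction bs arbitrary: k)
  case Nil
  then show ?case by (simp add: wilds_def)
next
  case (Cons b bs)
  then obtain k' where "k = Suc k'" by auto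
  then show ?case using Cons wild_pass[OF sep_wilds[OF Cons.prems(1)], of b k'] by (simp add: wilds_Suc)
qed

text \<open>The key occurs in a concatenation of words \<open>c\<close> and their reversed complements only if these
  words are the two chunks.\<close>

definition key :: "bool list" where "key = chunk True @ chunk False"

text \<open>For \<open>k = n + 1\<close> it has the size of one block: the two chunks of the key
  and, unconstrained, those of the \<open>n\<close> variables and of the closing
  \<open>True\<close>.\<close>

definition frame :: "nat \<Rightarrow> item list" where
  "frame k = forced key @ wilds k"

lemma length_key: "length key = 12" "last key = False" "key \<noteq> []" "hd key"
  by (simp_all add: key_def chunk_def)

lemma sep_frame: "sep (frame k @ rest)"
  by (simp add: frame_def key_def chunk_def)

lemma tight_frame: "sep rest \<Longrightarrow> tight (12 + 6 * k) (frame k @ rest) rest"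
  using tight_trans[OF tight_forced[of "wilds k @ rest" key] tight_wilds[of rest k]] sep_wilds[of rest k]
  by (simp add: frame_def length_key)

lemma frame_pass:
  assumes "sep rest" "length bs = k"
  shows "red (concat (map chunk (True # False # bs))) (frame k @ rest) = rest"
proof -
  have "concat (map chunk (True # False # bs)) = key @ concat (map chunk bs)" by (simp add: key_def)
  moreover have "red key (forced key @ wilds k @ rest) = wilds k @ rest"
    using sep_wilds[OF assms(1), of k] by (intro forced_pass) (simp add: length_key)
  ultimately show ?thesis
    using wilds_pass[OF assms] by (simp only: frame_def fold_append comp_apply append_assoc)
qed

text \<open>Missing the key means still facing its last run after 12 letters. One letter is needed
  to clear that run, and the remaining \<open>6 * k - 1\<close> cannot clear the last wild piece:
  the delay is carried through to the end of the frame.\<close>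

lemma frame_bad:
  assumes "sep rest" "0 < k" "take 12 W \<noteq> key" "length W \<le> 12 + 6 * k"
  shows "suffix (MM # rest) (red W (frame k @ rest))"
proof -
  let ?X = "wilds k @ rest"
  have "suffix (MM # ?X) (red (take 12 W) (forced key @ ?X))"
    using forced_run[of ?X key "take 12 W"] sep_wilds[OF assms(1), of k] assms(3) by (auto simp: length_key)
  then have "suffix (red (drop 12 W) (MM # ?X)) (red (drop 12 W) (red (take 12 W) (forced key @ ?X)))"
    by (rule red_mono)
  also have "\<dots> = red W (frame k @ rest)"
    by (simp add: frame_def flip: fold_append comp_apply[of "fold ieat (drop 12 W)"])
  finally have 1: "suffix (red (drop 12 W) (MM # ?X)) (red W (frame k @ rest))" .
  have "tight 1 (MM # ?X) ?X"
    using sep_wilds[OF assms(1), of k] by (intro tight_one) (cases ?X; auto simp: suffix_def)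
  from tight_trans[OF this tight_wilds_last[OF assms(1,2)]]
  have "tight (6 * k) (MM # ?X) (MM # rest)" using assms(2) by simp
  then have "suffix (MM # rest) (red (drop 12 W) (MM # ?X))" using assms(4) by (simp add: tight_def)
  with 1 show ?thesis by (rule suffix_order.trans[rotated])
qed

definition frames :: "nat \<Rightarrow> nat \<Rightarrow> item list" where "frames R k = concat (replicate R (frame k))"

lemma frames_Suc: "frames (Suc R) k = frame k @ frames R k"
  by (simp add: frames_def)

lemma sep_frames: "sep rest \<Longrightarrow> sep (frames R k @ rest)"
  using sep_frame[of k "frames (R - 1) k @ rest"] by (cases R) (simp_all add: frames_Suc frames_def)

lemma tight_frames: "sep rest \<Longrightarrow> tight (R * (12 + 6 * k)) (frames R k @ rest) rest"
proof (induction R)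
  case 0
  then show ?case by (simp add: tight_def frames_def)
next
  case (Suc R)
  from tight_trans[OF tight_frame[OF sep_frames[OF Suc.prems]] Suc.IH[OF Suc.prems]]
  show ?case by (simp add: frames_Suc)
qed

text \<open>Each copy costs one letter more than its size. The key is excluded at every offset of
  \<open>W\<close> because a delayed reader may meet a copy anywhere in the word.\<close>

lemma frames_bad:
  assumes "sep rest" "0 < k" "\<And>i. take 12 (drop i W) \<noteq> key" "length W \<le> R * (12 + 6 * k + 1)"
  shows "suffix rest (red W (frames R k @ rest))"
  using assms(3,4)
proof (induction R arbitrary: W)
  case 0
  then show ?case by (simp add: frames_def)
next
  case (Suc R)
  let ?m = "12 + 6 * k" and ?r = "frames R k @ rest"
  have sep: "sep ?r" using sep_frames[OF assms(1)] .
  have "take 12 (take ?m W) \<noteq> key" using Suc.prems(1)[of 0] by (simp add: min_def)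
  then have 1: "suffix (MM # ?r) (red (take ?m W) (frame k @ ?r))"
    by (intro frame_bad[OF sep assms(2)]) auto
  have "suffix ?r (red (take 1 (drop ?m W)) (MM # ?r))"
    using sep by (cases "drop ?m W"; cases ?r) (auto simp: suffix_def)
  also have "suffix \<dots> (red (take 1 (drop ?m W)) (red (take ?m W) (frame k @ ?r)))"
    by (rule red_mono[OF 1])
  also have "\<dots> = red (take (?m + 1) W) (frame k @ ?r)"
    by (simp only: take_add fold_append comp_apply)
  finally have 2: "suffix ?r (red (take (?m + 1) W) (frame k @ ?r))" .
  have "suffix rest (red (drop (?m + 1) W) ?r)"
    by (rule Suc.IH) (use Suc.prems in \<open>auto simp: drop_drop\<close>)
  also have "suffix \<dots> (red (drop (?m + 1) W) (red (take (?m + 1) W) (frame k @ ?r)))"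
    by (rule red_mono[OF 2])
  also have "\<dots> = red W (frames (Suc R) k @ rest)"
    by (simp add: frames_Suc flip: fold_append comp_apply[of "fold ieat (drop _ W)"] del: take_Suc drop_Suc)
  finally show ?case .
qed


section \<open>Clause gadgets\<close>

text \<open>On alternating single items a letter takes two items if it agrees with the first of them
  and one otherwise; by this count both chunks consume exactly the ten items of the neutral gadget.
  In the other gadgets repeated items shift the count so that the matching chunk ends two items
  further on and the other chunk does not.\<close>

fun gadget :: "bool option \<Rightarrow> item list" where
  "gadget None = [mm, pp, mm, pp, mm, pp, mm, pp, mm, pp]"
| "gadget (Some True) = [mm, pp, mm, pp, mm, pp, pp, mm, mm, pp]"
| "gadget (Some False) = [mm, pp, mm, mm, pp, mm, pp, mm, pp]"

text \<open>Passable only from two items ahead and only by \<open>chunk True\<close>. Without that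
  lead the letters \<open>True\<close> are used up too early, and one of the three long ascent runs
  is left when the chunk turns to \<open>False\<close>.\<close>

definition ending :: "item list" where
  "ending = [mm, pp, mm, PP, mm, PP, mm, PP, MM, pp, MM]"

definition literals :: "bool option list \<Rightarrow> item list" where
  "literals ls = concat (map gadget ls) @ ending"

text \<open>The forced part tests the leading chunk, and the wild piece lets the second chunk of the
  key pass. Without the \<open>pp\<close>, the literals are entered in the position of a clause that
  is already satisfied.\<close>

definition clause_start :: "bool \<Rightarrow> item list" where
  "clause_start active = forced (chunk True) @ wild @ (if active then [pp] else [])"

definition clause :: "bool \<times> bool option list \<Rightarrow> item list" where
  "clause C = clause_start (fst C) @ literals (snd C)"

definition some_match :: "bool option list \<Rightarrow> bool list \<Rightarrow> bool" where
  "some_match ls bs \<longleftrightarrow> (\<exists>(l, b) \<in> set (zip ls bs). l = Some b)"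

definition satisfied :: "bool list \<Rightarrow> bool \<times> bool option list \<Rightarrow> bool" where
  "satisfied bs C \<longleftrightarrow> (fst C \<longrightarrow> some_match (snd C) bs)"

abbreviation reds :: "bool list \<Rightarrow> item list \<Rightarrow> item list" where
  "reds bs xs \<equiv> red (concat (map chunk bs)) xs"

text \<open>Two positions matter when the gadget of a literal is reached with its chunk: at the gadget
  if no literal has matched so far, and two items ahead otherwise. No word of chunks gets further ahead.\<close>

fun ahead :: "item list \<Rightarrow> item list" where
  "ahead (a # b # r) = r"
| "ahead r = []"

lemma suffix_ahead: "suffix (ahead xs) xs"
  by (cases xs rule: ahead.cases) (auto simp: suffix_def)

lemma gadget_head: "\<exists>r. gadget l = mm # pp # mm # r"
  by (cases l rule: gadget.cases) auto

lemma literals_head: "\<exists>r. literals ls @ rest = mm # pp # mm # r"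
proof (cases ls)
  case (Cons l ls')
  then show ?thesis using gadget_head[of l] by (auto simp: literals_def)
qed (simp add: literals_def ending_def)

lemma gadget_behind: "red (chunk b) (gadget l @ mm # pp # mm # r) = (if l = Some b then mm # r else mm # pp # mm # r)"
  by (cases l rule: gadget.cases; cases b) (auto simp: chunk_def)

lemma gadget_ahead: "red (chunk b) (ahead (gadget l) @ mm # pp # mm # r) = mm # r"
  by (cases l rule: gadget.cases; cases b) (auto simp: chunk_def)

lemma literals_Cons: "literals (l # ls) = gadget l @ literals ls"
  by (simp add: literals_def)

lemma ahead_gadget: "ahead (gadget l @ xs) = ahead (gadget l) @ xs"
  using gadget_head[of l] by auto

lemma literals_step:
  "red (chunk b) (literals (l # ls) @ rest) = (if l = Some b then ahead (literals ls @ rest) else literals ls @ rest)"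
  "red (chunk b) (ahead (literals (l # ls) @ rest)) = ahead (literals ls @ rest)"
  using literals_head[of ls rest] gadget_behind[of b l] gadget_ahead[of b l]
  by (auto simp: literals_Cons ahead_gadget)

lemma ending_step:
  assumes "sep rest"
  shows "red (chunk True) (ahead (ending @ rest)) = rest"
    "suffix (MM # rest) (red (chunk False) (ahead (ending @ rest)))"
    "suffix (MM # rest) (red (chunk b) (ending @ rest))"
  using assms by (cases rest; cases b; auto simp: chunk_def ending_def suffix_def)+

lemma literals_ahead: "length bs = length ls \<Longrightarrow> reds bs (ahead (literals ls @ rest)) = ahead (ending @ rest)"
proof (induction bs arbitrary: ls)
  case (Cons b bs)
  then obtain l ls' where "ls = l # ls'" by (cases ls) auto
  then show ?case using Cons literals_step(2) by simp
qed (simp add: literals_def)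

lemma literals_behind: "length bs = length ls \<Longrightarrow>
    reds bs (literals ls @ rest) = (if some_match ls bs then ahead (ending @ rest) else ending @ rest)"
proof (induction bs arbitrary: ls)
  case Nil
  then show ?case by (simp add: literals_def some_match_def)
next
  case (Cons b bs)
  then obtain l ls' where ls: "ls = l # ls'" "length bs = length ls'" by (cases ls) auto
  then have "some_match ls (b # bs) \<longleftrightarrow> l = Some b \<or> some_match ls' bs" by (auto simp: some_match_def)
  then show ?case using Cons.IH[OF ls(2)] literals_step(1) literals_ahead[OF ls(2)] ls by simp
qed

lemma clause_enter:
  "red (chunk b) (wild @ (if active then [pp] else []) @ literals ls @ rest) =
    (if active then literals ls @ rest else ahead (literals ls @ rest))"
  using literals_head[of ls rest] wild_enter[of b] by auto

lemma sep_wild: "hd (wild @ xs) = PP"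
  by (simp add: wild_def)

lemma clause_pass:
  assumes "sep rest" "length bs = length (snd C)" "satisfied bs C"
  shows "reds (True # b # bs @ [True]) (clause C @ rest) = rest"
proof -
  let ?X = "wild @ (if fst C then [pp] else []) @ literals (snd C) @ rest"
  have "red (chunk True) (clause C @ rest) = ?X"
    using forced_pass[of ?X "chunk True"] sep_wild by (simp add: clause_def clause_start_def chunk_def)
  then have "reds (True # b # bs @ [True]) (clause C @ rest) = reds (bs @ [True]) (red (chunk b) ?X)" by simp
  also have "\<dots> = red (chunk True) (ahead (ending @ rest))"
    using assms literals_ahead[OF assms(2)] literals_behind[OF assms(2)]
    by (simp add: clause_enter satisfied_def)
  finally show ?thesis using ending_step(1)[OF assms(1)] by simp
qed

section \<open>Lower bounds in chunks\<close>

definition need :: "nat \<Rightarrow> item list \<Rightarrow> bool" where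
  "need k xs \<longleftrightarrow> (\<forall>bs. reds bs xs = [] \<longrightarrow> k \<le> length bs)"

lemma need_mono: "need k xs \<Longrightarrow> suffix xs ys \<Longrightarrow> need k ys"
  unfolding need_def by (metis red_mono suffix_bot.extremum_uniqueI)

lemma need_step: "xs \<noteq> [] \<Longrightarrow> (\<And>b. need k (red (chunk b) xs)) \<Longrightarrow> need (Suc k) xs"
  unfolding need_def
proof (intro allI impI)
  fix bs
  assume *: "xs \<noteq> []" "\<And>b. \<forall>bs. reds bs (red (chunk b) xs) = [] \<longrightarrow> k \<le> length bs" "reds bs xs = []"
  then obtain b bs' where "bs = b # bs'" by (cases bs) auto
  then show "Suc k \<le> length bs" using * by auto
qed

text \<open>Either chunk stalls on its leading letters \<open>True\<close>, clears the run with the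
  first \<open>False\<close> and then stops at the \<open>PP\<close> that starts
  \<open>rest\<close>. Thus being late by one long run costs a whole chunk.\<close>

lemma need_MM:
  assumes "sep rest" "need k rest"
  shows "need (Suc k) (MM # rest)"
proof (rule need_step)
  show "need k (red (chunk b) (MM # rest))" for b
    using assms by (cases rest; cases b) (auto simp: chunk_def)
qed simp

lemma need_ahead:
  assumes "sep rest" "need k rest"
  shows "need (Suc k + length ls) (ahead (literals ls @ rest))"
proof (induction ls)
  case Nil
  have "need k (red (chunk b) (ahead (ending @ rest)))" for b
    using ending_step(1,2)[OF assms(1)] assms(2) by (cases b) (auto intro: need_mono suffix_ConsD)
  then show ?case by (simp add: literals_def ending_def need_step)
next
  case (Cons l ls)
  have "ahead (literals (l # ls) @ rest) \<noteq> []" using literals_head[of "l # ls" rest] by auto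
  from need_step[OF this] show ?case using Cons literals_step(2) by simp
qed

lemma need_wild:
  assumes "sep rest" "need k rest"
  shows "need (Suc (Suc k + length ls)) (wild @ (if active then [pp] else []) @ literals ls @ rest)"
proof (rule need_step)
  show "need (Suc k + length ls) (red (chunk b) (wild @ (if active then [pp] else []) @ literals ls @ rest))" for b
    unfolding clause_enter using need_ahead[OF assms, of ls] by (auto intro: need_mono suffix_ahead)
qed (simp add: wild_def)

lemma forced_chunk_step:
  assumes "hd X = PP"
  shows "red (chunk b) (forced (chunk True) @ X) = X \<and> b \<or> suffix (MM # X) (red (chunk b) (forced (chunk True) @ X))"
  using forced_run[of X "chunk True" "chunk b"] assms by (cases b) (auto simp: chunk_def)

lemma need_clause:
  assumes "sep rest" "need k rest"
  shows "need (k + length (snd C) + 3) (clause C @ rest)"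
proof -
  let ?X = "wild @ (if fst C then [pp] else []) @ literals (snd C) @ rest"
  have "need (Suc (Suc (Suc k + length (snd C)))) (forced (chunk True) @ ?X)"
  proof (rule need_step)
    show "need (Suc (Suc k + length (snd C))) (red (chunk b) (forced (chunk True) @ ?X))" for b
    proof -
      have "suffix ?X (red (chunk b) (forced (chunk True) @ ?X))"
        using forced_chunk_step[OF sep_wild] by (metis suffix_ConsD suffix_order.refl)
      then show ?thesis by (rule need_mono[OF need_wild[OF assms]])
    qed
  qed (simp add: chunk_def)
  then show ?thesis by (simp add: clause_def clause_start_def eval_nat_numeral add.commute)
qed

text \<open>The number of chunks equals the lower bound for this clause and the rest together. Each
  possible failure leaves \<open>MM\<close> in front of the next piece and so demands one chunk too
  many.\<close>

lemma clause_exact: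
  assumes rest: "sep rest" "need (length zs) rest" and len: "length bs = length (snd C)"
    and *: "reds (x # y # bs @ z # zs) (clause C @ rest) = []"
  shows "x \<and> z \<and> satisfied bs C \<and> reds zs rest = []"
proof -
  let ?X = "wild @ (if fst C then [pp] else []) @ literals (snd C) @ rest"
  have X: "need (Suc (Suc (length zs) + length (snd C))) ?X" using need_wild[OF rest] .
  have "red (chunk x) (forced (chunk True) @ ?X) = ?X \<and> x"
  proof (rule ccontr)
    assume "\<not> ?thesis"
    then have "suffix (MM # ?X) (red (chunk x) (forced (chunk True) @ ?X))"
      using forced_chunk_step[of ?X x] sep_wild by auto
    moreover have "need (Suc (Suc (Suc (length zs) + length (snd C)))) (MM # ?X)"
      by (rule need_MM[OF _ X]) (simp add: sep_wild)
    ultimately have "need (Suc (Suc (Suc (length zs) + length (snd C)))) (red (chunk x) (clause C @ rest))"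
      using need_mono by (simp add: clause_def clause_start_def)
    then show False using * len by (auto simp: need_def dest!: spec[of _ "y # bs @ z # zs"])
  qed
  then have x: x and e: "red (chunk x) (forced (chunk True) @ ?X) = ?X" by blast+
  have "clause C @ rest = forced (chunk True) @ ?X" by (simp add: clause_def clause_start_def)
  then have "reds (y # bs @ z # zs) (red (chunk x) (forced (chunk True) @ ?X)) = []" using * by simp
  then have "reds (y # bs @ z # zs) ?X = []" unfolding e .
  then have 1: "reds (z # zs) (reds bs (if fst C then literals (snd C) @ rest else ahead (literals (snd C) @ rest))) = []"
    by (simp add: clause_enter)
  \<comment> \<open>The remaining \<open>zs\<close> are as many as \<open>rest\<close> needs, so
    they cannot pay for a leftover \<open>MM\<close>.\<close>
  have late: False if "suffix (MM # rest) Y" "reds zs Y = []" for Y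
    using need_mono[OF need_MM[OF rest] that(1)] that(2) by (auto simp: need_def)
  have sat: "satisfied bs C"
  proof (rule ccontr)
    assume "\<not> ?thesis"
    then have "reds zs (red (chunk z) (ending @ rest)) = []"
      using 1 literals_behind[OF len] by (simp add: satisfied_def)
    then show False using late ending_step(3)[OF rest(1)] by blast
  qed
  then have 2: "reds zs (red (chunk z) (ahead (ending @ rest))) = []"
    using 1 literals_behind[OF len] literals_ahead[OF len] by (simp add: satisfied_def split: if_splits)
  then have z using late ending_step(2)[OF rest(1)] by (cases z) auto
  then show ?thesis using x sat 2 ending_step(1)[OF rest(1)] by simp
qed

definition clauses :: "(bool \<times> bool option list) list \<Rightarrow> item list" where
  "clauses Cs = concat (map clause Cs)"

lemma sep_clauses: "sep (clauses Cs)"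
  by (cases Cs) (simp_all add: clauses_def clause_def clause_start_def chunk_def)

lemma need_clauses:
  "\<forall>C \<in> set Cs. length (snd C) = n \<Longrightarrow> need (length Cs * (n + 3)) (clauses Cs)"
proof (induction Cs)
  case Nil
  then show ?case by (simp add: need_def clauses_def)
next
  case (Cons C Cs)
  then have "need (length Cs * (n + 3) + length (snd C) + 3) (clause C @ clauses Cs)"
    by (intro need_clause sep_clauses) simp
  then show ?case using Cons.prems by (simp add: clauses_def algebra_simps)
qed

text \<open>\<open>need_clauses\<close> shows at each stage that the chunks left are no more than
  the remaining clauses require, so \<open>clause_exact\<close> applies to every clause with its own
  \<open>n + 3\<close> chunks.\<close>

lemma clauses_exact:
  assumes "\<forall>C \<in> set Cs. length (snd C) = n" "\<forall>ys \<in> set Y. length ys = n + 3" "length Y = length Cs"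
    and "reds (concat Y) (clauses Cs) = []"
  shows "list_all2 (\<lambda>ys C. hd ys \<and> last ys \<and> satisfied (butlast (drop 2 ys)) C) Y Cs"
  using assms
proof (induction Y arbitrary: Cs)
  case (Cons ys Y)
  then obtain C Cs' where Cs: "Cs = C # Cs'" by (cases Cs) auto
  have "length ys = n + 3" using Cons.prems by simp
  then obtain x y bs z where ys: "ys = x # y # bs @ [z]" "length bs = n"
  proof -
    obtain x y r where r: "ys = x # y # r" using \<open>length ys = n + 3\<close> by (cases ys; cases "tl ys") auto
    then have "r \<noteq> []" "length r = n + 1" using \<open>length ys = n + 3\<close> by auto
    then show ?thesis using r by (intro that[of x y "butlast r" "last r"]) auto
  qed
  have len: "length (concat Y) = length Cs' * (n + 3)"
    using Cons.prems Cs by (subst length_concat_uniform[of _ "n + 3"]) auto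
  have "x \<and> z \<and> satisfied bs C \<and> reds (concat Y) (clauses Cs') = []"
  proof (rule clause_exact)
    show "need (length (concat Y)) (clauses Cs')" unfolding len by (rule need_clauses) (use Cons.prems Cs in auto)
    show "reds (x # y # bs @ z # concat Y) (clause C @ clauses Cs') = []"
      using Cons.prems(4) by (simp add: ys Cs clauses_def)
  qed (use sep_clauses ys Cons.prems Cs in auto)
  then show ?case using Cons.IH[of Cs'] Cons.prems Cs ys by (simp add: butlast_append)
qed simp

section \<open>Schedules and assignments\<close>

definition rc :: "bool list \<Rightarrow> bool list" where "rc w = rev (map Not w)"

lemma rc_rc [simp]: "rc (rc w) = w"
  by (simp add: rc_def rev_map comp_def)

lemma length_rc [simp]: "length (rc w) = length w"
  by (simp add: rc_def)

lemma rc_concat: "rc (concat xs) = concat (rev (map rc xs))"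
  by (induction xs) (simp_all add: rc_def)

lemma rc_chunk: "rc (chunk b) = chunk (\<not> b)"
  by (cases b) (simp_all add: rc_def chunk_def)

lemma up_flip: "up (flip t) \<longleftrightarrow> \<not> up t"
  by (cases t) (simp_all add: up_def)

lemma map_up_rounds_word:
  "map up (rounds_word \<psi> \<phi>) = concat (map (\<lambda>v. if up v then map up \<psi> else rc (map up \<psi>)) \<phi>)"
  by (induction \<phi>) (simp_all add: rounds_word_def rc_def rev_map up_flip comp_def, simp_all add: up_def)

lemma drop_concat_uniform: "\<forall>x \<in> set xs. length x = m \<Longrightarrow> drop (a * m) (concat xs) = concat (drop a xs)"
proof (induction xs arbitrary: a)
  case (Cons x xs)
  then show ?case by (cases a) (simp_all add: add.commute)
qed simp

section \<open>Where the key can occur\<close>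

text \<open>A window that is not aligned sees the tail of one block, a full block and the head of a
  third. Writing \<open>c\<close> as six unknown letters turns each combination into contradictory
  equations.\<close>

lemma key_split:
  assumes "x \<in> {c, rc c}" "y \<in> {c, rc c}" "z \<in> {c, rc c}" "length c = 6" "b \<in> {1, 2, 3, 4, 5}"
  shows "drop b x @ y @ take b z \<noteq> key"
proof -
  obtain c1 c2 c3 c4 c5 c6 where c: "c = [c1, c2, c3, c4, c5, c6]"
    using assms(4) by (auto simp: length_Suc_conv eval_nat_numeral)
  have rc: "rc c = [\<not> c6, \<not> c5, \<not> c4, \<not> c3, \<not> c2, \<not> c1]" by (simp add: c rc_def)
  show ?thesis
    using assms(1,2,3,5) unfolding rc unfolding c
    by (elim insertE emptyE; simp add: key_def chunk_def; blast)
qed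

text \<open>At an aligned place the key makes a block equal to \<open>chunk True\<close>, whence
  \<open>c\<close> is a chunk; \<open>key_split\<close> excludes all other places.\<close>

lemma key_in_blocks:
  assumes cs: "\<forall>x \<in> set cs. x \<in> {c, rc c}" and c: "length c = 6"
    and key: "take 12 (drop i (concat cs)) = key"
  shows "\<exists>b. c = chunk b"
proof -
  have len: "\<forall>x \<in> set cs. length x = 6" using cs c by auto
  define a b ds where "a = i div 6" and "b = i mod 6" and "ds = drop a cs"
  have i: "i = b + a * 6" by (simp add: a_def b_def)
  have ds: "\<forall>x \<in> set ds. x \<in> {c, rc c} \<and> length x = 6" using cs len unfolding ds_def by (metis in_set_dropD)
  have "drop i (concat cs) = drop b (concat ds)"
    unfolding i using drop_concat_uniform[OF len, of a] by (simp add: ds_def flip: drop_drop)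
  then have key': "take 12 (drop b (concat ds)) = key" using key by simp
  have "length (take 12 (drop b (concat ds))) = 12" unfolding key' by (simp add: length_key)
  moreover have "length (concat ds) = length ds * 6"
    using ds by (intro length_concat_uniform) auto
  ultimately have ge: "12 + b \<le> length ds * 6" by simp
  then have "2 \<le> length ds" by simp
  then obtain x y es where xy: "ds = x # y # es" by (cases ds; cases "tl ds") auto
  have x: "x \<in> {c, rc c}" "y \<in> {c, rc c}" "length x = 6" "length y = 6" using ds xy by auto
  show ?thesis
  proof (cases "b = 0")
    case True
    then have "x @ y = chunk True @ chunk False" using key' x by (simp add: xy key_def)
    then have "x = chunk True" using x by simp
    then show ?thesis using x(1) rc_chunk rc_rc by (metis insertE singletonD)
  next
    case False
    then obtain z fs where z: "es = z # fs" using ge xy by (cases es) auto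
    then have z': "z \<in> {c, rc c}" "length z = 6" using ds xy by auto
    have b: "b \<in> {1, 2, 3, 4, 5}" using False by (auto simp: b_def)
    have "drop b x @ y @ take b z = take 12 (drop b (concat ds))"
      using x z' b by (auto simp: xy z)
    then show ?thesis using key_split[OF x(1,2) z'(1) c b] key' by simp
  qed
qed

section \<open>Schedules against assignments\<close>

theorem schedule_sound:
  assumes len: "length \<psi> = 6" "length \<phi> = n + 3" "length \<chi> = R + length Cs"
    and Cs: "Cs \<noteq> []" "\<forall>C \<in> set Cs. length (snd C) = n" and R: "6 * (n + 3) * length Cs \<le> R"
    and run: "red (map up (rounds_word (rounds_word \<psi> \<phi>) \<chi>)) (frames R (n + 1) @ clauses Cs) = []"
  shows "\<exists>bs. length bs = n \<and> (\<forall>C \<in> set Cs. satisfied bs C)"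
proof -
  define c where "c = map up \<psi>"
  define m where "m = 12 + 6 * (n + 1)"
  let ?W = "map up (rounds_word (rounds_word \<psi> \<phi>) \<chi>)"
  define u where "u = map (\<lambda>v. if up v then c else rc c) \<phi>"
  have W: "?W = concat (map (\<lambda>v. if up v then concat u else rc (concat u)) \<chi>)"
    unfolding map_up_rounds_word u_def c_def ..
  define us where "us = map (\<lambda>v. if up v then u else rev (map rc u)) \<chi>"
  have "concat (concat xss) = concat (map concat xss)" for xss :: "bool list list list"
    by (induction xss) auto
  then have Wus: "?W = concat (concat us)"
    unfolding W us_def by (auto simp: rc_concat intro!: arg_cong[of _ _ concat])
  have u: "\<forall>x \<in> set u. x \<in> {c, rc c}" by (auto simp: u_def)
  have usc: "\<forall>x \<in> set (concat us). x \<in> {c, rc c}" using u by (auto simp: us_def split: if_splits)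
  have ne: "clauses Cs \<noteq> []" using Cs(1) by (cases Cs) (auto simp: clauses_def clause_def clause_start_def chunk_def)
  have "\<exists>b. c = chunk b"
  proof (rule ccontr)
    assume no: "\<not> ?thesis"
    have "take 12 (drop i ?W) \<noteq> key" for i
      using key_in_blocks[OF usc, of i] no len unfolding Wus by (auto simp: c_def)
    \<comment> \<open>A block has \<open>6 * (n + 3) = 12 + 6 * (n + 1)\<close> letters, so the
      \<open>R\<close> extra letters demanded by the frames outweigh all blocks intended for the
      clauses.\<close>
    moreover have "length ?W \<le> R * (12 + 6 * (n + 1) + 1)"
    proof -
      have "length ?W = R * (6 * (n + 3)) + 6 * (n + 3) * length Cs" using len by (simp add: algebra_simps)
      also have "\<dots> \<le> R * (6 * (n + 3)) + R" using R by simp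
      also have "\<dots> = R * (12 + 6 * (n + 1) + 1)" by (simp add: algebra_simps)
      finally show ?thesis .
    qed
    ultimately have "suffix (clauses Cs) (red ?W (frames R (n + 1) @ clauses Cs))"
      using sep_clauses by (intro frames_bad) auto
    then show False using run ne by simp
  qed
  then obtain b where c: "c = chunk b" by blast
  \<comment> \<open>If the first word is \<open>chunk False\<close>, queues and stacks of the second
    round exchange their truth values.\<close>
  define y where "y = map (\<lambda>v. b = up v) \<phi>"
  define Y where "Y = map (\<lambda>v. if up v then y else rc y) \<chi>"
  have uy: "u = map chunk y" unfolding u_def c y_def by (auto simp: rc_chunk)
  have "rev (map rc u) = map chunk (rc y)" unfolding uy by (simp add: rc_chunk comp_def rev_map rc_def[of y])
  then have "us = map (map chunk) Y" unfolding us_def Y_def using uy by auto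
  then have WY: "?W = concat (map chunk (concat Y))" unfolding Wus by (simp add: map_concat)
  have y: "length y = n + 3" using len by (simp add: y_def)
  have Y: "\<forall>ys \<in> set Y. length ys = n + 3" "length Y = R + length Cs" using y len by (auto simp: Y_def)
  have split: "concat Y = concat (take R Y) @ concat (drop R Y)"
    by (metis append_take_drop_id concat_append)
  let ?D = "clauses Cs"
  have "\<forall>ys \<in> set (take R Y). length ys = n + 3" using Y by (meson in_set_takeD)
  then have "length (concat (map chunk (concat (take R Y)))) = R * (12 + 6 * (n + 1))"
    using Y length_concat_uniform[of "map chunk (concat (take R Y))" 6]
      length_concat_uniform[of "take R Y" "n + 3"] by (simp add: algebra_simps)
  \<comment> \<open>The first \<open>R\<close> blocks have just as many letters as the frames
    require and cannot touch the clauses.\<close>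
  then have "suffix ?D (reds (concat (take R Y)) (frames R (n + 1) @ ?D))"
    using tight_frames[OF sep_clauses, of R "n + 1" Cs] by (simp add: tight_def)
  then have "suffix (reds (concat (drop R Y)) ?D) (reds (concat (drop R Y)) (reds (concat (take R Y)) (frames R (n + 1) @ ?D)))"
    by (rule red_mono)
  moreover have "reds (concat (drop R Y)) (reds (concat (take R Y)) (frames R (n + 1) @ ?D)) = []"
    using run unfolding WY by (subst (asm) split) simp
  ultimately have "reds (concat (drop R Y)) ?D = []" by simp
  then have all: "list_all2 (\<lambda>ys C. hd ys \<and> last ys \<and> satisfied (butlast (drop 2 ys)) C) (drop R Y) Cs"
    using Y Cs by (intro clauses_exact[where n = n]) (auto dest: in_set_dropD)
  obtain w where w: "w \<in> set (drop R Y)" using Cs(1) Y(2) by (cases "drop R Y") auto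
  have ends: "hd ys \<and> last ys \<and> length ys = n + 3 \<and> ys \<in> {y, rc y}" if "ys \<in> set (drop R Y)" for ys
  proof -
    have mem: "ys \<in> set Y" using that by (rule in_set_dropD)
    obtain j where j: "j < length (drop R Y)" "ys = drop R Y ! j"
      using \<open>ys \<in> set (drop R Y)\<close> by (metis in_set_conv_nth)
    have "hd ys \<and> last ys" using list_all2_nthD[OF all j(1)] unfolding j(2) by (elim conjE) (rule conjI)
    moreover have "ys \<in> {y, rc y}" using mem by (auto simp: Y_def)
    moreover have "length ys = n + 3" using mem Y(1) by (rule bspec[rotated])
    ultimately show ?thesis by simp
  qed
  \<comment> \<open>The reversed complement of \<open>w\<close> would end with the negation of the
    first letter of \<open>w\<close>.\<close>
  have same: "ys = w" if "ys \<in> set (drop R Y)" for ys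
  proof (rule ccontr)
    assume "ys \<noteq> w"
    then have "ys = rc w" using ends[OF that] ends[OF w] by auto
    then have "last ys = (\<not> hd w)" using ends[OF w] by (cases w) (auto simp: rc_def)
    then show False using ends[OF that] ends[OF w] by simp
  qed
  have "satisfied (butlast (drop 2 w)) C" if "C \<in> set Cs" for C
  proof -
    obtain j where "j < length Cs" "C = Cs ! j" using \<open>C \<in> set Cs\<close> by (metis in_set_conv_nth)
    moreover from this have "drop R Y ! j = w"
      using list_all2_lengthD[OF all] by (intro same nth_mem) simp
    ultimately show ?thesis using list_all2_nthD2[OF all] by metis
  qed
  \<comment> \<open>Without the two leading chunks and the closing one, the values of the variables
    remain.\<close>
  then show ?thesis using ends[OF w] by (intro exI[of _ "butlast (drop 2 w)"]) auto
qed

definition type_of :: "bool \<Rightarrow> pile_type" where "type_of b = (if b then Queue else Stack)"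

lemma up_type_of [simp]: "up (type_of b) = b"
  by (simp add: up_def type_of_def)

theorem schedule_complete:
  assumes bs: "length bs = n" "\<forall>C \<in> set Cs. satisfied bs C" and Cs: "\<forall>C \<in> set Cs. length (snd C) = n"
  shows "\<exists>\<psi> \<phi> \<chi>. length \<psi> = 6 \<and> length \<phi> = n + 3 \<and> length \<chi> = R + length Cs \<and>
    red (map up (rounds_word (rounds_word \<psi> \<phi>) \<chi>)) (frames R (n + 1) @ clauses Cs) = []"
proof -
  \<comment> \<open>\<open>True, False\<close> spell the key, and the ending of a clause demands the
    closing \<open>True\<close>. The third round will consist of queues only, so each block is this
    word itself.\<close>
  define y where "y = True # False # bs @ [True]"
  define \<psi> where "\<psi> = map type_of (chunk True)"
  define \<phi> where "\<phi> = map type_of y"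
  have \<psi>: "map up \<psi> = chunk True" by (simp add: \<psi>_def comp_def)
  have block: "map up (rounds_word \<psi> \<phi>) = concat (map chunk y)"
    unfolding map_up_rounds_word \<psi> by (auto simp: \<phi>_def rc_chunk comp_def intro!: arg_cong[of _ _ concat])
  have rep: "map up (rounds_word (rounds_word \<psi> \<phi>) (replicate k Queue)) = concat (replicate k (concat (map chunk y)))" for k
  proof -
    have "up Queue" by (simp add: up_def)
    then show ?thesis by (subst map_up_rounds_word) (simp add: block map_replicate)
  qed
  have 1: "red (concat (replicate R (concat (map chunk y)))) (frames R (n + 1) @ D) = D" if "sep D" for D
  proof (induction R)
    case 0
    then show ?case by (simp add: frames_def)
  next
    case (Suc R)
    then show ?case
      using frame_pass[OF sep_frames[OF that], of "bs @ [True]" "n + 1" R "n + 1"] bs(1)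
      by (simp add: frames_Suc y_def)
  qed
  have 2: "red (concat (replicate (length Ds) (concat (map chunk y)))) (clauses Ds) = []" if "set Ds \<subseteq> set Cs" for Ds
    using that
  proof (induction Ds)
    case Nil
    then show ?case by (simp add: clauses_def)
  next
    case (Cons C Ds)
    then have "reds y (clause C @ clauses Ds) = clauses Ds"
      unfolding y_def using bs Cs sep_clauses by (intro clause_pass) auto
    then show ?case using Cons by (simp add: clauses_def)
  qed
  have "red (map up (rounds_word (rounds_word \<psi> \<phi>) (replicate (R + length Cs) Queue))) (frames R (n + 1) @ clauses Cs) = []"
    unfolding rep by (simp only: replicate_add concat_append fold_append comp_apply 1[OF sep_clauses] 2[OF order_refl])
  moreover have "length \<psi> = 6" "length \<phi> = n + 3" using bs(1) by (simp_all add: \<psi>_def \<phi>_def y_def)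
  ultimately show ?thesis by (intro exI[of _ \<psi>] exI[of _ \<phi>] exI[of _ "replicate (R + length Cs) Queue"]) simp
qed

section \<open>Computations as tilings\<close>

type_synonym rule = "nat \<times> nat list \<times> nat \<times> nat list \<times> head_move list"

text \<open>
  A tile describes one cell of every tape at one time: the rule applied at that time (\<open>None\<close> once
  the machine has accepted), and for each tape the symbol, whether the head is there now, and
  whether it is there at the next time.
\<close>

type_synonym tile = "rule option \<times> (nat \<times> bool \<times> bool) list"

definition source :: "tm \<Rightarrow> rule option \<Rightarrow> nat" where
  "source M r = (case r of None \<Rightarrow> accept_state M | Some (q, _) \<Rightarrow> q)"

definition target :: "tm \<Rightarrow> rule option \<Rightarrow> nat" where
  "target M r = (case r of None \<Rightarrow> accept_state M | Some (_, _, q', _) \<Rightarrow> q')"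

definition reads :: "rule option \<Rightarrow> nat \<Rightarrow> nat \<Rightarrow> bool" where
  "reads r i a \<longleftrightarrow> (case r of None \<Rightarrow> True | Some (_, rs, _) \<Rightarrow> a = rs ! i)"

definition written :: "rule option \<Rightarrow> nat \<Rightarrow> nat \<Rightarrow> nat" where
  "written r i a = (case r of None \<Rightarrow> a | Some (_, _, _, ws, _) \<Rightarrow> ws ! i)"

definition direction :: "rule option \<Rightarrow> nat \<Rightarrow> head_move" where
  "direction r i = (case r of None \<Rightarrow> Stay | Some (_, _, _, _, ds) \<Rightarrow> ds ! i)"

definition tsym :: "tile \<Rightarrow> nat \<Rightarrow> nat" where "tsym g i = fst (snd g ! i)"
definition here :: "tile \<Rightarrow> nat \<Rightarrow> bool" where "here g i = fst (snd (snd g ! i))"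
definition soon :: "tile \<Rightarrow> nat \<Rightarrow> bool" where "soon g i = snd (snd (snd g ! i))"

definition tiles :: "tm \<Rightarrow> nat \<Rightarrow> tile set" where
  "tiles M B = insert None (Some ` rules M) \<times> {cs. set cs \<subseteq> {..<B} \<times> UNIV \<and> length cs = num_tapes M}"

text \<open>A head arriving from a neighbouring cell is governed by \<open>hor\<close>. At the
  borders that neighbour is missing, so such an arrival is ruled out here.\<close>

definition una :: "tm \<Rightarrow> bool \<times> bool \<times> bool \<times> bool \<times> nat \<Rightarrow> tile \<Rightarrow> bool" where
  "una M = (\<lambda>(first_row, last_row, first_col, last_col, a) g.
     (\<forall>i < num_tapes M. (here g i \<longrightarrow> reads (fst g) i (tsym g i)) \<and>
       (direction (fst g) i = Stay \<longrightarrow> soon g i = here g i) \<and>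
       (direction (fst g) i = Move_Right \<and> first_col \<longrightarrow> \<not> soon g i) \<and>
       (direction (fst g) i = Move_Left \<and> last_col \<longrightarrow> \<not> soon g i) \<and>
       (first_row \<longrightarrow> tsym g i = (if i = 0 then a else 0) \<and> here g i = first_col)) \<and>
     (first_row \<longrightarrow> source M (fst g) = start_state M) \<and> (last_row \<longrightarrow> fst g = None))"

text \<open>Equality of the rules makes the whole row follow one nondeterministic choice. The
  disjunct for the left column mirrors a head that stays put when moving left on cell 0.\<close>

definition hor :: "tm \<Rightarrow> bool \<Rightarrow> tile \<Rightarrow> tile \<Rightarrow> bool" where
  "hor M first_col g g' \<longleftrightarrow> fst g = fst g' \<and>
     (\<forall>i < num_tapes M. (direction (fst g) i = Move_Right \<longrightarrow> soon g' i = here g i) \<and>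
       (direction (fst g) i = Move_Left \<longrightarrow> soon g i = (here g' i \<or> first_col \<and> here g i)))"

definition ver :: "tm \<Rightarrow> tile \<Rightarrow> tile \<Rightarrow> bool" where
  "ver M g g' \<longleftrightarrow> target M (fst g) = source M (fst g') \<and>
     (\<forall>i < num_tapes M. here g' i = soon g i \<and>
       tsym g' i = (if here g i then written (fst g) i (tsym g i) else tsym g i))"

definition tiling :: "tm \<Rightarrow> nat \<Rightarrow> nat list \<Rightarrow> (nat \<Rightarrow> nat \<Rightarrow> tile) \<Rightarrow> bool" where
  "tiling M B w \<tau> \<longleftrightarrow> (\<forall>t < length w. \<forall>h < length w. \<tau> t h \<in> tiles M B \<and>
     una M (t = 0, Suc t = length w, h = 0, Suc h = length w, w ! h) (\<tau> t h) \<and>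
     (Suc h < length w \<longrightarrow> hor M (h = 0) (\<tau> t h) (\<tau> t (Suc h))) \<and>
     (Suc t < length w \<longrightarrow> ver M (\<tau> t h) (\<tau> (Suc t) h)))"

lemma finite_tiles: "wf_tm M \<Longrightarrow> finite (tiles M B)"
  unfolding tiles_def wf_tm_def by (intro finite_cartesian_product) (auto intro!: finite_lists_length_eq)

lemma act_stay: "act tp (scanned tp, Stay) = tp"
  by (cases tp) (simp add: act_def scanned_def)

lemma act_simps: "fst (act tp (a, d)) = (fst tp)(snd tp := a)" "snd (act tp (a, d)) = move_head d (snd tp)"
  by (simp_all add: act_def split_beta)

lemma scanned_conv: "scanned tp = fst tp (snd tp)"
  by (simp add: scanned_def split_beta)

context
  fixes M :: tm and B :: nat
  assumes M: "wf_tm M"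
begin

lemma wf_rule: "(q, rs, q', ws, ds) \<in> rules M \<Longrightarrow>
    length rs = num_tapes M \<and> length ws = num_tapes M \<and> length ds = num_tapes M"
  using M by (auto simp: wf_tm_def)

lemma num_tapes_pos: "0 < num_tapes M"
  using M by (auto simp: wf_tm_def)

lemma initial_tape:
  assumes "i < num_tapes M"
  shows "snd (initial_config M x) ! i =
    ((\<lambda>j. if i = 0 \<and> j < length x then bit_symbol (x ! j) else 0), 0)"
  using assms by (cases i) (auto simp: initial_config_def)

lemma length_initial: "length (snd (initial_config M x)) = num_tapes M"
  using num_tapes_pos by (simp add: initial_config_def)

text \<open>Each row is a genuine configuration restricted to the first \<open>N\<close> cells.
  After \<open>t\<close> steps a head is at cell \<open>t\<close> at most, so the square never loses
  it.\<close>

theorem tiling_accepts: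
  assumes \<tau>: "tiling M B w \<tau>" and w: "w = map bit_symbol x @ replicate k 0" "1 < length w"
  shows "accepts M x"
proof -
  define N where "N = length w"
  define r where "r = (\<lambda>t. fst (\<tau> t 0))"
  have tile: "\<tau> t h \<in> tiles M B" "una M (t = 0, Suc t = N, h = 0, Suc h = N, w ! h) (\<tau> t h)" if "t < N" "h < N" for t h
    using \<tau> that by (auto simp: tiling_def N_def)
  have hor: "hor M (h = 0) (\<tau> t h) (\<tau> t (Suc h))" if "t < N" "Suc h < N" for t h
    using \<tau> that by (auto simp: tiling_def N_def)
  have ver: "ver M (\<tau> t h) (\<tau> (Suc t) h)" if "Suc t < N" "h < N" for t h
    using \<tau> that by (auto simp: tiling_def N_def)
  have row: "fst (\<tau> t h) = r t" if "t < N" "h < N" for t h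
    using that
  proof (induction h)
    case (Suc h)
    then show ?case using hor[of t h] by (simp add: hor_def)
  qed (simp add: r_def)
  have inv: "\<exists>tps. length tps = num_tapes M \<and> (step M)\<^sup>*\<^sup>* (initial_config M x) (source M (r t), tps) \<and>
      (\<forall>i < num_tapes M. snd (tps ! i) \<le> t \<and>
        (\<forall>h < N. tsym (\<tau> t h) i = fst (tps ! i) h \<and> (here (\<tau> t h) i \<longleftrightarrow> h = snd (tps ! i))))"
    if "t < N" for t
    using that
  proof (induction t)
    case 0
    let ?T = "snd (initial_config M x)"
    have "source M (r 0) = start_state M" using tile(2)[of 0 0] row[of 0 0] 0 by (simp add: una_def)
    then have "initial_config M x = (source M (r 0), ?T)" by (simp add: initial_config_def)
    moreover have "tsym (\<tau> 0 h) i = fst (?T ! i) h \<and> (here (\<tau> 0 h) i \<longleftrightarrow> h = snd (?T ! i))"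
      if "i < num_tapes M" "h < N" for i h
    proof -
      have "tsym (\<tau> 0 h) i = (if i = 0 then w ! h else 0) \<and> here (\<tau> 0 h) i = (h = 0)"
        using tile(2)[of 0 h] that 0 by (simp add: una_def)
      moreover have "w ! h = (if h < length x then bit_symbol (x ! h) else 0)"
        using that by (simp add: w(1) nth_append N_def)
      ultimately show ?thesis using initial_tape[OF that(1), of x] by auto
    qed
    ultimately show ?case using length_initial initial_tape
      by (intro exI[of _ ?T]) (auto simp del: initial_tape)
  next
    case (Suc t)
    then obtain tps where len: "length tps = num_tapes M"
      and reach: "(step M)\<^sup>*\<^sup>* (initial_config M x) (source M (r t), tps)"
      and pos: "\<And>i. i < num_tapes M \<Longrightarrow> snd (tps ! i) \<le> t"
      and sy: "\<And>i h. i < num_tapes M \<Longrightarrow> h < N \<Longrightarrow> tsym (\<tau> t h) i = fst (tps ! i) h"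
      and he: "\<And>i h. i < num_tapes M \<Longrightarrow> h < N \<Longrightarrow> here (\<tau> t h) i \<longleftrightarrow> h = snd (tps ! i)"
      by auto
    have t: "t < N" using Suc.prems by simp
    define tps' where "tps' = map (\<lambda>i. act (tps ! i) (written (r t) i (scanned (tps ! i)), direction (r t) i)) [0..<num_tapes M]"
    have tps': "tps' ! i = act (tps ! i) (written (r t) i (scanned (tps ! i)), direction (r t) i)"
      if "i < num_tapes M" for i using that by (simp add: tps'_def)
    have "source M (r (Suc t)) = target M (r t)"
      using ver[of t 0] Suc.prems by (simp add: ver_def r_def)
    moreover have "(step M)\<^sup>*\<^sup>* (source M (r t), tps) (target M (r t), tps')"
    proof (cases "r t")
      case None
      then have "tps' = tps" using len
        by (intro nth_equalityI) (auto simp: tps'_def written_def direction_def act_stay)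
      then show ?thesis using None by (simp add: source_def target_def)
    next
      case (Some rl)
      obtain q rs q' ws ds where rl: "rl = (q, rs, q', ws, ds)" by (cases rl)
      have mem: "(q, rs, q', ws, ds) \<in> rules M"
        using tile(1)[of t 0] t Some rl by (auto simp: tiles_def r_def)
      have "map scanned tps = rs"
      proof (rule nth_equalityI)
        fix i assume "i < length (map scanned tps)"
        then have i: "i < num_tapes M" using len by simp
        let ?h = "snd (tps ! i)"
        have h: "?h < N" using pos[OF i] t by simp
        have "reads (r t) i (tsym (\<tau> t ?h) i)" using tile(2)[OF t h] he[OF i h] i row[OF t h] by (simp add: una_def)
        then show "map scanned tps ! i = rs ! i"
          using sy[OF i h] i len Some rl by (simp add: reads_def scanned_conv)
      qed (use wf_rule[OF mem] len in simp)
      then have "step M (q, tps) (q', map2 act tps (zip ws ds))"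
        using mem by (intro step.intros) simp
      moreover have "map2 act tps (zip ws ds) = tps'"
        using wf_rule[OF mem] len Some rl
        by (intro nth_equalityI) (auto simp: tps'_def written_def direction_def)
      ultimately show ?thesis using Some rl by (simp add: source_def target_def)
    qed
    ultimately have reach': "(step M)\<^sup>*\<^sup>* (initial_config M x) (source M (r (Suc t)), tps')"
      using reach by simp
    have "snd (tps' ! i) \<le> Suc t \<and> (\<forall>h < N. tsym (\<tau> (Suc t) h) i = fst (tps' ! i) h \<and>
        (here (\<tau> (Suc t) h) i \<longleftrightarrow> h = snd (tps' ! i)))" if i: "i < num_tapes M" for i
    proof (intro conjI allI impI)
      let ?p = "snd (tps ! i)" and ?d = "direction (r t) i"
      show "snd (tps' ! i) \<le> Suc t" using pos[OF i] by (cases ?d) (auto simp: tps'[OF i] act_simps)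
      fix h assume h: "h < N"
      have v: "here (\<tau> (Suc t) h) i = soon (\<tau> t h) i"
        "tsym (\<tau> (Suc t) h) i = (if here (\<tau> t h) i then written (r t) i (tsym (\<tau> t h) i) else tsym (\<tau> t h) i)"
        using ver[OF Suc.prems h] i row[OF t h] by (auto simp: ver_def)
      show "tsym (\<tau> (Suc t) h) i = fst (tps' ! i) h"
        using v(2) sy[OF i h] he[OF i h] by (auto simp: tps'[OF i] act_simps scanned_conv)
      have u: "?d = Stay \<longrightarrow> soon (\<tau> t h) i = here (\<tau> t h) i" "?d = Move_Right \<and> h = 0 \<longrightarrow> \<not> soon (\<tau> t h) i"
        "?d = Move_Left \<and> Suc h = N \<longrightarrow> \<not> soon (\<tau> t h) i"
        using tile(2)[OF t h] i row[OF t h] by (auto simp: una_def)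
      have "soon (\<tau> t h) i \<longleftrightarrow> h = move_head ?d ?p"
      proof (cases ?d)
        case Stay
        then show ?thesis using u he[OF i h] by simp
      next
        case Move_Right
        show ?thesis
        proof (cases h)
          case (Suc h')
          then have "soon (\<tau> t h) i = here (\<tau> t h') i"
            using hor[of t h'] t h i row[OF t, of h'] Move_Right by (simp add: hor_def)
          then show ?thesis using Suc h he[OF i, of h'] Move_Right by auto
        qed (use u Move_Right in simp)
      next
        case Move_Left
        show ?thesis
        proof (cases "Suc h = N")
          case True
          \<comment> \<open>A head that moves left on cell 0 stays there, and by
            \<open>1 < length w\<close> this is not the last column.\<close>
          then show ?thesis using u Move_Left pos[OF i] t w(2) by (auto simp: N_def)
        next
          case False
          then have "soon (\<tau> t h) i = (here (\<tau> t (Suc h)) i \<or> h = 0 \<and> here (\<tau> t h) i)"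
            using hor[of t h] t h i row[OF t, of h] Move_Left by (simp add: hor_def)
          then show ?thesis using False h he[OF i, of h] he[OF i, of "Suc h"] Move_Left by auto
        qed
      qed
      then show "here (\<tau> (Suc t) h) i \<longleftrightarrow> h = snd (tps' ! i)" by (simp add: v tps'[OF i] act_simps)
    qed
    then show ?case using reach' by (intro exI[of _ tps']) (auto simp: tps'_def)
  qed
  have "N - 1 < N" using w(2) by (simp add: N_def)
  from inv[OF this] obtain tps where
    "(step M)\<^sup>*\<^sup>* (initial_config M x) (source M (r (N - 1)), tps)" by blast
  moreover have "r (N - 1) = None"
  proof -
    have "0 < N" using w(2) unfolding N_def by linarith
    from tile(2)[OF \<open>N - 1 < N\<close> this] this show ?thesis by (simp add: una_def r_def)
  qed
  ultimately show ?thesis unfolding accepts_def by (auto simp: source_def intro!: exI[of _ "(accept_state M, tps)"])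
qed

text \<open>The accepting configuration is repeated with rule \<open>None\<close> down to the last
  row. A tape symbol is blank, an input bit or written by some rule, hence below
  \<open>B\<close>.\<close>

theorem accepts_tiling:
  assumes acc: "(step M ^^ n) (initial_config M x) c" "fst c = accept_state M"
    and B: "3 \<le> B" "\<And>q rs q' ws ds. (q, rs, q', ws, ds) \<in> rules M \<Longrightarrow> set ws \<subseteq> {..<B}"
    and w: "w = map bit_symbol x @ replicate k 0" "n < length w" "1 < length w"
  shows "\<exists>\<tau>. tiling M B w \<tau>"
proof -
  obtain f where f: "f 0 = initial_config M x" "f n = c" "\<And>i. i < n \<Longrightarrow> step M (f i) (f (Suc i))"
    using acc(1) unfolding relpowp_fun_conv by blast
  have "\<exists>rl. rl \<in> rules M \<and> fst rl = fst (f i) \<and> fst (snd rl) = map scanned (snd (f i)) \<and>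
      fst (snd (snd rl)) = fst (f (Suc i)) \<and>
      snd (f (Suc i)) = map2 act (snd (f i)) (zip (fst (snd (snd (snd rl)))) (snd (snd (snd (snd rl)))))" if "i < n" for i
    using f(3)[OF that] by (cases rule: step.cases) force
  then obtain rl where rl: "\<And>i. i < n \<Longrightarrow> rl i \<in> rules M \<and> fst (rl i) = fst (f i) \<and> fst (snd (rl i)) = map scanned (snd (f i)) \<and>
      fst (snd (snd (rl i))) = fst (f (Suc i)) \<and>
      snd (f (Suc i)) = map2 act (snd (f i)) (zip (fst (snd (snd (snd (rl i))))) (snd (snd (snd (snd (rl i))))))" by metis
  define C where "C = (\<lambda>t. snd (f (min t n)))"
  define r where "r = (\<lambda>t. if t < n then Some (rl t) else None)"
  have len: "length (C t) = num_tapes M" for t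
  proof (induction t)
    case 0
    then show ?case by (simp add: C_def f(1) length_initial)
  next
    case (Suc t)
    show ?case
    proof (cases "t < n")
      case True
      obtain q rs q' ws ds where e: "rl t = (q, rs, q', ws, ds)" by (cases "rl t")
      have "rl t \<in> rules M" using rl[OF True] by blast
      then have "(q, rs, q', ws, ds) \<in> rules M" unfolding e .
      from wf_rule[OF this] show ?thesis using rl[OF True] e Suc True by (simp add: C_def min_def)
    next
      case False
      then show ?thesis using Suc by (simp add: C_def min_def split: if_splits)
    qed
  qed
  have next_tape: "C (Suc t) ! i = act (C t ! i) (written (r t) i (scanned (C t ! i)), direction (r t) i)"
    if "i < num_tapes M" for t i
  proof (cases "t < n")
    case True
    obtain q rs q' ws ds where e: "rl t = (q, rs, q', ws, ds)" by (cases "rl t")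
    have "rl t \<in> rules M" using rl[OF True] by blast
    then have "(q, rs, q', ws, ds) \<in> rules M" unfolding e .
    from wf_rule[OF this] show ?thesis using rl[OF True] e len[of t] True that
      by (simp add: C_def min_def r_def written_def direction_def)
  next
    case False
    then have "min (Suc t) n = min t n" by simp
    then show ?thesis using False by (simp add: C_def r_def written_def direction_def act_stay)
  qed
  have pos: "snd (C t ! i) \<le> t" if "i < num_tapes M" for t i
  proof (induction t)
    case 0
    then show ?case using initial_tape[OF that] by (simp add: C_def f(1))
  next
    case (Suc t)
    then show ?case by (cases "direction (r t) i") (auto simp: next_tape[OF that] act_simps)
  qed
  have bound: "fst (C t ! i) h < B" if "i < num_tapes M" for t i h
  proof (induction t arbitrary: h)
    case 0
    then show ?case using initial_tape[OF that] B(1) by (simp add: C_def f(1) bit_symbol_def)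
  next
    case (Suc t)
    have "written (r t) i (scanned (C t ! i)) < B"
    proof (cases "t < n")
      case True
      obtain q rs q' ws ds where e: "rl t = (q, rs, q', ws, ds)" by (cases "rl t")
      have "rl t \<in> rules M" using rl[OF True] by blast
      then have mem: "(q, rs, q', ws, ds) \<in> rules M" unfolding e .
      have "i < length ws" using wf_rule[OF mem] \<open>i < num_tapes M\<close> by simp
      then have "ws ! i < B" using B(2)[OF mem] nth_mem by blast
      then show ?thesis using e True by (simp add: r_def written_def)
    next
      case False
      then show ?thesis using Suc by (simp add: r_def written_def scanned_conv)
    qed
    then show ?case using Suc by (simp add: next_tape[OF that] act_simps)
  qed
  define \<tau> where "\<tau> = (\<lambda>t h. (r t, map (\<lambda>i. (fst (C t ! i) h, h = snd (C t ! i), h = snd (C (Suc t) ! i))) [0..<num_tapes M]))"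
  have parts: "fst (\<tau> t h) = r t" "i < num_tapes M \<Longrightarrow> tsym (\<tau> t h) i = fst (C t ! i) h"
    "i < num_tapes M \<Longrightarrow> here (\<tau> t h) i \<longleftrightarrow> h = snd (C t ! i)"
    "i < num_tapes M \<Longrightarrow> soon (\<tau> t h) i \<longleftrightarrow> h = move_head (direction (r t) i) (snd (C t ! i))" for t h i
    by (simp_all add: \<tau>_def tsym_def here_def soon_def next_tape act_simps)
  have "tiling M B w \<tau>"
    unfolding tiling_def
  proof (intro allI impI conjI)
    fix t h assume t: "t < length w" and h: "h < length w"
    show "\<tau> t h \<in> tiles M B"
      using bound rl by (auto simp: \<tau>_def tiles_def r_def)
    show "una M (t = 0, Suc t = length w, h = 0, Suc h = length w, w ! h) (\<tau> t h)"
      unfolding una_def prod.case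
    proof (intro conjI allI impI)
      fix i assume i: "i < num_tapes M"
      show "reads (fst (\<tau> t h)) i (tsym (\<tau> t h) i)" if "here (\<tau> t h) i"
        using rl[of t] len[of t] i that by (auto simp: parts reads_def r_def C_def scanned_conv split: prod.splits)
      show "soon (\<tau> t h) i = here (\<tau> t h) i" if "direction (fst (\<tau> t h)) i = Stay"
        using that i by (simp add: parts)
      show "\<not> soon (\<tau> t h) i" if "direction (fst (\<tau> t h)) i = Move_Right \<and> h = 0"
        using that i by (simp add: parts)
      show "\<not> soon (\<tau> t h) i" if "direction (fst (\<tau> t h)) i = Move_Left \<and> Suc h = length w"
        using that i pos[OF i, of t] t w(3) by (auto simp: parts)
      assume "t = 0"
      then have C: "C t = snd (initial_config M x)" by (simp add: C_def f(1))
      show "here (\<tau> t h) i = (h = 0)" using i by (simp add: parts C initial_tape)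
      have "w ! h = (if h < length x then bit_symbol (x ! h) else 0)"
        using h by (simp add: w(1) nth_append)
      then show "tsym (\<tau> t h) i = (if i = 0 then w ! h else 0)" using i by (simp add: parts C initial_tape)
    next
      assume "t = 0"
      then show "source M (fst (\<tau> t h)) = start_state M"
        using rl[of 0] f(1,2) acc(2) by (auto simp: parts r_def source_def initial_config_def split: prod.splits)
    next
      assume "Suc t = length w"
      then show "fst (\<tau> t h) = None" using w(2) by (simp add: parts r_def)
    qed
    show "hor M (h = 0) (\<tau> t h) (\<tau> t (Suc h))" if "Suc h < length w"
      unfolding hor_def by (auto simp: parts)
    show "ver M (\<tau> t h) (\<tau> (Suc t) h)" if "Suc t < length w"
      unfolding ver_def
    proof (intro conjI allI impI)
      have "source M (r t) = fst (f (min t n))" for t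
        using rl[of t] f(2) acc(2) by (auto simp: r_def source_def min_def split: prod.splits)
      moreover have "target M (r t) = fst (f (min (Suc t) n))"
        using rl[of t] f(2) acc(2) by (auto simp: r_def target_def min_def split: prod.splits)
      ultimately show "target M (fst (\<tau> t h)) = source M (fst (\<tau> (Suc t) h))" by (simp add: parts)
      fix i assume i: "i < num_tapes M"
      show "here (\<tau> (Suc t) h) i = soon (\<tau> t h) i" using i by (simp add: parts next_tape act_simps)
      show "tsym (\<tau> (Suc t) h) i = (if here (\<tau> t h) i then written (fst (\<tau> t h)) i (tsym (\<tau> t h) i) else tsym (\<tau> t h) i)"
        using i by (auto simp: parts next_tape act_simps scanned_conv)
    qed
  qed
  then show ?thesis by blast
qed

end


section \<open>Tilings as clauses\<close>

text \<open>One Boolean variable per cell and tile: some tile holds in each cell, no tile violating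
  \<open>una\<close> holds, and no incompatible neighbours hold together. If several tiles hold in a
  cell, each of them is compatible with each one next to it, so any choice gives a tiling.\<close>

datatype family = Fam_ex | Fam_una nat | Fam_hor nat nat | Fam_ver nat nat

definition families :: "nat \<Rightarrow> family list" where
  "families \<kappa> = Fam_ex # map Fam_una [0..<\<kappa>] @
     concat (map (\<lambda>k. concat (map (\<lambda>k'. [Fam_hor k k', Fam_ver k k']) [0..<\<kappa>])) [0..<\<kappa>])"

type_synonym place = "bool \<times> bool \<times> bool \<times> bool \<times> nat"

definition place :: "nat list \<Rightarrow> nat \<Rightarrow> nat \<Rightarrow> place" where
  "place w t h = (t = 0, Suc t = length w, h = 0, Suc h = length w, w ! h)"

text \<open>Clauses are produced for every family at every cell, so that plain loops generate them.
  Where nothing is to be forbidden, or the neighbour lies outside the square, the clause becomes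
  inactive and holds trivially.\<close>

fun forbids :: "tm \<Rightarrow> tile list \<Rightarrow> family \<Rightarrow> place \<Rightarrow> bool" where
  "forbids M gl Fam_ex pl = True"
| "forbids M gl (Fam_una k) pl = (\<not> una M pl (gl ! k))"
| "forbids M gl (Fam_hor k k') (fr, lr, fc, lc, a) = (\<not> lc \<and> \<not> hor M fc (gl ! k) (gl ! k'))"
| "forbids M gl (Fam_ver k k') (fr, lr, fc, lc, a) = (\<not> lr \<and> \<not> ver M (gl ! k) (gl ! k'))"

text \<open>The four flags tell whether the variable's row is that of the clause or the next one, and
  the same for its column.\<close>

fun literal :: "family \<Rightarrow> bool \<times> bool \<times> bool \<times> bool \<Rightarrow> nat \<Rightarrow> bool option" where
  "literal Fam_ex (et, nt, eh, nh) k = (if et \<and> eh then Some True else None)"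
| "literal (Fam_una g) (et, nt, eh, nh) k = (if et \<and> eh \<and> k = g then Some False else None)"
| "literal (Fam_hor g g') (et, nt, eh, nh) k =
    (if et \<and> eh \<and> k = g \<or> et \<and> nh \<and> k = g' then Some False else None)"
| "literal (Fam_ver g g') (et, nt, eh, nh) k =
    (if et \<and> eh \<and> k = g \<or> nt \<and> eh \<and> k = g' then Some False else None)"

definition relation :: "nat \<Rightarrow> nat \<Rightarrow> nat \<Rightarrow> nat \<Rightarrow> bool \<times> bool \<times> bool \<times> bool" where
  "relation t h t' h' = (t' = t, t' = Suc t, h' = h, h' = Suc h)"

definition grid :: "nat \<Rightarrow> nat \<Rightarrow> (nat \<Rightarrow> nat \<Rightarrow> nat \<Rightarrow> 'a) \<Rightarrow> 'a list" where
  "grid \<kappa> N f = concat (map (\<lambda>t. concat (map (\<lambda>h. map (f t h) [0..<\<kappa>]) [0..<N])) [0..<N])"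

text \<open>A clause lists all variables, with \<open>None\<close> for absent ones, because the
  block that reads it carries the whole assignment.\<close>

definition grid_clause :: "tm \<Rightarrow> tile list \<Rightarrow> nat list \<Rightarrow> family \<Rightarrow> nat \<Rightarrow> nat \<Rightarrow> bool \<times> bool option list" where
  "grid_clause M gl w fam t h = (forbids M gl fam (place w t h),
     grid (length gl) (length w) (\<lambda>t' h'. literal fam (relation t h t' h')))"

lemma set_grid: "set (grid \<kappa> N f) = (\<Union>t < N. \<Union>h < N. f t h ` {..<\<kappa>})"
  by (simp add: grid_def atLeast0LessThan)

lemma map_grid: "map g (grid \<kappa> N f) = grid \<kappa> N (\<lambda>t h k. g (f t h k))"
  by (simp add: grid_def map_concat comp_def)

lemma zip_grid: "zip (grid \<kappa> N f) (grid \<kappa> N g) = grid \<kappa> N (\<lambda>t h k. (f t h k, g t h k))"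
proof -
  let ?p = "grid \<kappa> N (\<lambda>t h k. (f t h k, g t h k))"
  have "grid \<kappa> N f = map fst ?p" "grid \<kappa> N g = map snd ?p" by (simp_all add: map_grid)
  then show ?thesis by (simp add: zip_map_fst_snd)
qed

lemma length_grid [simp]: "length (grid \<kappa> N f) = N * (N * \<kappa>)"
proof -
  have "length (concat (map (\<lambda>h. map (f t h) [0..<\<kappa>]) [0..<N])) = N * \<kappa>" for t
    by (subst length_concat_uniform[of _ \<kappa>]) auto
  then show ?thesis unfolding grid_def by (subst length_concat_uniform[of _ "N * \<kappa>"]) auto
qed

lemma nth_grid:
  assumes "t < N" "h < N" "k < \<kappa>"
  shows "grid \<kappa> N f ! (t * (N * \<kappa>) + (h * \<kappa> + k)) = f t h k"
proof -
  let ?row = "\<lambda>t. concat (map (\<lambda>h. map (f t h) [0..<\<kappa>]) [0..<N])"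
  have row: "length (?row t) = N * \<kappa>" for t
    by (subst length_concat_uniform[of _ \<kappa>]) auto
  have "h * \<kappa> + k < Suc h * \<kappa>" using assms by simp
  also have "\<dots> \<le> N * \<kappa>" using assms by (intro mult_right_mono) auto
  finally have "grid \<kappa> N f ! (t * (N * \<kappa>) + (h * \<kappa> + k)) = ?row t ! (h * \<kappa> + k)"
    unfolding grid_def using assms by (subst nth_concat_uniform) (auto simp: row)
  also have "\<dots> = f t h k" using assms by (subst nth_concat_uniform) auto
  finally show ?thesis .
qed

lemma grid_surj: "length bs = N * (N * \<kappa>) \<Longrightarrow> \<exists>f. bs = grid \<kappa> N f"
proof (intro exI nth_equalityI)
  let ?f = "\<lambda>t h k. bs ! (t * (N * \<kappa>) + (h * \<kappa> + k))"
  show "length bs = length (grid \<kappa> N ?f)" if "length bs = N * (N * \<kappa>)" using that by simp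
  fix i assume "length bs = N * (N * \<kappa>)" "i < length bs"
  then have i: "i < N * (N * \<kappa>)" by simp
  define t r where "t = i div (N * \<kappa>)" and "r = i mod (N * \<kappa>)"
  define h k where "h = r div \<kappa>" and "k = r mod \<kappa>"
  have pos: "0 < \<kappa>" "0 < N" using i by (auto intro: gr0I)
  have "t < N" using i by (simp add: t_def less_mult_imp_div_less)
  moreover have "r < N * \<kappa>" using pos by (simp add: r_def)
  then have "h < N" by (simp add: h_def less_mult_imp_div_less)
  moreover have "k < \<kappa>" using pos by (simp add: k_def)
  moreover have "i = t * (N * \<kappa>) + (h * \<kappa> + k)" by (simp only: t_def r_def h_def k_def div_mult_mod_eq)
  ultimately show "bs ! i = grid \<kappa> N ?f ! i" using nth_grid[of t N h k \<kappa> ?f] by simp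
qed

lemma some_match_grid:
  "some_match (grid \<kappa> N f) (grid \<kappa> N g) \<longleftrightarrow>
    (\<exists>t h k. t < N \<and> h < N \<and> k < \<kappa> \<and> f t h k = Some (g t h k))"
proof -
  have "some_match (grid \<kappa> N f) (grid \<kappa> N g) \<longleftrightarrow>
    (\<exists>t \<in> {..<N}. \<exists>h \<in> {..<N}. \<exists>k \<in> {..<\<kappa>}. f t h k = Some (g t h k))"
    by (simp add: some_match_def zip_grid set_grid del: lessThan_iff)
  then show ?thesis by auto
qed

lemma satisfied_grid:
  "satisfied (grid (length gl) (length w) a) (grid_clause M gl w fam t h) \<longleftrightarrow>
    (forbids M gl fam (place w t h) \<longrightarrow> (\<exists>t' h' k. t' < length w \<and> h' < length w \<and> k < length gl \<and>
      literal fam (relation t h t' h') k = Some (a t' h' k)))"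
  by (simp add: satisfied_def grid_clause_def some_match_grid)

theorem clauses_iff_tiling:
  assumes gl: "set gl = tiles M B"
  shows "(\<exists>bs. length bs = length w * (length w * length gl) \<and>
      (\<forall>fam \<in> set (families (length gl)). \<forall>t < length w. \<forall>h < length w. satisfied bs (grid_clause M gl w fam t h))) \<longleftrightarrow>
    (\<exists>\<tau>. tiling M B w \<tau>)" (is "?L \<longleftrightarrow> ?R")
proof
  let ?N = "length w" and ?k = "length gl"
  assume ?L
  then obtain bs where bs: "length bs = ?N * (?N * ?k)"
    "\<And>fam t h. fam \<in> set (families ?k) \<Longrightarrow> t < ?N \<Longrightarrow> h < ?N \<Longrightarrow> satisfied bs (grid_clause M gl w fam t h)" by blast
  obtain a where a: "bs = grid ?k ?N a" using grid_surj[OF bs(1)] by blast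
  note sat = bs(2)[unfolded a satisfied_grid]
  have "\<exists>k < ?k. a t h k" if "t < ?N" "h < ?N" for t h
    using sat[of Fam_ex t h] that by (auto simp: families_def relation_def split: if_splits)
  then obtain f where f: "\<And>t h. t < ?N \<Longrightarrow> h < ?N \<Longrightarrow> f t h < ?k \<and> a t h (f t h)" by metis
  have "tiling M B w (\<lambda>t h. gl ! f t h)"
    unfolding tiling_def
  proof (intro allI impI conjI)
    fix t h assume t: "t < ?N" and h: "h < ?N"
    have mem: "Fam_una (f t h) \<in> set (families ?k)" using f[OF t h] by (simp add: families_def)
    show "gl ! f t h \<in> tiles M B" using f[OF t h] gl nth_mem by blast
    show "una M (t = 0, Suc t = ?N, h = 0, Suc h = ?N, w ! h) (gl ! f t h)"
      using sat[OF mem t h] f[OF t h] by (auto simp: relation_def place_def split: if_splits)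
    show "hor M (h = 0) (gl ! f t h) (gl ! f t (Suc h))" if h': "Suc h < ?N"
    proof -
      have "Fam_hor (f t h) (f t (Suc h)) \<in> set (families ?k)"
        using f[OF t h] f[OF t h'] by (auto simp: families_def)
      from sat[OF this t h] show ?thesis
        using f[OF t h] f[OF t h'] h' by (auto simp: relation_def place_def split: if_splits)
    qed
    show "ver M (gl ! f t h) (gl ! f (Suc t) h)" if t': "Suc t < ?N"
    proof -
      have "Fam_ver (f t h) (f (Suc t) h) \<in> set (families ?k)"
        using f[OF t h] f[OF t' h] by (auto simp: families_def)
      from sat[OF this t h] show ?thesis
        using f[OF t h] f[OF t' h] t' by (auto simp: relation_def place_def split: if_splits)
    qed
  qed
  then show ?R by blast
next
  let ?N = "length w" and ?k = "length gl"
  assume ?R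
  then obtain \<tau> where \<tau>: "tiling M B w \<tau>" by blast
  have "\<exists>k < ?k. gl ! k = \<tau> t h" if "t < ?N" "h < ?N" for t h
    using \<tau> gl that unfolding tiling_def by (metis in_set_conv_nth)
  then obtain f where f: "\<And>t h. t < ?N \<Longrightarrow> h < ?N \<Longrightarrow> f t h < ?k \<and> gl ! f t h = \<tau> t h" by metis
  define a where "a = (\<lambda>t h k. k = f t h)"
  have "satisfied (grid ?k ?N a) (grid_clause M gl w fam t h)"
    if fam: "fam \<in> set (families ?k)" and t: "t < ?N" and h: "h < ?N" for fam t h
    unfolding satisfied_grid
  proof
    assume forb: "forbids M gl fam (place w t h)"
    have T: "una M (place w t h) (\<tau> t h)" "Suc h < ?N \<Longrightarrow> hor M (h = 0) (\<tau> t h) (\<tau> t (Suc h))"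
      "Suc t < ?N \<Longrightarrow> ver M (\<tau> t h) (\<tau> (Suc t) h)"
      using \<tau> t h by (auto simp: tiling_def place_def)
    show "\<exists>t' h' k. t' < ?N \<and> h' < ?N \<and> k < ?k \<and> literal fam (relation t h t' h') k = Some (a t' h' k)"
    proof (cases fam)
      case Fam_ex
      then show ?thesis using f[OF t h] t h
        by (intro exI[of _ t] exI[of _ h] exI[of _ "f t h"]) (simp add: relation_def a_def)
    next
      case (Fam_una k)
      then have "k < ?k" "k \<noteq> f t h" using fam forb T(1) f[OF t h] by (auto simp: families_def)
      then show ?thesis using Fam_una t h
        by (intro exI[of _ t] exI[of _ h] exI[of _ k]) (simp add: relation_def a_def)
    next
      case (Fam_hor k k')
      then have k: "k < ?k" "k' < ?k" using fam by (auto simp: families_def)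
      have h': "Suc h < ?N" "\<not> hor M (h = 0) (gl ! k) (gl ! k')"
        using forb Fam_hor h by (auto simp: place_def)
      then have "k \<noteq> f t h \<or> k' \<noteq> f t (Suc h)" using T(2) f[OF t h] f[OF t h'(1)] by auto
      then show ?thesis
      proof
        assume "k \<noteq> f t h"
        then show ?thesis using Fam_hor t h k
          by (intro exI[of _ t] exI[of _ h] exI[of _ k]) (simp add: relation_def a_def)
      next
        assume "k' \<noteq> f t (Suc h)"
        then show ?thesis using Fam_hor t h' k
          by (intro exI[of _ t] exI[of _ "Suc h"] exI[of _ k']) (simp add: relation_def a_def)
      qed
    next
      case (Fam_ver k k')
      then have k: "k < ?k" "k' < ?k" using fam by (auto simp: families_def)
      have t': "Suc t < ?N" "\<not> ver M (gl ! k) (gl ! k')"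
        using forb Fam_ver t by (auto simp: place_def)
      then have "k \<noteq> f t h \<or> k' \<noteq> f (Suc t) h" using T(3) f[OF t h] f[OF t'(1) h] by auto
      then show ?thesis
      proof
        assume "k \<noteq> f t h"
        then show ?thesis using Fam_ver t h k
          by (intro exI[of _ t] exI[of _ h] exI[of _ k]) (simp add: relation_def a_def)
      next
        assume "k' \<noteq> f (Suc t) h"
        then show ?thesis using Fam_ver t' h k
          by (intro exI[of _ "Suc t"] exI[of _ h] exI[of _ k']) (simp add: relation_def a_def)
      qed
    qed
  qed
  then show ?L by (intro exI[of _ "grid ?k ?N a"]) simp
qed

section \<open>Nested loops by pebbles\<close>

lemma fout_append: "fout \<delta> q (xs @ ys) = fout \<delta> q xs @ fout \<delta> (fend \<delta> q xs) ys"
  by (induction xs arbitrary: q) auto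

definition single :: "'a set \<Rightarrow> 'a option list set" where
  "single A = (\<lambda>b. flat [b]) ` lists A"

lemma single_subset: "single A \<subseteq> lists (insert None (Some ` A))"
  by (auto simp: single_def)

lemma single_flat: "single A \<subseteq> flat ` lists (lists A)"
  unfolding single_def by (rule image_subsetI, rule imageI) simp

lemma singleI: "set b \<subseteq> A \<Longrightarrow> flat [b] \<in> single A"
  unfolding single_def by (rule imageI) auto

lemma lists_flat: "flat ` lists (lists A) \<subseteq> lists (insert None (Some ` A))"
proof (rule image_subsetI)
  fix bs assume "bs \<in> lists (lists A)"
  then show "flat bs \<in> lists (insert None (Some ` A))" by (induction bs) auto
qed

definition wrap :: "'a list \<Rightarrow> 'a option list" where "wrap xs = flat [xs]"

lemma fout_map:
  assumes "\<And>q a. snd (\<delta> q a) = [f a]"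
  shows "fout \<delta> q xs = map f xs"
  by (induction xs arbitrary: q) (simp_all add: assms)

lemma pf_wrap:
  assumes "finite A"
  shows "pf (lists A) wrap"
proof (rule pf_cong)
  show "pf (lists A) (frun (\<lambda>q a. (q, [Some a])) (\<lambda>_. [None]) ())"
    by (rule pf_frun[where A = A and Q = UNIV]) (use assms in auto)
qed (simp add: wrap_def frun_def fout_map[where f = Some])

definition pad :: "nat \<Rightarrow> bool list \<Rightarrow> nat option list" where
  "pad c x = flat [map bit_symbol x @ replicate c 0]"

lemma pf_pad: "pf UNIV (pad c)"
proof (rule pf_cong)
  show "pf UNIV (frun (\<lambda>q b. (q, [Some (bit_symbol b)])) (\<lambda>_. replicate c (Some 0) @ [None]) ())"
    by (rule pf_frun[where A = UNIV and Q = UNIV]) auto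
qed (simp add: pad_def frun_def fout_map[where f = "\<lambda>b. Some (bit_symbol b)"] comp_def)

section \<open>Squaring the length of a word\<close>

definition grown :: "'a \<Rightarrow> 'a list \<Rightarrow> 'a list" where
  "grown z b = b @ replicate (length b * length b - length b) z"

fun grow_step :: "'a \<Rightarrow> bool \<Rightarrow> ('a \<times> bool) option \<Rightarrow> bool \<times> 'a option list" where
  "grow_step z first (Some (x, _)) = (first, [Some (if first then x else z)])"
| "grow_step z first None = (False, [])"

text \<open>The marked copies of a word have the square of its length in total; the first copy is
  kept and the letters of all others become padding.\<close>

definition grow :: "'a \<Rightarrow> 'a option list \<Rightarrow> 'a option list" where
  "grow z xs = frun (grow_step z) (\<lambda>_. [None]) True (mark xs)"

lemma grow_block: "fout (grow_step z) first (map Some b) = map (\<lambda>x. Some (if first then fst x else z)) b \<and>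
   fend (grow_step z) first (map Some b) = first"
  by (induction b) auto

lemma grow_rest: "\<forall>b \<in> set bs. length b = n \<Longrightarrow>
    fout (grow_step z) False (flat bs) = replicate (length bs * n) (Some z)"
proof (induction bs)
  case (Cons b bs)
  then have "map (\<lambda>x. Some z) b = replicate n (Some z)" by (simp add: map_replicate_const)
  then show ?case using Cons by (simp add: fout_append grow_block replicate_add)
qed simp

lemma grow_single: "grow z (flat [b]) = flat [grown z b]"
proof (cases "marks b")
  case Nil
  then show ?thesis using length_marks(1)[of b] unfolding grow_def mark_flat by (simp add: frun_def grown_def)
next
  case (Cons m ms)
  have m: "map fst m = b"
  proof -
    have "b \<noteq> []" using Cons length_marks(1)[of b] by auto
    then have "m = map (\<lambda>i. (b ! i, i = 0)) [0..<length b]"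
      using Cons by (simp add: marks_conv upt_conv_Cons)
    then show ?thesis by (simp add: comp_def map_nth)
  qed
  have "length b = Suc (length ms)" using length_marks(1)[of b] Cons by simp
  then have "length ms * length b = length b * length b - length b" by simp
  moreover have "fout (grow_step z) False (flat ms) = replicate (length ms * length b) (Some z)"
    by (rule grow_rest) (use length_marks(2)[of _ b] Cons in auto)
  moreover have "map (\<lambda>x. Some (fst x)) m = map Some b" unfolding m[symmetric] by simp
  ultimately show ?thesis unfolding grow_def mark_flat
    by (simp add: frun_def Cons fout_append grow_block grown_def)
qed

lemma pf_marked: "finite A \<Longrightarrow> pf (single A) mark"
  by (rule pf_mono[OF pf_mark single_flat])

lemma mark_in: "bs \<in> lists (lists A) \<Longrightarrow> mark (flat bs) \<in> flat ` lists (lists (A \<times> UNIV))"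
proof -
  assume bs: "bs \<in> lists (lists A)"
  have "c \<in> lists (A \<times> UNIV)" if "c \<in> set (marks b)" "b \<in> lists A" for c b
    using that by (auto simp: marks_conv in_lists_conv_set)
  then have "concat (map marks bs) \<in> lists (lists (A \<times> UNIV))"
    using bs by (auto simp: in_lists_conv_set)
  then show ?thesis by simp
qed

lemma pf_grow:
  assumes "finite A"
  shows "pf (single A) (grow z)"
  unfolding grow_def
proof (rule pf_comp[OF pf_marked[OF assms]])
  show "pf (flat ` lists (lists (A \<times> (UNIV :: bool set)))) (frun (grow_step z) (\<lambda>_. [None]) True)"
    by (rule pf_frun[where Q = UNIV, OF _ lists_flat]) (use assms in auto)
  show "mark xs \<in> flat ` lists (lists (A \<times> UNIV))" if "xs \<in> single A" for xs
  proof -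
    obtain bs where "xs = flat bs" "bs \<in> lists (lists A)"
      using subsetD[OF single_flat \<open>xs \<in> single A\<close>] by blast
    then show ?thesis using mark_in by (simp only:)
  qed
qed

lemma pf_funpow:
  assumes "\<And>x. x \<in> D \<Longrightarrow> F x \<in> D" "pf D F" "pf D G" "\<And>x. x \<in> D \<Longrightarrow> G x = x"
  shows "pf D (F ^^ n)"
proof (induction n)
  case 0
  then show ?case using pf_cong[OF assms(3), of "\<lambda>x. x"] assms(4) by (simp add: id_def)
next
  case (Suc n)
  have "(F ^^ n) x \<in> D" if "x \<in> D" for x using that assms(1) by (induction n) auto
  from pf_comp[OF Suc assms(2) this] show ?case by simp
qed

lemma pf_ident:
  assumes "finite A" "D \<subseteq> lists A"
  shows "pf D (\<lambda>xs. xs)"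
proof (rule pf_cong)
  show "pf D (frun (\<lambda>q a. (q, [a])) (\<lambda>_. []) ())"
    by (rule pf_frun[where Q = UNIV, OF assms]) auto
qed (simp add: frun_def fout_map[where f = "\<lambda>a. a"])

lemma pf_grow_funpow:
  assumes "finite A" "z \<in> A"
  shows "pf (single A) (grow z ^^ e)"
proof (rule pf_funpow)
  show "pf (single A) (\<lambda>x. x)" by (rule pf_ident[OF _ single_subset]) (use assms in simp)
  show "grow z x \<in> single A" if "x \<in> single A" for x
  proof -
    obtain b where b: "x = flat [b]" "b \<in> lists A" using \<open>x \<in> single A\<close> by (auto simp only: single_def)
    show ?thesis unfolding b(1) grow_single by (rule singleI) (use b(2) assms(2) in \<open>auto simp: grown_def\<close>)
  qed
qed (use pf_grow assms in auto)

lemma grow_funpow: "(grow z ^^ e) (flat [b]) = flat [b @ replicate (length b ^ (2 ^ e) - length b) z]"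
proof (induction e)
  case (Suc e)
  let ?n = "length b ^ (2 ^ e)"
  have n: "length b \<le> ?n" by (cases "length b") (auto intro: self_le_power)
  have sq: "?n * ?n = length b ^ (2 ^ Suc e)" by (simp add: mult_2 power_add)
  have le: "?n \<le> ?n * ?n" by (rule le_square)
  have "grown z (b @ replicate (?n - length b) z) = b @ replicate (?n - length b + (?n * ?n - ?n)) z"
  proof -
    have "length (b @ replicate (?n - length b) z) = ?n" using n by simp
    then show ?thesis by (simp only: grown_def replicate_add append_assoc)
  qed
  also have "?n - length b + (?n * ?n - ?n) = length b ^ (2 ^ Suc e) - length b"
    unfolding sq[symmetric] using n le by simp
  finally show ?case using Suc by (simp only: funpow.simps comp_apply grow_single)
qed simp

section \<open>Words carrying pebbles\<close>

type_synonym cell = "(nat \<times> nat) \<times> bool list"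

text \<open>Positions are recorded only up to the cutoff \<open>K\<close> to keep the alphabet
  finite; the pebbles supply what else has to be known about them.\<close>

definition block :: "nat \<Rightarrow> nat list \<Rightarrow> nat list \<Rightarrow> cell list" where
  "block K w is = map (\<lambda>l. ((min l K, w ! l), map (\<lambda>i. l = i) is)) [0..<length w]"

fun index_step :: "nat \<Rightarrow> nat \<Rightarrow> nat option \<Rightarrow> nat \<times> cell option list" where
  "index_step K i (Some a) = (min (Suc i) K, [Some ((i, a), [])])"
| "index_step K i None = (i, [None])"

lemma index_run:
  "fout (index_step K) (min m K) (map Some w) = map (\<lambda>l. Some ((min (m + l) K, w ! l), [])) [0..<length w]"
proof (induction w arbitrary: m)
  case (Cons a w)
  have "min (Suc (min m K)) K = min (Suc m) K" by simp
  then have "fout (index_step K) (min m K) (map Some (a # w)) =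
     Some ((min m K, a), []) # fout (index_step K) (min (Suc m) K) (map Some w)" by simp
  also have "\<dots> = map (\<lambda>l. Some ((min (m + l) K, (a # w) ! l), [])) (0 # map Suc [0..<length w])"
    unfolding Cons.IH by simp
  also have "0 # map Suc [0..<length w] = [0..<length (a # w)]" by (simp add: map_Suc_upt upt_conv_Cons del: upt_Suc)
  finally show ?case .
qed simp

definition index :: "nat \<Rightarrow> nat option list \<Rightarrow> cell option list" where
  "index K = frun (index_step K) (\<lambda>_. []) 0"

lemma index_single: "index K (flat [w]) = flat [block K w []]"
  using index_run[of K 0 w] by (simp add: index_def frun_def fout_append block_def)

lemma pf_index: "finite A \<Longrightarrow> pf (single A) (index K)"
  unfolding index_def
  by (rule pf_frun[where Q = "{..K}", OF _ single_subset]) auto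

fun relabel_step :: "unit \<Rightarrow> (cell \<times> bool) option \<Rightarrow> unit \<times> cell option list" where
  "relabel_step q (Some ((c, fl), b)) = (q, [Some (c, b # fl)])"
| "relabel_step q None = (q, [None])"

text \<open>The new flag goes in front of the old ones, so the pebble placed last has number 0 and
  belongs to the innermost loop. The order of \<open>tup\<close> agrees with this.\<close>

definition pebble :: "cell option list \<Rightarrow> cell option list" where
  "pebble xs = frun relabel_step (\<lambda>_. []) () (mark xs)"

definition pebbles :: "cell list \<Rightarrow> cell list list" where
  "pebbles b = map (map (\<lambda>((c, fl), m). (c, m # fl))) (marks b)"

lemma relabel_flat: "fout relabel_step () (flat bs) = flat (map (map (\<lambda>((c, fl), m). (c, m # fl))) bs)"
proof (induction bs)
  case (Cons b bs)
  have "fout relabel_step () (map Some b) = map Some (map (\<lambda>((c, fl), m). (c, m # fl)) b)" for b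
    by (induction b) auto
  then show ?case using Cons by (simp add: fout_append)
qed simp

lemma pebble_flat: "pebble (flat bs) = flat (concat (map pebbles bs))"
  by (simp add: pebble_def frun_def relabel_flat pebbles_def[abs_def] map_concat comp_def)

definition cells :: "nat \<Rightarrow> nat \<Rightarrow> nat set \<Rightarrow> cell set" where
  "cells d K A = ({..K} \<times> A) \<times> {fl. set fl \<subseteq> UNIV \<and> length fl = d}"

lemma finite_cells: "finite A \<Longrightarrow> finite (cells d K A)"
  unfolding cells_def by (intro finite_cartesian_product finite_lists_length_eq) auto

lemma pf_pebble: "finite A \<Longrightarrow> pf (flat ` lists (lists (cells d K A))) pebble"
  unfolding pebble_def
proof (rule pf_comp[OF pf_mark])
  assume A: "finite A"
  show "finite (cells d K A)" using A by (rule finite_cells)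
  show "pf (flat ` lists (lists (cells d K A \<times> (UNIV :: bool set)))) (frun relabel_step (\<lambda>_. []) ())"
    by (rule pf_frun[where Q = UNIV, OF _ lists_flat]) (use A finite_cells in auto)
  show "mark xs \<in> flat ` lists (lists (cells d K A \<times> UNIV))" if "xs \<in> flat ` lists (lists (cells d K A))" for xs
    using that mark_in by (auto simp del: mark_flat)
qed

fun tup :: "nat \<Rightarrow> nat \<Rightarrow> nat list list" where
  "tup N 0 = [[]]"
| "tup N (Suc d) = concat (map (\<lambda>is. map (\<lambda>j. j # is) [0..<N]) (tup N d))"

lemma pebbles_block: "pebbles (block K w is) = map (\<lambda>j. block K w (j # is)) [0..<length w]"
  by (auto simp: pebbles_def marks_conv block_def)

lemma pebble_funpow: "(pebble ^^ d) (flat [block K w []]) = flat (map (block K w) (tup (length w) d))"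
proof (induction d)
  case (Suc d)
  then show ?case by (simp add: pebble_flat map_concat comp_def pebbles_block)
qed simp

lemma pebbles_conv: "pebbles b =
    map (\<lambda>j. map (\<lambda>i. (fst (b ! i), (i = j) # snd (b ! i))) [0..<length b]) [0..<length b]"
  by (simp add: pebbles_def marks_conv split_beta comp_def)

lemma pf_pebble_funpow:
  assumes "finite A"
  shows "pf (flat ` lists (lists (cells 0 K A))) (pebble ^^ d) \<and>
    (\<forall>xs \<in> flat ` lists (lists (cells 0 K A)). (pebble ^^ d) xs \<in> flat ` lists (lists (cells d K A)))"
proof (induction d)
  case 0
  have "pf (flat ` lists (lists (cells 0 K A))) (\<lambda>xs. xs)"
    by (rule pf_ident[OF _ lists_flat]) (use assms finite_cells in simp)
  then show ?case by (simp add: id_def)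
next
  case (Suc d)
  have "pebble xs \<in> flat ` lists (lists (cells (Suc d) K A))" if xs: "xs \<in> flat ` lists (lists (cells d K A))" for xs
  proof -
    obtain bs where bs: "xs = flat bs" "bs \<in> lists (lists (cells d K A))" using xs by blast
    have "c \<in> lists (cells (Suc d) K A)" if "c \<in> set (pebbles b)" "b \<in> lists (cells d K A)" for b c
    proof -
      obtain j where c: "c = map (\<lambda>i. (fst (b ! i), (i = j) # snd (b ! i))) [0..<length b]"
        using \<open>c \<in> set (pebbles b)\<close> by (auto simp: pebbles_conv)
      have "b ! i \<in> cells d K A" if "i < length b" for i
        using \<open>b \<in> lists (cells d K A)\<close> that by (auto simp: in_lists_conv_set)
      then have "(fst (b ! i), (i = j) # snd (b ! i)) \<in> cells (Suc d) K A" if "i < length b" for i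
        using that by (fastforce simp: cells_def)
      then show ?thesis by (auto simp: c)
    qed
    then have "concat (map pebbles bs) \<in> lists (lists (cells (Suc d) K A))"
      using bs(2) by (auto simp: in_lists_conv_set)
    then show ?thesis unfolding bs(1) pebble_flat by blast
  qed
  moreover have "pf (flat ` lists (lists (cells 0 K A))) (\<lambda>xs. pebble ((pebble ^^ d) xs))"
    by (rule pf_comp[OF conjunct1[OF Suc] pf_pebble[OF assms]]) (use Suc in blast)
  moreover have "pebble ^^ Suc d = (\<lambda>xs. pebble ((pebble ^^ d) xs))" by (simp add: comp_def)
  ultimately show ?case using conjunct2[OF Suc] by (simp del: funpow.simps)
qed

section \<open>Evaluating a block with finite memory\<close>

text \<open>A block exceeds every finite memory, but the set of its adjacent pairs, with
  \<open>None\<close> beyond both ends, does not; coincidence and succession of pebbles and the end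
  of the word can be read off it.\<close>

fun adj :: "'c option \<Rightarrow> 'c list \<Rightarrow> ('c option \<times> 'c option) set" where
  "adj p [] = {(p, None)}"
| "adj p (c # cs) = insert (p, Some c) (adj (Some c) cs)"

fun blockwise_step :: "(('c option \<times> 'c option) set \<Rightarrow> 'b list) \<Rightarrow> 'c option \<times> ('c option \<times> 'c option) set \<Rightarrow>
    'c option \<Rightarrow> ('c option \<times> ('c option \<times> 'c option) set) \<times> 'b list" where
  "blockwise_step g (p, S) (Some c) = ((Some c, insert (p, Some c) S), [])"
| "blockwise_step g (p, S) None = ((None, {}), g (insert (p, None) S))"

definition blockwise :: "(('c option \<times> 'c option) set \<Rightarrow> 'b list) \<Rightarrow> 'c option list \<Rightarrow> 'b list" where
  "blockwise g = frun (blockwise_step g) (\<lambda>_. []) (None, {})"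

lemma blockwise_block:
  "fout (blockwise_step g) (p, S) (map Some b @ None # xs) =
    g (S \<union> adj p b) @ fout (blockwise_step g) (None, {}) xs"
  by (induction b arbitrary: p S) auto

lemma blockwise_flat: "blockwise g (flat bs) = concat (map (\<lambda>b. g (adj None b)) bs)"
proof -
  have "fout (blockwise_step g) (None, {}) (flat bs) = concat (map (\<lambda>b. g (adj None b)) bs)"
    by (induction bs) (simp_all add: blockwise_block)
  then show ?thesis by (simp add: blockwise_def frun_def)
qed

lemma pf_blockwise:
  fixes A :: "'c :: countable set" and g :: "_ \<Rightarrow> 'b :: countable list"
  assumes "finite A"
  shows "pf (flat ` lists (lists A)) (blockwise g)"
proof -
  let ?A = "insert None (Some ` A)"
  show ?thesis unfolding blockwise_def
  proof (rule pf_frun[where Q = "?A \<times> Pow (?A \<times> ?A)", OF _ lists_flat])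
    show "fst (blockwise_step g q a) \<in> ?A \<times> Pow (?A \<times> ?A)" if "q \<in> ?A \<times> Pow (?A \<times> ?A)" "a \<in> ?A" for q a
      using that by (cases q; cases a) auto
  qed (use assms in auto)
qed

lemma adj_current: "(\<exists>x c. (x, Some c) \<in> adj p b \<and> P c) \<longleftrightarrow> (\<exists>c \<in> set b. P c)"
proof (induction b arbitrary: p)
  case (Cons d b)
  have "(\<exists>x c. (x, Some c) \<in> adj p (d # b) \<and> P c) \<longleftrightarrow>
      P d \<or> (\<exists>x c. (x, Some c) \<in> adj (Some d) b \<and> P c)" by auto
  then show ?case unfolding Cons.IH by simp
qed simp

lemma adj_last: "(\<exists>c. (Some c, None) \<in> adj p b \<and> P c) \<longleftrightarrow>
    (if b = [] then \<exists>c. p = Some c \<and> P c else P (last b))"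
  by (induction b arbitrary: p) auto

lemma adj_successive: "(\<exists>c c'. (Some c, Some c') \<in> adj p b \<and> P c c') \<longleftrightarrow>
    (let b' = (case p of None \<Rightarrow> b | Some c \<Rightarrow> c # b) in \<exists>l. Suc l < length b' \<and> P (b' ! l) (b' ! Suc l))"
proof (induction b arbitrary: p)
  case (Cons d b)
  have shift: "(\<exists>l. Suc l < length (c # d # b) \<and> P ((c # d # b) ! l) ((c # d # b) ! Suc l)) \<longleftrightarrow>
      P c d \<or> (\<exists>l. Suc l < length (d # b) \<and> P ((d # b) ! l) ((d # b) ! Suc l))" for c
  proof
    assume "\<exists>l. Suc l < length (c # d # b) \<and> P ((c # d # b) ! l) ((c # d # b) ! Suc l)"
    then obtain l where "Suc l < length (c # d # b)" "P ((c # d # b) ! l) ((c # d # b) ! Suc l)" by blast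
    then show "P c d \<or> (\<exists>l. Suc l < length (d # b) \<and> P ((d # b) ! l) ((d # b) ! Suc l))"
      by (cases l) auto
  next
    assume "P c d \<or> (\<exists>l. Suc l < length (d # b) \<and> P ((d # b) ! l) ((d # b) ! Suc l))"
    then show "\<exists>l. Suc l < length (c # d # b) \<and> P ((c # d # b) ! l) ((c # d # b) ! Suc l)"
    proof
      assume "P c d"
      then show ?thesis by (intro exI[of _ 0]) simp
    next
      assume "\<exists>l. Suc l < length (d # b) \<and> P ((d # b) ! l) ((d # b) ! Suc l)"
      then obtain l where "Suc l < length (d # b)" "P ((d # b) ! l) ((d # b) ! Suc l)" by blast
      then show ?thesis by (intro exI[of _ "Suc l"]) simp
    qed
  qed
  have IH: "(\<exists>c c'. (Some c, Some c') \<in> adj (Some d) b \<and> P c c') \<longleftrightarrow>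
      (\<exists>l. Suc l < length (d # b) \<and> P ((d # b) ! l) ((d # b) ! Suc l))"
    using Cons.IH[of "Some d"] by (simp add: Let_def del: length_Cons nth_Cons_Suc)
  show ?case
  proof (cases p)
    case None
    then have "(\<exists>c c'. (Some c, Some c') \<in> adj p (d # b) \<and> P c c') \<longleftrightarrow> (\<exists>c c'. (Some c, Some c') \<in> adj (Some d) b \<and> P c c')" by simp
    then show ?thesis unfolding IH using None by (simp add: Let_def)
  next
    case (Some c)
    then have "(\<exists>c c'. (Some c, Some c') \<in> adj p (d # b) \<and> P c c') \<longleftrightarrow>
        P c d \<or> (\<exists>c c'. (Some c, Some c') \<in> adj (Some d) b \<and> P c c')" by auto
    then show ?thesis unfolding IH using Some shift[of c] by (simp add: Let_def)
  qed
qed (simp split: option.split)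

section \<open>Generating the items\<close>

datatype isym = It bool bool | End_mark | TA | TB | Blank

instance isym :: countable by countable_datatype

lemma finite_isym: "finite (UNIV :: isym set)"
proof -
  have "x \<in> (\<lambda>(l, c). It l c) ` UNIV \<union> {End_mark, TA, TB, Blank}" for x
    by (cases x) (auto simp: image_iff)
  then have "(UNIV :: isym set) \<subseteq> (\<lambda>(l, c). It l c) ` UNIV \<union> {End_mark, TA, TB, Blank}" by blast
  then show ?thesis by (rule finite_subset) simp
qed

definition its :: "item list \<Rightarrow> isym list" where "its = map (\<lambda>(l, c). It l c)"

lemma its_simps [simp]: "its [] = []" "its (xs @ ys) = its xs @ its ys" "its (concat xss) = concat (map its xss)"
  by (simp_all add: its_def map_concat)

type_synonym links = "(cell option \<times> cell option) set"

text \<open>In a block pebble \<open>j\<close> lies on exactly one cell, hence the definite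
  description.\<close>

definition val_at :: "links \<Rightarrow> nat \<Rightarrow> nat" where
  "val_at S j = (THE v. \<exists>x c. (x, Some c) \<in> S \<and> snd c ! j \<and> fst (fst c) = v)"
definition sym_at :: "links \<Rightarrow> nat \<Rightarrow> nat" where
  "sym_at S j = (THE v. \<exists>x c. (x, Some c) \<in> S \<and> snd c ! j \<and> snd (fst c) = v)"
definition last_at :: "links \<Rightarrow> nat \<Rightarrow> bool" where
  "last_at S j \<longleftrightarrow> (\<exists>c. (Some c, None) \<in> S \<and> snd c ! j)"
definition same_at :: "links \<Rightarrow> nat \<Rightarrow> nat \<Rightarrow> bool" where
  "same_at S i j \<longleftrightarrow> (\<exists>x c. (x, Some c) \<in> S \<and> snd c ! i \<and> snd c ! j)"
definition next_at :: "links \<Rightarrow> nat \<Rightarrow> nat \<Rightarrow> bool" where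
  "next_at S i j \<longleftrightarrow> (\<exists>c c'. (Some c, Some c') \<in> S \<and> snd c ! i \<and> snd c' ! j)"

lemma links_block:
  assumes "w \<noteq> []" "length is = 8" "\<forall>x \<in> set is. x < length w" "i < 8" "j < 8"
  shows "val_at (adj None (block K w is)) j = min (is ! j) K"
    "sym_at (adj None (block K w is)) j = w ! (is ! j)"
    "last_at (adj None (block K w is)) j \<longleftrightarrow> Suc (is ! j) = length w"
    "same_at (adj None (block K w is)) i j \<longleftrightarrow> is ! i = is ! j"
    "next_at (adj None (block K w is)) i j \<longleftrightarrow> is ! j = Suc (is ! i)"
proof -
  have b: "length (block K w is) = length w" "block K w is \<noteq> []"
    "\<And>l. l < length w \<Longrightarrow> block K w is ! l = ((min l K, w ! l), map (\<lambda>i. l = i) is)"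
    using assms(1) by (auto simp: block_def)
  have set: "set (block K w is) = (\<lambda>l. ((min l K, w ! l), map (\<lambda>i. l = i) is)) ` {..<length w}"
    by (auto simp: block_def)
  have ij: "is ! i < length w" "is ! j < length w" using assms by auto
  have cur: "(\<exists>x c. (x, Some c) \<in> adj None (block K w is) \<and> snd c ! j \<and> P c) \<longleftrightarrow>
      P ((min (is ! j) K, w ! (is ! j)), map (\<lambda>i. is ! j = i) is)" for P
    unfolding adj_current[of None "block K w is" "\<lambda>c. snd c ! j \<and> P c"] set using ij assms by auto
  show "val_at (adj None (block K w is)) j = min (is ! j) K" unfolding val_at_def cur by simp
  show "sym_at (adj None (block K w is)) j = w ! (is ! j)" unfolding sym_at_def cur by simp
  show "last_at (adj None (block K w is)) j \<longleftrightarrow> Suc (is ! j) = length w"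
    unfolding last_at_def adj_last using b assms ij by (cases "length w") (auto simp: last_conv_nth)
  show "same_at (adj None (block K w is)) i j \<longleftrightarrow> is ! i = is ! j"
    using cur[of "\<lambda>c. snd c ! i"] assms by (auto simp: same_at_def conj_commute)
  show "next_at (adj None (block K w is)) i j \<longleftrightarrow> is ! j = Suc (is ! i)"
    
    unfolding next_at_def adj_successive using b assms(2,4,5) ij by (auto simp: Let_def intro!: exI[of _ "is ! i"])
qed

text \<open>
  The pebbles are, from the innermost to the outermost loop: column and row of the variable
  (0, 1), three pebbles (2, 3, 4) that only serve to repeat the frame, column and row of
  the clause (5, 6), and the family of the clause (7).
\<close>

definition emission :: "tm \<Rightarrow> tile list \<Rightarrow> (nat \<Rightarrow> nat) \<Rightarrow> (nat \<Rightarrow> bool) \<Rightarrow> (nat \<Rightarrow> nat \<Rightarrow> bool) \<Rightarrow>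
    (nat \<Rightarrow> nat \<Rightarrow> bool) \<Rightarrow> nat \<Rightarrow> isym list" where
  "emission M gl v l eq succ a =
    (let \<kappa> = length gl; fams = families \<kappa>; \<phi> = length fams; f = v 7;
         first = (v 0 = 0 \<and> v 1 = 0); final = (l 0 \<and> l 1); spare = (v 2 = 0 \<and> v 3 = 0 \<and> v 4 = 0)
     in if f = 0 then (if first then its (forced key) else []) @ its (wilds \<kappa>) @ (if final then its wild else [])
        else if f \<le> \<phi> then
          if spare then
            (if first then its (clause_start (forbids M gl (fams ! (f - 1)) (v 6 = 0, l 6, v 5 = 0, l 5, a))) else []) @
            its (concat (map (\<lambda>k. gadget (literal (fams ! (f - 1)) (eq 1 6, succ 6 1, eq 0 5, succ 5 0) k)) [0..<\<kappa>])) @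
            (if final then its ending else [])
          else []
        else if f = \<phi> + 1 then
          if spare \<and> v 5 = 0 \<and> v 6 = 0 then (if first then [End_mark, TA, TA, TA] else []) @ replicate \<kappa> TA else []
        else if f = \<phi> + 2 then
          if first then replicate (if spare then \<phi> + 1 else 1) TB else []
        else [])"

definition emit_links :: "tm \<Rightarrow> tile list \<Rightarrow> links \<Rightarrow> isym list" where
  "emit_links M gl S = emission M gl (val_at S) (last_at S) (same_at S) (next_at S) (sym_at S 5)"

definition emit_tuple :: "tm \<Rightarrow> tile list \<Rightarrow> nat list \<Rightarrow> nat list \<Rightarrow> isym list" where
  "emit_tuple M gl w is = emission M gl (\<lambda>j. min (is ! j) (length (families (length gl)) + 3))
     (\<lambda>j. Suc (is ! j) = length w) (\<lambda>i j. is ! i = is ! j) (\<lambda>i j. is ! j = Suc (is ! i)) (w ! (is ! 5))"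

lemma emission_cong:
  assumes "\<And>j. j < 8 \<Longrightarrow> v j = v' j" "\<And>j. j < 8 \<Longrightarrow> l j = l' j" "\<And>i j. i < 8 \<Longrightarrow> j < 8 \<Longrightarrow> eq i j = eq' i j"
    "\<And>i j. i < 8 \<Longrightarrow> j < 8 \<Longrightarrow> succ i j = succ' i j"
  shows "emission M gl v l eq succ a = emission M gl v' l' eq' succ' a"
proof -
  have "v 0 = v' 0" "v 1 = v' 1" "v 2 = v' 2" "v 3 = v' 3" "v 4 = v' 4" "v 5 = v' 5" "v 6 = v' 6" "v 7 = v' 7"
    "l 0 = l' 0" "l 1 = l' 1" "l 5 = l' 5" "l 6 = l' 6" "eq 1 6 = eq' 1 6" "eq 0 5 = eq' 0 5"
    "succ 6 1 = succ' 6 1" "succ 5 0 = succ' 5 0"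
    by (simp_all add: assms)
  then show ?thesis unfolding emission_def by (simp only:)
qed

lemma emit_links_block:
  assumes "w \<noteq> []" "length is = 8" "\<forall>x \<in> set is. x < length w"
  shows "emit_links M gl (adj None (block (length (families (length gl)) + 3) w is)) = emit_tuple M gl w is"
  unfolding emit_links_def emit_tuple_def
  by (subst links_block(2)[OF assms, of 0 5])
    (auto intro!: emission_cong simp: links_block(1,3)[OF assms, of 0] links_block(4,5)[OF assms])

section \<open>Loops over index tuples\<close>

lemma concat_map_nested: "concat (map (\<lambda>x. f x) (concat xss)) = concat (map (\<lambda>xs. concat (map f xs)) xss)"
  by (induction xss) simp_all

lemma concat_concat: "concat (concat xss) = concat (map concat xss)"
  by (induction xss) simp_all

lemma tup_add: "tup N (a + b) = concat (map (\<lambda>js. map (\<lambda>es. es @ js) (tup N a)) (tup N b))"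
proof (induction a)
  case 0
  then show ?case by simp
next
  case (Suc a)
  then show ?case by (simp add: map_concat concat_concat comp_def concat_map_nested)
qed

lemma length_tup: "length (tup N d) = N ^ d"
  by (induction d) (simp_all add: length_concat comp_def map_replicate_const sum_list_replicate)

lemma set_tup: "set (tup N d) = {is. length is = d \<and> set is \<subseteq> {..<N}}"
proof (induction d)
  case (Suc d)
  show ?case
  proof (rule set_eqI)
    fix js
    show "js \<in> set (tup N (Suc d)) \<longleftrightarrow> js \<in> {is. length is = Suc d \<and> set is \<subseteq> {..<N}}"
      using Suc by (cases js) auto
  qed
qed auto

lemma distinct_tup: "distinct (tup N d)"
proof (rule card_distinct)
  have "set (tup N d) = {is. set is \<subseteq> {..<N} \<and> length is = d}" by (auto simp: set_tup)
  then show "card (set (tup N d)) = length (tup N d)"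
    by (simp only: card_lists_length_eq finite_lessThan length_tup card_lessThan)
qed

lemma hd_tup: "0 < N \<Longrightarrow> hd (tup N d) = replicate d 0 \<and> tup N d \<noteq> []"
proof (induction d)
  case (Suc d)
  then obtain r where "tup N d = replicate d 0 # r" by (cases "tup N d") auto
  then show ?case using Suc.prems by (simp add: upt_conv_Cons)
qed simp

lemma last_tup: "0 < N \<Longrightarrow> last (tup N d) = replicate d (N - 1)"
proof (induction d)
  case (Suc d)
  then obtain r where r: "tup N d = r @ [replicate d (N - 1)]"
    using hd_tup[of N d] by (metis append_butlast_last_id)
  obtain N' where "N = Suc N'" using Suc.prems by (cases N) auto
  then show ?case using r by simp
qed simp

text \<open>A loop body that prints a prologue in its first round and an epilogue in its last;
  distinctness makes each test succeed just once.\<close>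

lemma concat_first_last:
  assumes "distinct xs" "xs \<noteq> []"
  shows "concat (map (\<lambda>x. (if x = hd xs then A else []) @ B x @ (if x = last xs then C else [])) xs) =
    A @ concat (map B xs) @ C"
proof -
  have last: "concat (map (\<lambda>x. B x @ (if x = last xs then C else [])) xs) = concat (map B xs) @ C"
    if "distinct xs" "xs \<noteq> []" for B xs
  proof -
    obtain ys y where xs: "xs = ys @ [y]" using \<open>xs \<noteq> []\<close> by (metis append_butlast_last_id)
    then have "map (\<lambda>x. B x @ (if x = y then C else [])) ys = map B ys" using \<open>distinct xs\<close> by (auto simp: xs)
    then have "concat (map (\<lambda>x. B x @ (if x = y then C else [])) ys) = concat (map B ys)" by (rule arg_cong)
    then show ?thesis by (simp add: xs)
  qed
  obtain y ys where xs: "xs = y # ys" using assms(2) by (cases xs) auto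
  have "concat (map (\<lambda>x. ((if x = hd xs then A else []) @ B x) @ (if x = last xs then C else [])) xs) =
     concat (map (\<lambda>x. (if x = hd xs then A else []) @ B x) xs) @ C"
    by (rule last[OF assms])
  also have "map (\<lambda>x. (if x = y then A else []) @ B x) ys = map B ys" using assms(1) xs by auto
  then have "concat (map (\<lambda>x. (if x = y then A else []) @ B x) ys) = concat (map B ys)" by (rule arg_cong)
  then have "concat (map (\<lambda>x. (if x = hd xs then A else []) @ B x) xs) = A @ concat (map B xs)" by (simp add: xs)
  finally show ?thesis by simp
qed

lemma concat_only_first:
  assumes "distinct xs" "xs \<noteq> []"
  shows "concat (map (\<lambda>x. if x = hd xs then A else []) xs) = A"
proof -
  have "(\<lambda>x. if x = hd xs then A else []) = (\<lambda>x. (if x = hd xs then A else []) @ [] @ (if x = last xs then [] else []))"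
    by auto
  moreover have "concat (map (\<lambda>x. []) xs) = []" by simp
  ultimately show ?thesis using concat_first_last[OF assms, of A "\<lambda>_. []" "[]"] by simp
qed

lemma grid_tup: "grid \<kappa> N f = concat (map (\<lambda>xs. map (f (xs ! 1) (xs ! 0)) [0..<\<kappa>]) (tup N 2))"
  by (simp add: grid_def numeral_2_eq_2 map_concat concat_concat comp_def)

lemma wilds_concat: "concat (map (\<lambda>_. wilds k) xs) = wilds (length xs * k)"
proof -
  have "wilds (a + b) = wilds a @ wilds b" for a b by (simp add: wilds_def replicate_add)
  then show ?thesis by (induction xs) (simp_all add: wilds_def)
qed

lemma concat_replicate: "concat (map (\<lambda>_. replicate k a) xs) = replicate (length xs * k) a"
  by (induction xs) (simp_all add: replicate_add)

section \<open>The emitted word\<close>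

definition all_clauses :: "tm \<Rightarrow> tile list \<Rightarrow> nat list \<Rightarrow> (bool \<times> bool option list) list" where
  "all_clauses M gl w = concat (map (\<lambda>fam. map (\<lambda>b. grid_clause M gl w fam (b ! 1) (b ! 0)) (tup (length w) 2))
     (families (length gl)))"

text \<open>\<open>TA\<close> and \<open>TB\<close> count the piles of the second and third round:
  \<open>n + 3\<close> for \<open>n = N\<^sup>2 * \<kappa>\<close> variables, and frames plus
  clauses. There have to be at least \<open>6 * (n + 3)\<close> frames for each of the
  \<open>\<phi> * N\<^sup>2\<close> clauses; that is at most a constant times \<open>N ^ 4\<close>,
  hence the exponent 5.\<close>

definition program :: "tm \<Rightarrow> tile list \<Rightarrow> nat list \<Rightarrow> isym list" where
  "program M gl w = (let N = length w; \<kappa> = length gl; \<phi> = length (families \<kappa>) in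
     its (frames (N ^ 5) (N\<^sup>2 * \<kappa> + 1)) @ its (clauses (all_clauses M gl w)) @
     End_mark # replicate (N\<^sup>2 * \<kappa> + 3) TA @ replicate (N ^ 5 + \<phi> * N\<^sup>2) TB)"

context
  fixes M :: tm and gl :: "tile list" and w :: "nat list" and N \<kappa> \<phi> :: nat
  defines "N \<equiv> length w" and "\<kappa> \<equiv> length gl" and "\<phi> \<equiv> length (families \<kappa>)"
  assumes N: "\<phi> + 3 \<le> N"
begin

lemma N_pos: "0 < N"
  using N by simp

definition inner :: "nat list \<Rightarrow> isym list" where
  "inner js = concat (map (\<lambda>xs. emit_tuple M gl w (xs @ js)) (tup N 2))"

lemma emit_concat: "concat (map (emit_tuple M gl w) (tup N 8)) =
    concat (map (\<lambda>f. concat (map (\<lambda>es. inner (es @ [f])) (tup N 5))) [0..<N])"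
proof -
  have "tup N 8 = concat (map (\<lambda>js. map (\<lambda>es. es @ js) (tup N 2)) (tup N 6))"
    using tup_add[of N 2 6] by simp
  moreover have "tup N 6 = concat (map (\<lambda>f. map (\<lambda>es. es @ [f]) (tup N 5)) [0..<N])"
    using tup_add[of N 5 1] by (simp add: comp_def)
  ultimately show ?thesis by (simp add: map_concat concat_concat comp_def inner_def concat_map_nested)
qed

lemma first_last_2:
  assumes "xs \<in> set (tup N 2)"
  shows "xs ! 0 = 0 \<and> xs ! 1 = 0 \<longleftrightarrow> xs = hd (tup N 2)"
    "Suc (xs ! 0) = N \<and> Suc (xs ! 1) = N \<longleftrightarrow> xs = last (tup N 2)"
    "\<exists>h t. xs = [h, t]"
proof -
  obtain h t where xs: "xs = [h, t]" using assms by (auto simp: set_tup length_Suc_conv numeral_2_eq_2)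
  show "\<exists>h t. xs = [h, t]" using xs by blast
  show "xs ! 0 = 0 \<and> xs ! 1 = 0 \<longleftrightarrow> xs = hd (tup N 2)"
    using hd_tup[OF N_pos, of 2] by (auto simp: xs numeral_2_eq_2)
  show "Suc (xs ! 0) = N \<and> Suc (xs ! 1) = N \<longleftrightarrow> xs = last (tup N 2)"
    using last_tup[OF N_pos, of 2] N_pos by (auto simp: xs numeral_2_eq_2)
qed

lemma loop_2: "concat (map (\<lambda>xs. (if xs ! 0 = 0 \<and> xs ! 1 = 0 then A else []) @ B xs @
      (if Suc (xs ! 0) = N \<and> Suc (xs ! 1) = N then C else [])) (tup N 2)) =
    A @ concat (map B (tup N 2)) @ C"
proof -
  have "map (\<lambda>xs. (if xs ! 0 = 0 \<and> xs ! 1 = 0 then A else []) @ B xs @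
      (if Suc (xs ! 0) = N \<and> Suc (xs ! 1) = N then C else [])) (tup N 2) =
    map (\<lambda>xs. (if xs = hd (tup N 2) then A else []) @ B xs @ (if xs = last (tup N 2) then C else [])) (tup N 2)"
    by (rule map_cong[OF refl]) (simp only: first_last_2)
  then show ?thesis using concat_first_last[OF distinct_tup, of N 2 A B C] hd_tup[OF N_pos, of 2] by (simp only:) blast
qed

lemma emit_at:
  assumes "xs \<in> set (tup N 2)" "es = [e0, e1, e2, h, t]"
  shows "emit_tuple M gl w (xs @ es @ [f]) =
    (let f = min f (\<phi> + 3) in if f = 0 then (if xs ! 0 = 0 \<and> xs ! 1 = 0 then its (forced key) else []) @ its (wilds \<kappa>) @
       (if Suc (xs ! 0) = N \<and> Suc (xs ! 1) = N then its wild else [])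
     else if f \<le> \<phi> then
       if e0 = 0 \<and> e1 = 0 \<and> e2 = 0 then
         (if xs ! 0 = 0 \<and> xs ! 1 = 0 then its (clause_start (forbids M gl (families \<kappa> ! (f - 1)) (place w t h))) else []) @
         its (concat (map (\<lambda>k. gadget (literal (families \<kappa> ! (f - 1)) (relation t h (xs ! 1) (xs ! 0)) k)) [0..<\<kappa>])) @
         (if Suc (xs ! 0) = N \<and> Suc (xs ! 1) = N then its ending else [])
       else []
     else if f = \<phi> + 1 then
       if e0 = 0 \<and> e1 = 0 \<and> e2 = 0 \<and> h = 0 \<and> t = 0 then (if xs ! 0 = 0 \<and> xs ! 1 = 0 then [End_mark, TA, TA, TA] else []) @ replicate \<kappa> TA
       else []
     else if f = \<phi> + 2 then
       if xs ! 0 = 0 \<and> xs ! 1 = 0 then replicate (if e0 = 0 \<and> e1 = 0 \<and> e2 = 0 then \<phi> + 1 else 1) TB else []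
     else [])"
proof -
  obtain x y where xs: "xs = [x, y]" using first_last_2(3)[OF assms(1)] by blast
  have zero: "min a (\<phi> + 3) = 0 \<longleftrightarrow> a = 0" for a by (simp add: min_def)
  have nth: "(xs @ es @ [f]) ! 0 = x" "(xs @ es @ [f]) ! 1 = y" "(xs @ es @ [f]) ! 2 = e0" "(xs @ es @ [f]) ! 3 = e1"
    "(xs @ es @ [f]) ! 4 = e2" "(xs @ es @ [f]) ! 5 = h" "(xs @ es @ [f]) ! 6 = t" "(xs @ es @ [f]) ! 7 = f"
    "xs ! 0 = x" "xs ! 1 = y"
    by (simp_all add: xs assms(2))
  show ?thesis
    unfolding emit_tuple_def emission_def Let_def nth place_def relation_def
    by (simp only: N_def[symmetric] \<kappa>_def[symmetric] \<phi>_def[symmetric] zero nth conj_assoc)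
qed

text \<open>The outermost index \<open>f\<close> selects the part of the output: frames for 0, a
  clause family for 1 to \<open>\<phi>\<close>, tags for the next two, nothing beyond. A frame needs
  one wild piece more than there are variables, which the last round of the loop supplies.\<close>

lemma inner_eq:
  assumes "es = [e0, e1, e2, h, t]"
  shows "inner (es @ [f]) =
    (if f = 0 then its (frame (N\<^sup>2 * \<kappa> + 1))
     else if f \<le> \<phi> then
       if e0 = 0 \<and> e1 = 0 \<and> e2 = 0 then its (clause (grid_clause M gl w (families \<kappa> ! (f - 1)) t h)) else []
     else if f = \<phi> + 1 then
       if e0 = 0 \<and> e1 = 0 \<and> e2 = 0 \<and> h = 0 \<and> t = 0 then End_mark # replicate (N\<^sup>2 * \<kappa> + 3) TA else []
     else if f = \<phi> + 2 then replicate (if e0 = 0 \<and> e1 = 0 \<and> e2 = 0 then \<phi> + 1 else 1) TB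
     else [])"
proof -
  let ?T = "tup N 2"
  have cong: "inner (es @ [f]) = concat (map G ?T)"
    if "\<And>xs. xs \<in> set ?T \<Longrightarrow> emit_tuple M gl w (xs @ es @ [f]) = G xs" for G
    unfolding inner_def using that by (intro arg_cong[of _ _ concat] map_cong) auto
  consider "f = 0" | "0 < f" "f \<le> \<phi>" | "f = \<phi> + 1" | "f = \<phi> + 2" | "\<phi> + 2 < f" by linarith
  then show ?thesis
  proof cases
    case 1
    have m: "min f (\<phi> + 3) = 0" using 1 by simp
    note at = emit_at[OF _ assms, of _ f, unfolded m Let_def]
    have "inner (es @ [f]) = its (forced key) @ concat (map (\<lambda>_. its (wilds \<kappa>)) ?T) @ its wild"
      unfolding loop_2[symmetric] by (rule cong, simp only: at) (simp)
    also have "concat (map (\<lambda>_. its (wilds \<kappa>)) ?T) = its (wilds (N\<^sup>2 * \<kappa>))"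
    proof -
      have "map (\<lambda>_. its (wilds \<kappa>)) ?T = map its (map (\<lambda>_. wilds \<kappa>) ?T)" by simp
      then show ?thesis by (simp only: its_simps(3)[symmetric] wilds_concat length_tup)
    qed
    also have "its (forced key) @ its (wilds (N\<^sup>2 * \<kappa>)) @ its wild = its (frame (N\<^sup>2 * \<kappa> + 1))"
    proof -
      have "wilds (k + 1) = wilds k @ wild" for k by (induction k) (simp_all add: wilds_def)
      then show ?thesis by (simp add: frame_def)
    qed
    finally show ?thesis using 1 by simp
  next
    case 2
    have m: "min f (\<phi> + 3) = f" using 2 by simp
    note at = emit_at[OF _ assms, of _ f, unfolded m Let_def]
    let ?fam = "families \<kappa> ! (f - 1)"
    let ?g = "\<lambda>xs. concat (map (\<lambda>k. gadget (literal ?fam (relation t h (xs ! 1) (xs ! 0)) k)) [0..<\<kappa>])"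
    show ?thesis
    proof (cases "e0 = 0 \<and> e1 = 0 \<and> e2 = 0")
      case True
      have "inner (es @ [f]) = its (clause_start (forbids M gl ?fam (place w t h))) @ concat (map (\<lambda>xs. its (?g xs)) ?T) @ its ending"
        unfolding loop_2[symmetric] by (rule cong, simp only: at) (use 2 True in simp)
      also have "concat (map (\<lambda>xs. its (?g xs)) ?T) =
          its (concat (map gadget (grid \<kappa> N (\<lambda>t' h'. literal ?fam (relation t h t' h')))))"
        by (simp add: grid_tup map_concat concat_concat comp_def concat_map_nested)
      finally show ?thesis using 2 True
        by (simp add: clause_def literals_def grid_clause_def N_def \<kappa>_def del: its_simps(3))
    next
      case False
      have "inner (es @ [f]) = concat (map (\<lambda>_. []) ?T)"
        by (rule cong) (use 2 in \<open>simp only: at False neq0_conv[symmetric] if_True if_False refl\<close>)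
      moreover have "concat (map (\<lambda>_. []) ?T) = []" by simp
      ultimately show ?thesis using 2 by (simp only: False neq0_conv[symmetric] if_True if_False)
    qed
  next
    case 3
    have m: "min f (\<phi> + 3) = \<phi> + 1" using 3 by simp
    note at = emit_at[OF _ assms, of _ f, unfolded m Let_def]
    show ?thesis
    proof (cases "e0 = 0 \<and> e1 = 0 \<and> e2 = 0 \<and> h = 0 \<and> t = 0")
      case True
      have "inner (es @ [f]) = [End_mark, TA, TA, TA] @ concat (map (\<lambda>_. replicate \<kappa> TA) ?T) @ []"
        unfolding loop_2[symmetric] by (rule cong, simp only: at) (use 3 True in simp)
      also have "concat (map (\<lambda>_. replicate \<kappa> TA) ?T) = replicate (N\<^sup>2 * \<kappa>) TA"
        by (simp only: concat_replicate length_tup)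
      finally show ?thesis using 3 True by (simp add: eval_nat_numeral)
    next
      case False
      have "inner (es @ [f]) = concat (map (\<lambda>_. []) ?T)"
        by (rule cong, simp only: at False) (use 3 in simp)
      then show ?thesis using 3 False by auto
    qed
  next
    case 4
    have m: "min f (\<phi> + 3) = \<phi> + 2" using 4 by simp
    note at = emit_at[OF _ assms, of _ f, unfolded m Let_def]
    have "inner (es @ [f]) = replicate (if e0 = 0 \<and> e1 = 0 \<and> e2 = 0 then \<phi> + 1 else 1) TB @ concat (map (\<lambda>_. []) ?T) @ []"
      unfolding loop_2[symmetric] by (rule cong, simp only: at) (use 4 in simp)
    then show ?thesis using 4 by simp
  next
    case 5
    have m: "min f (\<phi> + 3) = \<phi> + 3" using 5 by simp
    note at = emit_at[OF _ assms, of _ f, unfolded m Let_def]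
    have "inner (es @ [f]) = concat (map (\<lambda>_. []) ?T)"
      by (rule cong, simp only: at) (use 5 in simp)
    then show ?thesis using 5 by simp
  qed
qed

theorem emit_tuple_program: "concat (map (emit_tuple M gl w) (tup N 8)) = program M gl w"
proof -
  have len: "es \<in> set (tup N 5) \<Longrightarrow> \<exists>e0 e1 e2 h t. es = [e0, e1, e2, h, t]" for es
    by (auto simp: set_tup length_Suc_conv eval_nat_numeral)
  have loop: "concat (map (\<lambda>es. inner (es @ [f])) (tup N 5)) = concat (map G (tup N 5))"
    if "\<And>e0 e1 e2 h t. inner ([e0, e1, e2, h, t] @ [f]) = G [e0, e1, e2, h, t]" for f G
    by (intro arg_cong[of _ _ concat] map_cong refl) (use len that in fastforce)
  have hd5: "hd (tup N 5) = [0, 0, 0, 0, 0]" "tup N 5 \<noteq> []"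
    using hd_tup[OF N_pos, of 5] by (simp_all add: eval_nat_numeral)
  have hd3: "hd (tup N 3) = [0, 0, 0]" "tup N 3 \<noteq> []"
    using hd_tup[OF N_pos, of 3] by (simp_all add: eval_nat_numeral)
  have tup5: "tup N 5 = concat (map (\<lambda>b. map (\<lambda>a. a @ b) (tup N 3)) (tup N 2))"
    using tup_add[of N 3 2] by simp
  have frames: "concat (map (\<lambda>es. inner (es @ [0])) (tup N 5)) = its (frames (N ^ 5) (N\<^sup>2 * \<kappa> + 1))"
  proof -
    have "concat (map (\<lambda>es. inner (es @ [0])) (tup N 5)) = concat (map (\<lambda>_. its (frame (N\<^sup>2 * \<kappa> + 1))) (tup N 5))"
      by (rule loop) (simp only: inner_eq if_True refl)
    also have "\<dots> = its (frames (N ^ 5) (N\<^sup>2 * \<kappa> + 1))"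
      by (simp add: frames_def map_replicate_const length_tup)
    finally show ?thesis .
  qed
  have clause: "concat (map (\<lambda>es. inner (es @ [f])) (tup N 5)) =
      concat (map (\<lambda>b. its (clause (grid_clause M gl w (families \<kappa> ! (f - 1)) (b ! 1) (b ! 0)))) (tup N 2))"
    if "0 < f" "f \<le> \<phi>" for f
  proof -
    let ?c = "\<lambda>b. its (clause (grid_clause M gl w (families \<kappa> ! (f - 1)) (b ! 1) (b ! 0)))"
    have "concat (map (\<lambda>es. inner (es @ [f])) (tup N 5)) =
        concat (map (\<lambda>es. if take 3 es = hd (tup N 3) then ?c (drop 3 es) else []) (tup N 5))"
      by (rule loop, subst inner_eq[OF refl]) (use that in \<open>simp add: hd3\<close>)
    also have "\<dots> = concat (map (\<lambda>b. concat (map (\<lambda>a. if a = hd (tup N 3) then ?c b else []) (tup N 3))) (tup N 2))"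
    proof -
      have "concat (map (\<lambda>es. if take 3 es = hd (tup N 3) then ?c (drop 3 es) else []) (map (\<lambda>a. a @ b) (tup N 3))) =
          concat (map (\<lambda>a. if a = hd (tup N 3) then ?c b else []) (tup N 3))" for b
        unfolding map_map by (intro arg_cong[of _ _ concat] map_cong refl) (auto simp: set_tup)
      then show ?thesis unfolding tup5 by (simp only: concat_map_nested map_map comp_def)
    qed
    also have "\<dots> = concat (map ?c (tup N 2))"
      by (simp only: concat_only_first[OF distinct_tup hd3(2)])
    finally show ?thesis .
  qed
  have mark: "concat (map (\<lambda>es. inner (es @ [\<phi> + 1])) (tup N 5)) = End_mark # replicate (N\<^sup>2 * \<kappa> + 3) TA"
  proof -
    let ?a = "End_mark # replicate (N\<^sup>2 * \<kappa> + 3) TA"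
    have "concat (map (\<lambda>es. inner (es @ [\<phi> + 1])) (tup N 5)) = concat (map (\<lambda>es. if es = hd (tup N 5) then ?a else []) (tup N 5))"
      by (rule loop, subst inner_eq[OF refl]) (auto simp: hd5)
    then show ?thesis by (simp only: concat_only_first[OF distinct_tup hd5(2)])
  qed
  \<comment> \<open>Each of the \<open>N ^ 5\<close> outer rounds writes one \<open>TB\<close>, and
    the \<open>N\<^sup>2\<close> rounds in which the spare pebbles are at 0 write
    \<open>\<phi>\<close> more.\<close>
  have tail: "concat (map (\<lambda>es. inner (es @ [\<phi> + 2])) (tup N 5)) = replicate (N ^ 5 + \<phi> * N\<^sup>2) TB"
  proof -
    have "concat (map (\<lambda>es. inner (es @ [\<phi> + 2])) (tup N 5)) =
        concat (map (\<lambda>es. replicate (if take 3 es = hd (tup N 3) then \<phi> + 1 else 1) TB) (tup N 5))"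
      by (rule loop, subst inner_eq[OF refl]) (simp add: hd3)
    also have "\<dots> = concat (map (\<lambda>b. concat (map (\<lambda>a. replicate (if a = hd (tup N 3) then \<phi> + 1 else 1) TB) (tup N 3))) (tup N 2))"
    proof -
      have "concat (map (\<lambda>es. replicate (if take 3 es = hd (tup N 3) then \<phi> + 1 else 1) TB) (map (\<lambda>a. a @ b) (tup N 3))) =
          concat (map (\<lambda>a. replicate (if a = hd (tup N 3) then \<phi> + 1 else 1) TB) (tup N 3))" for b
        unfolding map_map by (intro arg_cong[of _ _ concat] map_cong refl) (auto simp: set_tup)
      then show ?thesis unfolding tup5 by (simp only: concat_map_nested map_map comp_def)
    qed
    also have "concat (map (\<lambda>a. replicate (if a = hd (tup N 3) then \<phi> + 1 else 1) TB) (tup N 3)) = replicate (N ^ 3 + \<phi>) TB"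
    proof -
      have "(\<lambda>a. replicate (if a = hd (tup N 3) then \<phi> + 1 else 1) TB) =
          (\<lambda>a. (if a = hd (tup N 3) then replicate \<phi> TB else []) @ [TB] @ (if a = last (tup N 3) then [] else []))"
        by (auto simp: replicate_append_same)
      then have "concat (map (\<lambda>a. replicate (if a = hd (tup N 3) then \<phi> + 1 else 1) TB) (tup N 3)) =
          replicate \<phi> TB @ concat (map (\<lambda>_. [TB]) (tup N 3)) @ []"
        by (simp only: concat_first_last[OF distinct_tup hd3(2)])
      also have "concat (map (\<lambda>_. [TB]) (tup N 3)) = replicate (N ^ 3) TB"
        by (simp add: map_replicate_const length_tup)
      finally show ?thesis by (simp add: add.commute flip: replicate_add)
    qed
    moreover have "N\<^sup>2 * (N ^ 3 + \<phi>) = N ^ 5 + \<phi> * N\<^sup>2"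
      by (simp add: algebra_simps flip: power_add)
    ultimately show ?thesis by (simp only: concat_replicate length_tup)
  qed
  have rest: "concat (map (\<lambda>es. inner (es @ [f])) (tup N 5)) = []" if "\<phi> + 2 < f" for f
  proof -
    have "concat (map (\<lambda>es. inner (es @ [f])) (tup N 5)) = concat (map (\<lambda>_. []) (tup N 5))"
      by (rule loop, subst inner_eq[OF refl]) (use that in simp)
    then show ?thesis by simp
  qed
  let ?F = "\<lambda>f. concat (map (\<lambda>es. inner (es @ [f])) (tup N 5))"
  have split: "[0..<N] = [0] @ map Suc [0..<\<phi>] @ [\<phi> + 1] @ [\<phi> + 2] @ [\<phi> + 3..<N]"
  proof -
    have "[0..<N] = [0..<\<phi> + 3] @ [\<phi> + 3..<N]" using N upt_add_eq_append[of 0 "\<phi> + 3" "N - (\<phi> + 3)"] by simp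
    also have "[0..<\<phi> + 3] = [0..<Suc \<phi>] @ [\<phi> + 1] @ [\<phi> + 2]" by (simp add: eval_nat_numeral)
    also have "[0..<Suc \<phi>] = [0] @ map Suc [0..<\<phi>]" by (simp add: map_Suc_upt upt_conv_Cons del: upt_Suc)
    finally show ?thesis by simp
  qed
  have "concat (map ?F (map Suc [0..<\<phi>])) = its (clauses (all_clauses M gl w))"
  proof -
    have "concat (map ?F (map Suc [0..<\<phi>])) = concat (map (\<lambda>i. concat (map (\<lambda>b. its (clause (grid_clause M gl w (families \<kappa> ! i) (b ! 1) (b ! 0)))) (tup N 2))) [0..<\<phi>])"
      unfolding map_map by (intro arg_cong[of _ _ concat] map_cong refl) (simp add: clause)
    also have "\<dots> = concat (map (\<lambda>fam. concat (map (\<lambda>b. its (clause (grid_clause M gl w fam (b ! 1) (b ! 0)))) (tup N 2))) (families \<kappa>))"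
    proof -
      have "families \<kappa> = map ((!) (families \<kappa>)) [0..<\<phi>]" unfolding \<phi>_def by (rule map_nth[symmetric])
      then show ?thesis by (metis (no_types, lifting) map_map comp_apply map_cong)
    qed
    also have "\<dots> = its (clauses (all_clauses M gl w))"
      by (simp add: clauses_def all_clauses_def map_concat concat_concat comp_def N_def \<kappa>_def)
    finally show ?thesis .
  qed
  moreover have "concat (map ?F [\<phi> + 3..<N]) = []" using rest by simp
  ultimately have "concat (map ?F [0..<N]) = its (frames (N ^ 5) (N\<^sup>2 * \<kappa> + 1)) @ its (clauses (all_clauses M gl w)) @
      (End_mark # replicate (N\<^sup>2 * \<kappa> + 3) TA) @ replicate (N ^ 5 + \<phi> * N\<^sup>2) TB"
    unfolding split map_append concat_append by (simp only: list.map concat.simps frames mark tail append_Nil2)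
  then show ?thesis
    unfolding emit_concat program_def Let_def by (simp add: N_def \<kappa>_def \<phi>_def)
qed

end

lemma length_all_clauses: "length (all_clauses M gl w) = length (families (length gl)) * (length w)\<^sup>2"
  by (simp add: all_clauses_def length_concat comp_def length_tup map_replicate_const sum_list_replicate)

lemma set_all_clauses: "C \<in> set (all_clauses M gl w) \<longleftrightarrow>
    (\<exists>fam \<in> set (families (length gl)). \<exists>t < length w. \<exists>h < length w. C = grid_clause M gl w fam t h)"
proof -
  have "(\<exists>b \<in> set (tup N 2). P (b ! 1) (b ! 0)) \<longleftrightarrow> (\<exists>t < N. \<exists>h < N. P t h)" for N P
  proof
    assume "\<exists>b \<in> set (tup N 2). P (b ! 1) (b ! 0)"
    then obtain b where b: "P (b ! 1) (b ! 0)" "length b = 2" "set b \<subseteq> {..<N}" by (auto simp: set_tup)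
    have "b ! 0 \<in> set b" "b ! 1 \<in> set b" using b(2) by simp_all
    then have "b ! 0 < N" "b ! 1 < N" using b(3) by blast+
    then show "\<exists>t < N. \<exists>h < N. P t h" using b(1) by blast
  next
    assume "\<exists>t < N. \<exists>h < N. P t h"
    then obtain t h where "t < N" "h < N" "P t h" by blast
    then show "\<exists>b \<in> set (tup N 2). P (b ! 1) (b ! 0)"
      by (intro bexI[of _ "[h, t]"]) (auto simp: set_tup)
  qed
  note pairs = this[of "length w" "\<lambda>t h. C = grid_clause M gl w _ t h"]
  have "C \<in> set (concat (map f fams)) \<longleftrightarrow> (\<exists>fam \<in> set fams. C \<in> set (f fam))" for f and fams :: "family list" by simp
  then show ?thesis by (simp only: all_clauses_def pairs set_map image_iff)
qed

lemma length_grid_clause: "length (snd (grid_clause M gl w fam t h)) = length w * (length w * length gl)"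
  by (simp add: grid_clause_def)

section \<open>From items to a permutation\<close>

text \<open>A copy marked at a long item prints its letter at the mark and at every later position.
  The run therefore extends over the rest of the copy, and padding behind the word guarantees its
  length.\<close>

fun expand_step :: "bool option \<Rightarrow> (isym \<times> bool) option \<Rightarrow> bool option \<times> isym list" where
  "expand_step q None = (None, [])"
| "expand_step (Some c) (Some _) = (Some c, [It False c])"
| "expand_step None (Some (x, m)) =
    (if m then (case x of It l c \<Rightarrow> (if l then Some c else None, [It False c]) | Blank \<Rightarrow> (None, []) | _ \<Rightarrow> (None, [x]))
     else (None, []))"

fun spread :: "isym list \<Rightarrow> isym list" where
  "spread [] = []"
| "spread (x # xs) =
    (case x of It l c \<Rightarrow> replicate (if l then Suc (length xs) else 1) (It False c) | Blank \<Rightarrow> [] | _ \<Rightarrow> [x]) @ spread xs"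

lemma expand_step_run: "fout expand_step (Some c) (map Some b @ None # ys) = replicate (length b) (It False c) @ fout expand_step None ys"
  by (induction b) auto

lemma expand_step_skip: "fout expand_step None (map Some (map off b) @ ys) = fout expand_step None ys"
  by (induction b) auto

lemma expand_step_marks: "fout expand_step None (flat (marks_from xs ys)) = spread ys"
proof (induction ys arbitrary: xs)
  case (Cons y ys)
  have "fout expand_step None (flat (marks_from xs (y # ys))) =
      fout expand_step None (map Some (map off xs) @ Some (y, True) # map Some (map off ys) @ None # flat (marks_from (xs @ [y]) ys))"
    by simp
  also have "\<dots> = fout expand_step None (Some (y, True) # map Some (map off ys) @ None # flat (marks_from (xs @ [y]) ys))"
    by (rule expand_step_skip)
  also have "\<dots> = spread (y # ys)"
  proof -
    have "fout expand_step None (None # zs) = fout expand_step None zs" for zs by simp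
    then show ?thesis using Cons expand_step_run[of _ "map off ys"] expand_step_skip[of ys]
      by (cases y) (simp_all del: map_map)
  qed
  finally show ?case .
qed simp

lemma spread_items: "\<exists>D. spread (its xs @ ys) = map (It False) D @ spread ys \<and> expands (length ys) xs D"
proof (induction xs)
  case (Cons x xs)
  then obtain D where D: "spread (its xs @ ys) = map (It False) D @ spread ys" "expands (length ys) xs D" by blast
  obtain l c where x: "x = (l, c)" by fastforce
  let ?k = "if l then Suc (length (its xs @ ys)) else 1"
  have "spread (its (x # xs) @ ys) = map (It False) (replicate ?k c @ D) @ spread ys"
    using D(1) by (simp add: its_def x)
  moreover have "expands (length ys) (x # xs) (replicate ?k c @ D)"
    using D(2) by (auto simp: x intro!: exI[of _ ?k])
  ultimately show ?case by blast
qed (simp add: its_def)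

lemma spread_tags: "set xs \<subseteq> {End_mark, TA, TB} \<Longrightarrow> spread (xs @ replicate k Blank) = xs"
proof (induction xs)
  case Nil
  show ?case by (induction k) auto
qed auto

section \<open>Positions of cards in unary\<close>

datatype phase = Scan | Skip | Count | Final | Tag_A | Tag_B | Done

lemma finite_phase: "finite (UNIV :: phase set)"
proof -
  have "x \<in> {Scan, Skip, Count, Final, Tag_A, Tag_B, Done}" for x by (cases x) auto
  then have "(UNIV :: phase set) \<subseteq> {Scan, Skip, Count, Final, Tag_A, Tag_B, Done}" by blast
  then show ?thesis by (rule finite_subset) simp
qed

fun letter :: "isym \<Rightarrow> bool" where
  "letter (It l c) = True"
| "letter End_mark = True"
| "letter _ = False"

text \<open>A copy marked at a letter prints the position of that card: the ascents before the mark,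
  one for the mark and, for a descent, all later letters, with \<open>End_mark\<close> counted for
  the sentinel. The copy marked at \<open>End_mark\<close> prints the last card and begins the list
  of pile numbers; the next copy supplies the second and third number, and all further copies are
  ignored.\<close>

fun token_step :: "phase \<Rightarrow> (isym \<times> bool) option \<Rightarrow> phase \<times> tok list" where
  "token_step Scan (Some (It l c, m)) = (if m then if c then Skip else Count else Scan, if m \<or> c then [Tick] else [])"
| "token_step Scan (Some (x, m)) = (if m then Final else Scan, if m then [Tick] else [])"
| "token_step Skip None = (Scan, [Sep])"
| "token_step Count (Some (x, m)) = (Count, if letter x then [Tick] else [])"
| "token_step Count None = (Scan, [Sep])"
| "token_step Final None = (Tag_A, [Sep, Endl] @ replicate 6 Tick @ [Sep])"
| "token_step Tag_A (Some (x, m)) = (if x = TB then Tag_B else Tag_A, if x = TA then [Tick] else if x = TB then [Sep, Tick] else [])"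
| "token_step Tag_B (Some (x, m)) = (Tag_B, if x = TB then [Tick] else [])"
| "token_step Tag_B None = (Done, [Sep, Endl])"
| "token_step q _ = (q, [])"

lemma token_scan: "fout token_step Scan (map Some (map off (map (It False) P)) @ ys) =
    replicate (ups P) Tick @ fout token_step Scan ys"
  by (induction P) (auto simp: ups_def)

lemma token_skip: "fout token_step Skip (map Some b @ None # ys) = Sep # fout token_step Scan ys"
  by (induction b) auto

lemma token_count: "fout token_step Count (map Some b @ None # ys) =
    replicate (length (filter letter (map fst b))) Tick @ Sep # fout token_step Scan ys"
  by (induction b) auto

lemma token_final: "fout token_step Final (map Some b @ None # ys) =
    [Sep, Endl] @ replicate 6 Tick @ [Sep] @ fout token_step Tag_A ys"
  by (induction b) auto

lemma token_tag_A: "\<forall>x \<in> set b. fst x \<noteq> TB \<Longrightarrow> fout token_step Tag_A (map Some b @ ys) =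
    replicate (length (filter (\<lambda>x. x = TA) (map fst b))) Tick @ fout token_step Tag_A ys"
  by (induction b) auto

lemma token_done: "fout token_step Done ys = []"
  by (induction ys) auto

lemma token_tag_B: "fout token_step Tag_B (map Some b @ None # ys) =
    replicate (length (filter (\<lambda>x. x = TB) (map fst b))) Tick @ [Sep, Endl]"
  by (induction b) (auto simp: token_done)

lemma to_binary_ticks: "to_binary k (replicate n Tick @ xs) = to_binary (k + n) xs"
  by (induction n arbitrary: k) auto

context
  fixes V S :: nat and D0 D :: "bool list" and T :: "isym list"
  defines "T \<equiv> End_mark # replicate V TA @ replicate S TB" and "D \<equiv> D0 @ [False]"
  assumes pos: "0 < V" "0 < S"
begin

lemma token_letter:
  assumes "D0 = P @ c # Q"
  shows "to_binary 0 (fout token_step Scan (map Some (map off (map (It False) P) @ (It False c, True) # map off (map (It False) Q @ T)) @ None # ys)) =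
    encode_nat (position D (length P)) @ to_binary 0 (fout token_step Scan ys)"
proof -
  let ?Y = "map off (map (It False) Q @ T)"
  have "fout token_step Scan (map Some (map off (map (It False) P) @ (It False c, True) # ?Y) @ None # ys) =
      replicate (ups P) Tick @ fout token_step Scan (Some (It False c, True) # map Some ?Y @ None # ys)"
    using token_scan[of P "Some (It False c, True) # map Some ?Y @ None # ys"] by (simp del: map_map)
  also have "fout token_step Scan (Some (It False c, True) # map Some ?Y @ None # ys) =
      replicate (if c then 1 else length Q + 2) Tick @ Sep # fout token_step Scan ys"
  proof (cases c)
    case True
    then show ?thesis using token_skip[of ?Y ys] by (simp del: map_map)
  next
    case False
    have "filter letter (map fst ?Y) = map (It False) Q @ [End_mark]"
    proof -
      have "filter letter (map (It False) Q) = map (It False) Q" "filter letter T = [End_mark]" by (simp_all add: T_def)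
      moreover have "map fst ?Y = map (It False) Q @ T" by (simp add: comp_def)
      ultimately show ?thesis by (simp only: filter_append)
    qed
    then show ?thesis using False token_count[of ?Y ys] by (simp del: map_map)
  qed
  finally show ?thesis
  proof -
    assume "fout token_step Scan (map Some (map off (map (It False) P) @ (It False c, True) # ?Y) @ None # ys) =
      replicate (ups P) Tick @ replicate (if c then 1 else length Q + 2) Tick @ Sep # fout token_step Scan ys"
    \<comment> \<open>The 2 is one for the card itself and one for the sentinel.\<close>
    moreover have "position D (length P) = ups P + (if c then 1 else length Q + 2)"
      by (simp add: position_def D_def assms)
    ultimately show ?thesis by (simp only: to_binary_ticks add_0 to_binary.simps)
  qed
qed

lemma token_letters:
  assumes "D0 = P @ Q"
  shows "to_binary 0 (fout token_step Scan (flat (marks_from (map (It False) P) (map (It False) Q @ T)))) =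
    concat (map (\<lambda>i. encode_nat (position D i)) [length P..<length D0]) @
    to_binary 0 (fout token_step Scan (flat (marks_from (map (It False) D0) T)))"
  using assms
proof (induction Q arbitrary: P)
  case (Cons c Q)
  have "[length P..<length D0] = length P # [length (P @ [c])..<length D0]"
    using Cons.prems by (simp add: upt_conv_Cons del: upt_Suc)
  moreover have "marks_from (map (It False) P) (map (It False) (c # Q) @ T) =
      (map off (map (It False) P) @ (It False c, True) # map off (map (It False) Q @ T)) #
      marks_from (map (It False) (P @ [c])) (map (It False) Q @ T)" by simp
  ultimately show ?case
    using token_letter[OF Cons.prems] Cons.IH[of "P @ [c]"] Cons.prems by (simp only: flat_simps) simp
qed simp

lemma token_end: "to_binary 0 (fout token_step Scan (flat (marks_from (map (It False) D0) T))) =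
    encode_nat (position D (length D0)) @ [False, True] @ encode_nat 6 @ encode_nat V @ encode_nat S @ [False, True]"
proof -
  obtain V' where V: "V = Suc V'" using pos(1) by (cases V) auto
  obtain S' where S: "S = Suc S'" using pos(2) by (cases S) auto
  define b1 where "b1 = map off (replicate V TA @ replicate S TB)"
  \<comment> \<open>\<open>b2\<close>, one \<open>TB\<close> and \<open>b3\<close> make up the copy
    marked at the first \<open>TA\<close>, from which both counts are taken; \<open>rest\<close> is
    read in the phase that prints nothing.\<close>
  define b2 where "b2 = map off (map (It False) D0) @ [off End_mark] @ (TA, True) # map off (replicate V' TA)"
  define b3 where "b3 = map off (replicate S' TB)"
  define rest where "rest = marks_from ((map (It False) D0 @ [End_mark]) @ [TA]) (replicate V' TA @ replicate S TB)"
  have "flat (marks_from (map (It False) D0) T) = map Some (map off (map (It False) D0)) @ Some (End_mark, True) # map Some b1 @ None #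
      map Some b2 @ Some (TB, False) # map Some b3 @ None # flat rest"
    by (simp add: T_def V S b1_def b2_def b3_def rest_def)
  then have "fout token_step Scan (flat (marks_from (map (It False) D0) T)) =
      replicate (ups D0) Tick @ fout token_step Scan (Some (End_mark, True) # map Some b1 @ None #
        map Some b2 @ Some (TB, False) # map Some b3 @ None # flat rest)"
    by (simp only: token_scan)
  also have "\<dots> = replicate (ups D0) Tick @ Tick # fout token_step Final (map Some b1 @ None #
        map Some b2 @ Some (TB, False) # map Some b3 @ None # flat rest)" by simp
  also have "\<dots> = replicate (ups D0) Tick @ Tick # [Sep, Endl] @ replicate 6 Tick @ [Sep] @
      fout token_step Tag_A (map Some b2 @ Some (TB, False) # map Some b3 @ None # flat rest)"
    by (simp only: token_final)
  also have "fout token_step Tag_A (map Some b2 @ Some (TB, False) # map Some b3 @ None # flat rest) =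
      replicate V Tick @ fout token_step Tag_A (Some (TB, False) # map Some b3 @ None # flat rest)"
  proof -
    have "filter (\<lambda>x. x = TA) (map fst b2) = replicate V TA" by (simp add: b2_def V)
    moreover have "\<forall>x \<in> set b2. fst x \<noteq> TB" by (auto simp: b2_def)
    ultimately show ?thesis by (simp only: token_tag_A length_replicate)
  qed
  also have "fout token_step Tag_A (Some (TB, False) # map Some b3 @ None # flat rest) =
      [Sep, Tick] @ fout token_step Tag_B (map Some b3 @ None # flat rest)" by simp
  also have "fout token_step Tag_B (map Some b3 @ None # flat rest) = replicate S' Tick @ [Sep, Endl]"
  proof -
    have "filter (\<lambda>x. x = TB) (map fst b3) = replicate S' TB" by (simp add: b3_def)
    then show ?thesis by (simp only: token_tag_B length_replicate)
  qed
  finally have *: "fout token_step Scan (flat (marks_from (map (It False) D0) T)) =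
      replicate (ups D0) Tick @ Tick # [Sep, Endl] @ replicate 6 Tick @ [Sep] @ replicate V Tick @ [Sep, Tick] @ replicate S' Tick @ [Sep, Endl]" .
  have "position D (length D0) = Suc (ups D0)" by (simp add: position_def D_def)
  then show ?thesis unfolding * by (simp add: to_binary_ticks S)
qed

lemma token_instance: "to_binary 0 (fout token_step Scan (flat (marks (map (It False) D0 @ T)))) =
    encode_instance (length D) (perm_of D) [6, V, S]"
proof -
  have "to_binary 0 (fout token_step Scan (flat (marks (map (It False) D0 @ T)))) =
      concat (map (\<lambda>i. encode_nat (position D i)) [0..<length D0]) @
      encode_nat (position D (length D0)) @ [False, True] @ encode_nat 6 @ encode_nat V @ encode_nat S @ [False, True]"
    using token_letters[of "[]" D0] by (simp only: token_end marks_def) simp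
  also have "\<dots> = concat (map (\<lambda>i. encode_nat (position D i)) [0..<length D]) @ [False, True] @ encode_list [6, V, S]"
    by (simp add: encode_list_def D_def)
  also have "map (\<lambda>i. encode_nat (position D i)) [0..<length D] = map encode_nat (map (perm_of D) [1..<length D + 1])"
  proof -
    have "[1..<length D + 1] = map Suc [0..<length D]" by (simp add: map_Suc_upt del: upt_Suc)
    then show ?thesis by (simp add: perm_of_def comp_def del: upt_Suc)
  qed
  finally show ?thesis by (simp add: encode_instance_def encode_list_def del: upt_Suc)
qed

end

text \<open>The length is squared before the expansion so that runs become longer than the number of
  piles. The expanded word is marked again because the position of a card depends on letters on both
  sides of it.\<close>

definition finish :: "isym list \<Rightarrow> bool list" where
  "finish s = to_binary 0 (frun token_step (\<lambda>_. []) Scan (mark (wrap (frun expand_step (\<lambda>_. []) None (mark (grow Blank (wrap s)))))))"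

lemma pf_mark_frun:
  fixes \<delta> :: "'q \<Rightarrow> (isym \<times> bool) option \<Rightarrow> 'q \<times> 'b :: countable list"
  assumes "finite (UNIV :: 'q set)"
  shows "pf (single UNIV) (\<lambda>xs. frun \<delta> fin q (mark xs))"
proof (rule pf_comp[OF pf_marked[OF finite_isym]])
  show "pf UNIV (frun \<delta> fin q)"
    by (rule pf_frun[where A = UNIV and Q = UNIV]) (use assms finite_isym in \<open>auto intro: finite_option_UNIV[THEN iffD2] simp: finite_prod\<close>)
qed simp

lemma pf_finish: "pf UNIV finish"
proof -
  have wrap: "pf UNIV (wrap :: isym list \<Rightarrow> _)" using pf_wrap[OF finite_isym] by simp
  have in_single: "wrap s \<in> single UNIV" for s :: "isym list" unfolding wrap_def by (rule singleI) simp
  have grow: "pf UNIV (\<lambda>s :: isym list. grow Blank (wrap s))"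
    by (rule pf_comp[OF wrap pf_grow[OF finite_isym] in_single])
  have grow_in: "grow Blank (wrap s) \<in> single UNIV" for s unfolding wrap_def grow_single by (rule singleI) simp
  have "finite (UNIV :: bool option set)" by simp
  from pf_comp[OF grow pf_mark_frun[OF this] grow_in]
  have "pf UNIV (\<lambda>s. frun expand_step (\<lambda>_. []) None (mark (grow Blank (wrap s))))" .
  from pf_comp[OF this wrap] have "pf UNIV (\<lambda>s. wrap (frun expand_step (\<lambda>_. []) None (mark (grow Blank (wrap s)))))" by simp
  from pf_comp[OF this pf_mark_frun[OF finite_phase] in_single]
  have "pf UNIV (\<lambda>s. frun token_step (\<lambda>_. []) Scan (mark (wrap (frun expand_step (\<lambda>_. []) None (mark (grow Blank (wrap s)))))))" .
  from pf_comp[OF this pf_to_binary] show ?thesis unfolding finish_def by simp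
qed

lemma finish_eq:
  fixes xs :: "item list" and V S :: nat
  defines "s \<equiv> its xs @ End_mark # replicate V TA @ replicate S TB"
  assumes "0 < V" "0 < S"
  obtains D where "expands (length s * length s - length s) xs D"
    "finish s = encode_instance (length (D @ [False])) (perm_of (D @ [False])) [6, V, S]"
proof -
  let ?T = "End_mark # replicate V TA @ replicate S TB"
  let ?k = "length s * length s - length s"
  obtain D where D: "spread (its xs @ (?T @ replicate ?k Blank)) = map (It False) D @ spread (?T @ replicate ?k Blank)"
    "expands (length (?T @ replicate ?k Blank)) xs D"
    using spread_items by blast
  have "frun expand_step (\<lambda>_. []) None (mark (grow Blank (wrap s))) = spread (grown Blank s)"
    by (simp add: frun_def wrap_def grow_single marks_def expand_step_marks del: flat_simps)
  also have "grown Blank s = its xs @ (?T @ replicate ?k Blank)" by (simp add: grown_def s_def)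
  also have "spread (its xs @ (?T @ replicate ?k Blank)) = map (It False) D @ ?T"
    unfolding D(1) by (subst spread_tags) auto
  finally have "finish s = to_binary 0 (fout token_step Scan (flat (marks (map (It False) D @ ?T))))"
    by (simp add: finish_def frun_def wrap_def del: flat_simps)
  also have "\<dots> = encode_instance (length (D @ [False])) (perm_of (D @ [False])) [6, V, S]"
    by (rule token_instance[OF assms(2,3)])
  finally show ?thesis using that expands_mono[OF D(2), of ?k] by simp
qed

section \<open>The reduction\<close>

lemma length_frame: "6 * (k + 2) \<le> length (frame k)"
proof -
  have "length (wilds k) = 10 * k" by (simp add: wilds_def wild_def length_concat sum_list_replicate)
  then show ?thesis by (simp add: frame_def key_def chunk_def)
qed

lemma clauses_last:
  assumes "Cs \<noteq> []"
  obtains xs where "clauses Cs = xs @ [MM]"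
proof -
  obtain Cs' C where "Cs = Cs' @ [C]" using assms by (metis append_butlast_last_id)
  then have "clauses Cs = (clauses Cs' @ clause_start (fst C) @ concat (map gadget (snd C)) @ butlast ending) @ [MM]"
    by (simp add: clauses_def clause_def literals_def ending_def)
  then show ?thesis using that by blast
qed

text \<open>By injectivity of the encoding no other instance shares the code.\<close>

lemma mem_dealers_choice_sort:
  assumes "\<sigma> permutes {1..n}" "\<forall>m \<in> set ms. m \<ge> 1"
  shows "encode_instance n \<sigma> ms \<in> dealers_choice_sort \<longleftrightarrow>
    (\<exists>X. length X = length ms \<and> (\<forall>t < length ms. length (X ! t) = ms ! t) \<and> sorts n X \<sigma>)" (is "_ \<longleftrightarrow> ?R")
proof
  assume "encode_instance n \<sigma> ms \<in> dealers_choice_sort"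
  then obtain n' \<sigma>' ms' where *: "encode_instance n \<sigma> ms = encode_instance n' \<sigma>' ms'" "\<sigma>' permutes {1..n'}"
    "\<exists>X. length X = length ms' \<and> (\<forall>t < length ms'. length (X ! t) = ms' ! t) \<and> sorts n' X \<sigma>'"
    unfolding dealers_choice_sort_def by blast
  show ?R using encode_instance_inj[OF assms(1) *(2,1)] *(3) by simp
qed (use assms in \<open>unfold dealers_choice_sort_def, blast\<close>)

lemma three_rounds: "(\<exists>X. length X = length [a, b, c] \<and> (\<forall>t < length [a, b, c]. length (X ! t) = [a, b, c] ! t) \<and> P X) \<longleftrightarrow>
    (\<exists>\<psi> \<phi> \<chi>. length \<psi> = a \<and> length \<phi> = b \<and> length \<chi> = c \<and> P [\<psi>, \<phi>, \<chi>])"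
proof
  assume "\<exists>X. length X = length [a, b, c] \<and> (\<forall>t < length [a, b, c]. length (X ! t) = [a, b, c] ! t) \<and> P X"
  then obtain X where X: "length X = 3" "\<forall>t < 3. length (X ! t) = [a, b, c] ! t" "P X" by (auto simp: eval_nat_numeral)
  from X(1) obtain \<psi> \<phi> \<chi> where "X = [\<psi>, \<phi>, \<chi>]" by (auto simp: length_Suc_conv eval_nat_numeral)
  then show "\<exists>\<psi> \<phi> \<chi>. length \<psi> = a \<and> length \<phi> = b \<and> length \<chi> = c \<and> P [\<psi>, \<phi>, \<chi>]"
    using X(2)[rule_format, of 0] X(2)[rule_format, of 1] X(2)[rule_format, of 2] X(3) by auto
next
  assume "\<exists>\<psi> \<phi> \<chi>. length \<psi> = a \<and> length \<phi> = b \<and> length \<chi> = c \<and> P [\<psi>, \<phi>, \<chi>]"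
  then obtain \<psi> \<phi> \<chi> where "length \<psi> = a" "length \<phi> = b" "length \<chi> = c" "P [\<psi>, \<phi>, \<chi>]" by blast
  then show "\<exists>X. length X = length [a, b, c] \<and> (\<forall>t < length [a, b, c]. length (X ! t) = [a, b, c] ! t) \<and> P X"
    by (intro exI[of _ "[\<psi>, \<phi>, \<chi>]"]) (auto simp: less_Suc_eq nth_Cons')
qed

lemma finish_mem:
  fixes Cs :: "(bool \<times> bool option list) list" and R n :: nat
  defines "V \<equiv> n + 3" and "S \<equiv> R + length Cs"
  assumes Cs: "Cs \<noteq> []" "\<forall>C \<in> set Cs. length (snd C) = n" and R: "6 * (n + 3) * length Cs \<le> R"
  shows "finish (its (frames R (n + 1)) @ its (clauses Cs) @ End_mark # replicate V TA @ replicate S TB) \<in> dealers_choice_sort \<longleftrightarrow>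
    (\<exists>bs. length bs = n \<and> (\<forall>C \<in> set Cs. satisfied bs C))"
proof -
  let ?xs = "frames R (n + 1) @ clauses Cs"
  let ?s = "its ?xs @ End_mark # replicate V TA @ replicate S TB"
  let ?K = "length ?s * length ?s - length ?s"
  have pos: "0 < V" "0 < S" using Cs(1) by (simp_all add: V_def S_def)
  obtain D0 where D0: "expands ?K ?xs D0"
    "finish ?s = encode_instance (length (D0 @ [False])) (perm_of (D0 @ [False])) [6, V, S]"
    using finish_eq[OF pos] by blast
  define D where "D = D0 @ [False]"
  \<comment> \<open>The clauses end with a long run of descents, which absorbs the sentinel appended
    to \<open>D0\<close>.\<close>
  obtain ys where "clauses Cs = ys @ [MM]" using clauses_last[OF Cs(1)] by blast
  then have D: "expands ?K ?xs D"
    using D0(1) expands_last[of ?K "frames R (n + 1) @ ys" False D0] by (simp add: D_def)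
  \<comment> \<open>The frames alone give \<open>?s\<close> at least \<open>R * (V * 6)\<close>
    symbols, and \<open>S \<le> 2 * R\<close>; so the composed word is at most linear in the length
    of \<open>?s\<close>, while the threshold for runs is quadratic.\<close>
  have short: "V * 6 * S < ?K"
  proof -
    have "length Cs \<le> R"
      using R by (rule le_trans[rotated]) simp
    have "R * (V * 6) \<le> length (frames R (n + 1))"
    proof -
      have "length (frames R (n + 1)) = R * length (frame (n + 1))"
        by (simp add: frames_def length_concat sum_list_replicate)
      moreover have "V * 6 \<le> length (frame (n + 1))" using length_frame[of "n + 1"] by (simp add: V_def)
      ultimately show ?thesis by simp
    qed
    then have le: "R * (V * 6) + 4 \<le> length ?s" using pos by (simp add: V_def its_def)
    have "V * 6 * S \<le> 2 * (R * (V * 6))"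
    proof -
      have "S \<le> 2 * R" using \<open>length Cs \<le> R\<close> by (simp add: S_def)
      then have "V * 6 * S \<le> V * 6 * (2 * R)" by (rule mult_le_mono2)
      then show ?thesis by (simp add: algebra_simps)
    qed
    also have "\<dots> < 3 * length ?s" using le by linarith
    also have "3 * length ?s \<le> ?K"
    proof -
      have "4 * length ?s \<le> length ?s * length ?s" using le by (intro mult_le_mono1) linarith
      then show ?thesis by linarith
    qed
    finally show ?thesis .
  qed
  have "finish ?s \<in> dealers_choice_sort \<longleftrightarrow>
      (\<exists>\<psi> \<phi> \<chi>. length \<psi> = 6 \<and> length \<phi> = V \<and> length \<chi> = S \<and> sorts (length D) [\<psi>, \<phi>, \<chi>] (perm_of D))"
    unfolding D0(2) D_def[symmetric]
    by (subst mem_dealers_choice_sort[OF perm_of_permutes]) (use pos in \<open>auto simp: three_rounds simp del: list.size\<close>)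
  also have "\<dots> \<longleftrightarrow> (\<exists>\<psi> \<phi> \<chi>. length \<psi> = 6 \<and> length \<phi> = V \<and> length \<chi> = S \<and>
      red (map up (rounds_word (rounds_word \<psi> \<phi>) \<chi>)) ?xs = [])"
  proof -
    have "sorts (length D) [\<psi>, \<phi>, \<chi>] (perm_of D) \<longleftrightarrow> red (map up (rounds_word (rounds_word \<psi> \<phi>) \<chi>)) ?xs = []"
      if "length \<psi> = 6" "length \<phi> = V" "length \<chi> = S" for \<psi> \<phi> \<chi>
    proof -
      have "length (map up (rounds_word (rounds_word \<psi> \<phi>) \<chi>)) < ?K"
        using short that by (simp add: mult.commute mult.left_commute)
      from expands_red[OF D this] show ?thesis
        using sorts_perm_of[of \<psi> \<phi> D \<chi>] that pos by simp
    qed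
    then show ?thesis by blast
  qed
  also have "\<dots> \<longleftrightarrow> (\<exists>bs. length bs = n \<and> (\<forall>C \<in> set Cs. satisfied bs C))"
    using schedule_sound[OF _ _ _ Cs R] schedule_complete[OF _ _ Cs(2), of _ R] unfolding V_def S_def by blast
  finally show ?thesis by simp
qed

lemma program_reduces:
  assumes gl: "set gl = tiles M B"
    and N: "length (families (length gl)) + 3 \<le> length w" "6 * (length gl + 3) * length (families (length gl)) \<le> length w"
  shows "finish (program M gl w) \<in> dealers_choice_sort \<longleftrightarrow> (\<exists>\<tau>. tiling M B w \<tau>)"
proof -
  let ?N = "length w" and ?\<kappa> = "length gl" and ?\<phi> = "length (families (length gl))" and ?Cs = "all_clauses M gl w"
  let ?n = "?N\<^sup>2 * ?\<kappa>"
  have n: "?n = ?N * (?N * ?\<kappa>)" by (simp add: power2_eq_square)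
  have "0 < ?\<phi>" by (simp add: families_def)
  moreover have "0 < ?N" using N(1) by linarith
  ultimately have "0 < length ?Cs" by (simp add: length_all_clauses)
  then have Cs: "?Cs \<noteq> []" by simp
  have len: "\<forall>C \<in> set ?Cs. length (snd C) = ?n" 
  proof
    fix C assume "C \<in> set ?Cs"
    then obtain fam t h where "C = grid_clause M gl w fam t h" unfolding set_all_clauses by blast
    then show "length (snd C) = ?n" by (simp only: length_grid_clause n)
  qed
  \<comment> \<open>The constant factor \<open>6 * (\<kappa> + 3) * \<phi>\<close> is paid for by
    the fifth factor \<open>N\<close>.\<close>
  have R: "6 * (?n + 3) * length ?Cs \<le> ?N ^ 5"
  proof -
    have "3 \<le> 3 * ?N\<^sup>2" using N by simp
    then have "?n + 3 \<le> (?\<kappa> + 3) * ?N\<^sup>2" by (simp add: algebra_simps)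
    then have "6 * (?n + 3) * length ?Cs \<le> 6 * ((?\<kappa> + 3) * ?N\<^sup>2) * (?\<phi> * ?N\<^sup>2)"
      unfolding length_all_clauses by (intro mult_le_mono) auto
    also have "\<dots> = (6 * (?\<kappa> + 3) * ?\<phi>) * ?N ^ 4" by (simp add: algebra_simps flip: power_add)
    also have "\<dots> \<le> ?N * ?N ^ 4" using N(2) by (rule mult_le_mono1)
    also have "\<dots> = ?N ^ 5" by (simp flip: power_Suc)
    finally show ?thesis .
  qed
  have "program M gl w = its (frames (?N ^ 5) (?n + 1)) @ its (clauses ?Cs) @ End_mark # replicate (?n + 3) TA @ replicate (?N ^ 5 + length ?Cs) TB"
    by (simp add: program_def Let_def length_all_clauses)
  then have "finish (program M gl w) \<in> dealers_choice_sort \<longleftrightarrow> (\<exists>bs. length bs = ?n \<and> (\<forall>C \<in> set ?Cs. satisfied bs C))"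
    by (simp only: finish_mem[OF Cs len R])
  also have "\<dots> \<longleftrightarrow> (\<exists>bs. length bs = ?N * (?N * ?\<kappa>) \<and>
      (\<forall>fam \<in> set (families ?\<kappa>). \<forall>t < ?N. \<forall>h < ?N. satisfied bs (grid_clause M gl w fam t h)))"
    unfolding n Ball_def[of "set ?Cs"] set_all_clauses by blast
  also have "\<dots> \<longleftrightarrow> (\<exists>\<tau>. tiling M B w \<tau>)" by (rule clauses_iff_tiling[OF gl])
  finally show ?thesis .
qed

text \<open>The padding \<open>c\<close> takes care of the constants, and \<open>e\<close> squarings
  push the side of the square beyond the running time; each of the eight pebbles is one
  loop.\<close>

definition reduction :: "tm \<Rightarrow> tile list \<Rightarrow> nat \<Rightarrow> nat \<Rightarrow> bool list \<Rightarrow> bool list" where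
  "reduction M gl c e x = finish (blockwise (emit_links M gl)
     ((pebble ^^ 8) (index (length (families (length gl)) + 3) ((grow 0 ^^ e) (pad c x)))))"

lemma pf_reduction: "pf UNIV (reduction M gl c e)"
proof -
  let ?A = "{0, 1, 2 :: nat}" and ?K = "length (families (length gl)) + 3"
  let ?C = "\<lambda>d. flat ` lists (lists (cells d ?K ?A))"
  have fin: "finite ?A" by simp
  have pad: "pad c x \<in> single ?A" for x
    unfolding pad_def by (rule singleI) (auto simp: bit_symbol_def)
  have grow: "(grow 0 ^^ e) (pad c x) = flat [map bit_symbol x @ replicate c 0 @ replicate ((length x + c) ^ (2 ^ e) - (length x + c)) 0]" for x
    unfolding pad_def grow_funpow by simp
  have grow_in: "(grow 0 ^^ e) (pad c x) \<in> single ?A" for x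
    unfolding grow by (rule singleI) (auto simp: bit_symbol_def)
  have index_in: "index ?K ys \<in> ?C 0" if "ys \<in> single ?A" for ys
  proof -
    obtain w where w: "ys = flat [w]" "w \<in> lists ?A" using \<open>ys \<in> single ?A\<close> by (auto simp only: single_def)
    have "w ! l \<in> ?A" if "l < length w" for l using that w(2) nth_mem by blast
    then have "block ?K w [] \<in> lists (cells 0 ?K ?A)" unfolding block_def cells_def in_lists_conv_set
      by (auto simp del: insert_iff)
    then show ?thesis unfolding w(1) index_single by (intro imageI) simp
  qed
  have "pf UNIV (\<lambda>x. (grow 0 ^^ e) (pad c x))"
    by (rule pf_comp[OF pf_pad pf_grow_funpow[OF fin] pad]) simp
  from pf_comp[OF this pf_index[OF fin] grow_in]
  have "pf UNIV (\<lambda>x. index ?K ((grow 0 ^^ e) (pad c x)))" .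
  from pf_comp[OF this conjunct1[OF pf_pebble_funpow[OF fin]] index_in[OF grow_in]]
  have "pf UNIV (\<lambda>x. (pebble ^^ 8) (index ?K ((grow 0 ^^ e) (pad c x))))" .
  moreover have "(pebble ^^ 8) (index ?K ((grow 0 ^^ e) (pad c x))) \<in> ?C 8" for x
    using pf_pebble_funpow[OF fin] index_in[OF grow_in] by blast
  ultimately have "pf UNIV (\<lambda>x. blockwise (emit_links M gl) ((pebble ^^ 8) (index ?K ((grow 0 ^^ e) (pad c x)))))"
    using pf_comp[OF _ pf_blockwise[OF finite_cells[OF fin]]] by blast
  from pf_comp[OF this pf_finish] show ?thesis unfolding reduction_def by simp
qed

lemma reduction_eq:
  fixes c e :: nat and x :: "bool list"
  defines "N \<equiv> (length x + c) ^ (2 ^ e)"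
  assumes N: "length (families (length gl)) + 3 \<le> N"
  shows "reduction M gl c e x = finish (program M gl (map bit_symbol x @ replicate (N - length x) 0))"
proof -
  let ?K = "length (families (length gl)) + 3"
  let ?w = "map bit_symbol x @ replicate (N - length x) 0"
  have "0 < length x + c" using N unfolding N_def by (cases "length x + c = 0") (auto simp: zero_power)
  then have le: "length x + c \<le> N" unfolding N_def by (intro self_le_power) (linarith, simp)
  then have len: "length ?w = N" by simp
  have "replicate c (0 :: nat) @ replicate (N - (length x + c)) 0 = replicate (N - length x) 0"
    using le by (simp flip: replicate_add)
  then have "(grow 0 ^^ e) (pad c x) = flat [?w]"
    unfolding pad_def grow_funpow by (simp add: N_def)
  then have "(pebble ^^ 8) (index ?K ((grow 0 ^^ e) (pad c x))) = flat (map (block ?K ?w) (tup N 8))"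
    by (simp only: index_single pebble_funpow len)
  then have "reduction M gl c e x = finish (concat (map (\<lambda>is. emit_links M gl (adj None (block ?K ?w is))) (tup N 8)))"
    by (simp add: reduction_def blockwise_flat comp_def)
  also have "map (\<lambda>is. emit_links M gl (adj None (block ?K ?w is))) (tup N 8) = map (emit_tuple M gl ?w) (tup N 8)"
  proof (rule map_cong[OF refl])
    fix js assume "js \<in> set (tup N 8)"
    then have "length js = 8" "\<forall>j \<in> set js. j < length ?w" unfolding len by (auto simp: set_tup)
    moreover have "?w \<noteq> []" using len N by (metis add_is_0 le_zero_eq list.size(3) numeral_eq_Suc Zero_not_Suc)
    ultimately show "emit_links M gl (adj None (block ?K ?w js)) = emit_tuple M gl ?w js"
      by (intro emit_links_block)
  qed
  also have "concat (map (emit_tuple M gl ?w) (tup N 8)) = program M gl ?w"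
    using emit_tuple_program[of gl ?w M] N len by simp
  finally show ?thesis .
qed

text \<open>The exponent is a power of two because padding squares lengths. An exponent
  \<open>d\<close> is found by induction, and it may be raised to \<open>2 ^ d\<close> since the
  base \<open>n + Suc a\<close> is positive.\<close>

lemma poly_dominated:
  fixes p :: "nat poly"
  shows "\<exists>a d. \<forall>n. poly p n < (n + a) ^ (2 ^ d)"
proof -
  have "\<exists>a d. \<forall>n. poly p n < (n + Suc a) ^ d"
  proof (induction p)
    case 0
    show ?case by (intro exI[of _ 0]) simp
  next
    case (pCons b p)
    then obtain a d where IH: "\<And>n. poly p n < (n + Suc a) ^ d" by blast
    have "poly (pCons b p) n < (n + Suc (a + b)) ^ Suc d" for n
    proof -
      let ?X = "(n + Suc (a + b)) ^ d"
      have "poly p n \<le> ?X" using IH[of n] power_mono[of "n + Suc a" "n + Suc (a + b)" d] by linarith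
      then have "n * poly p n \<le> n * ?X" by (rule mult_le_mono2)
      moreover have "b * 1 \<le> b * ?X" by (rule mult_le_mono2) (simp add: Suc_leI)
      moreover have "0 < ?X" by simp
      ultimately have "poly (pCons b p) n < b * ?X + n * ?X + ?X" unfolding poly_pCons by linarith
      also have "\<dots> \<le> (n + Suc (a + b)) ^ Suc d" by (simp add: algebra_simps)
      finally show ?thesis .
    qed
    then show ?case by blast
  qed
  then obtain a d where p: "\<And>n. poly p n < (n + Suc a) ^ d" by blast
  have "(n + Suc a) ^ d \<le> (n + Suc a) ^ (2 ^ d)" for n
    by (rule power_increasing) (auto intro: less_imp_le less_exp)
  then show ?thesis using p by (meson less_le_trans)
qed

theorem theorem1: "NP_hard dealers_choice_sort"
  unfolding NP_hard_def
proof
  fix A assume "A \<in> NP"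
  then obtain M and p :: "nat poly" where M: "wf_tm M"
    "\<And>x n c. (step M ^^ n) (initial_config M x) c \<Longrightarrow> n \<le> poly p (length x)"
    "\<And>x. x \<in> A \<longleftrightarrow> accepts M x"
    unfolding NP_def by blast
  define symbols where "symbols = (\<Union>(q, rs, q', ws, ds) \<in> rules M. set ws)"
  have "finite symbols" using M(1) unfolding symbols_def wf_tm_def by auto
  \<comment> \<open>3 accounts for the blank and the two bits; other symbols reach a tape only
    through rules.\<close>
  then obtain B where B: "3 \<le> B" "symbols \<subseteq> {..<B}"
    using finite_nat_set_iff_bounded[of "symbols"] by (meson less_le_trans lessThan_iff max.cobounded1 max.cobounded2 subsetI)
  have writes: "set ws \<subseteq> {..<B}" if "(q, rs, q', ws, ds) \<in> rules M" for q rs q' ws ds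
    using that B(2) unfolding symbols_def by fastforce
  obtain gl where gl: "set gl = tiles M B" using finite_list[OF finite_tiles[OF M(1)]] by blast
  let ?\<kappa> = "length gl" and ?\<phi> = "length (families (length gl))"
  obtain a e where p: "\<And>n. poly p n < (n + a) ^ (2 ^ e)" using poly_dominated[of p] by blast
  \<comment> \<open>The sum covers all lower bounds on the side of the square at once: the offset
    \<open>a\<close> of the time bound, the range of the outermost loop, and the constant factor in
    the number of frames.\<close>
  define c where "c = a + ?\<phi> + 3 + 6 * (?\<kappa> + 3) * ?\<phi>"
  have "x \<in> A \<longleftrightarrow> reduction M gl c e x \<in> dealers_choice_sort" for x
  proof -
    define N where "N = (length x + c) ^ (2 ^ e)"
    define w where "w = map bit_symbol x @ replicate (N - length x) 0"
    have "length x + c \<le> N" unfolding N_def c_def by (intro self_le_power) auto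
    then have len: "length w = N" and N: "?\<phi> + 3 \<le> N" "6 * (?\<kappa> + 3) * ?\<phi> \<le> N" "1 < N"
      by (simp_all add: w_def c_def)
    have "(length x + a) ^ (2 ^ e) \<le> N" unfolding N_def c_def by (intro power_mono) auto
    then have "poly p (length x) < N" using p[of "length x"] by linarith
    have "x \<in> A \<longleftrightarrow> (\<exists>\<tau>. tiling M B w \<tau>)"
    proof
      assume "x \<in> A"
      then obtain n c' where c': "(step M ^^ n) (initial_config M x) c'" "fst c' = accept_state M"
        using M(3) unfolding accepts_def by (meson rtranclp_imp_relpowp)
      then have "n < length w" using M(2)[OF c'(1)] \<open>poly p (length x) < N\<close> len by linarith
      then show "\<exists>\<tau>. tiling M B w \<tau>"
        by (intro accepts_tiling[OF M(1) c' B(1) writes w_def]) (use len N(3) in auto)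
    next
      assume "\<exists>\<tau>. tiling M B w \<tau>"
      then show "x \<in> A" using tiling_accepts[OF M(1) _ w_def] len N(3) M(3) by blast
    qed
    also have "\<dots> \<longleftrightarrow> finish (program M gl w) \<in> dealers_choice_sort"
      using program_reduces[OF gl, of w] N len by simp
    also have "finish (program M gl w) = reduction M gl c e x"
      using reduction_eq[of gl x c e M] N(1) unfolding N_def w_def by simp
    finally show ?thesis .
  qed
  then show "A \<le>\<^sub>p dealers_choice_sort"
    using pf_imp_polytime_computable[OF pf_reduction] unfolding polytime_reducible_def by blast
qed

end
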